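(* Consider the stable $GI/GI/1$ feedback queue ($\rho=\lambda b/q<1$) with service time distribution $G$, and assume that $G$ is intermediate regularly varying. If the tagged customer finds the system empty upon arrival, then its sojourn time $U$ satisfies $$\mathbb{P}(U>x)\ \sim\ \frac1q\,\mathbb{E}\big(1+X^{(0)}_{K-1}\big)\,\mathbb{P}\big((1+m^{(0)}_{K-1})\,\sigma>x\big)\qquad\text{as }x\to\infty,$$ where $m^{(0)}_k=\frac{1-r^k}{1-r}\lambda b$ for $k\ge 0$, $r=p+\lambda b$, and the random variable $K$ does not depend on $\{X^{(0)}_k\}$ and $\sigma$.
   Context: $GI/GI/1$ feedback queue: exogenous customers arrive to a single server as a renewal process with i.i.d. inter-arrival times of finite mean $a>0$; $\lambda=1/a$; $N^e(t)$ is the number of exogenous arrivals in $(0,t]$, counted after the arrival of the tagged customer at time $0$. Customers are served in the order of their (external and internal) arrivals to the queue. All service times are i.i.d. with distribution $G$ on the nonnegative half-line with finite mean $b>0$, independent of the arrival process; $\sigma$ denotes a random variable with distribution $G$. A customer completing a service returns to the end of the queue for another service with probability $p\in(0,1)$ or leaves the system with probability $q=1-p$, independently of everything else. Stability means $\rho=\lambda b/q<1$ (equivalently $r=p+\lambda b<1$). Tagged customer: it arrives at time $0$ and finds the system empty. Its number of services $K$ has $\mathbb{P}(K=k)=qp^{k-1}$, $k\ge1$, and is independent of everything else. Put $X_0=0$, $T_0=0$ and, for $k\ge1$, $$U_k=\sum_{i=0}^{X_{k-1}}\sigma_{k,i},\qquad T_k=T_{k-1}+U_k,\qquad X_k=N^e(T_k)-N^e(T_{k-1})+N^B_k(X_{k-1}),$$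 where the $\sigma_{k,i}$ are i.i.d. with distribution $G$, $N^B_k(n)$ is Binomial with parameters $n,p$, and the families $\{\sigma_{k,i}\}$, $\{N_k^B(\cdot)\}$, $N^e$, $K$ are independent, with the $N_k^B$ independent over $k$. ($X_k$ is the queue length behind the tagged customer when it finishes its $k$th service; $\sigma_{k,0}$ is its $k$th service time.) $X_k^{(0)}$ denotes this $X_k$ (with $X_0=0$). The recursion is used for all $k$, independently of $K$. The sojourn time is $U=\sum_{k=1}^K U_k$. A distribution $F$ with tail $\overline F=1-F$, $\overline F(x)>0$ for all $x$, is intermediate regularly varying if $\lim_{\alpha\downarrow1}\liminf_{x\to\infty}\overline F(\alpha x)/\overline F(x)=1$. $f(x)\sim g(x)$ means $f(x)/g(x)\to1$ as $x\to\infty$. *)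

theory Defs
  imports "HOL-Probability.Probability" "HOL-Library.Landau_Symbols"
begin

definition tail :: "real measure \<Rightarrow> real \<Rightarrow> real" where
  "tail F x = 1 - cdf F x"

text \<open>The inner liminf is taken in \<^typ>\<open>ereal\<close>, where it always exists.\<close>

definition intermediate_regularly_varying :: "real measure \<Rightarrow> bool" where
  "intermediate_regularly_varying F \<longleftrightarrow>
     (\<forall>x. tail F x > 0) \<and>
     ((\<lambda>\<alpha>. Liminf at_top (\<lambda>x. ereal (tail F (\<alpha> * x) / tail F x))) \<longlongrightarrow> 1) (at_right 1)"

text \<open>
  The definitions up to \<open>sojourn_time\<close> are pathwise: \<open>\<tau>\<close>, \<open>s\<close>, \<open>nb\<close> are realisations of the
  inter-arrival times (indexed from 1), of the service times \<open>\<sigma>\<^sub>k\<^sub>,\<^sub>i\<close> (\<open>k \<ge> 1\<close>, \<open>i \<ge> 0\<close>) and of the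
  counts \<open>N\<^sup>B\<^sub>k(n)\<close> (\<open>k \<ge> 1\<close>, \<open>n \<ge> 0\<close>).
  The set of arrivals in \<open>renewal_count\<close> is almost surely finite for i.i.d. nonnegative
  inter-arrival times of positive mean, and the count is then monotone in \<open>t\<close>, so the
  convention \<open>card A = 0\<close> for infinite \<open>A\<close> and the truncated subtraction in \<open>queue_behind\<close>
  have no effect outside a null set.
\<close>

definition renewal_count :: "(nat \<Rightarrow> real) \<Rightarrow> real \<Rightarrow> nat" where
  "renewal_count \<tau> t = card {n. n \<ge> 1 \<and> 0 < (\<Sum>j=1..n. \<tau> j) \<and> (\<Sum>j=1..n. \<tau> j) \<le> t}"

fun service_epoch :: "(nat \<Rightarrow> real) \<Rightarrow> (nat \<Rightarrow> nat \<Rightarrow> real) \<Rightarrow> (nat \<Rightarrow> nat \<Rightarrow> nat) \<Rightarrow> nat \<Rightarrow> real"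
  and queue_behind :: "(nat \<Rightarrow> real) \<Rightarrow> (nat \<Rightarrow> nat \<Rightarrow> real) \<Rightarrow> (nat \<Rightarrow> nat \<Rightarrow> nat) \<Rightarrow> nat \<Rightarrow> nat"
where
  "service_epoch \<tau> s nb 0 = 0"
| "service_epoch \<tau> s nb (Suc k) =
     service_epoch \<tau> s nb k + (\<Sum>i=0..queue_behind \<tau> s nb k. s (Suc k) i)"
| "queue_behind \<tau> s nb 0 = 0"
| "queue_behind \<tau> s nb (Suc k) =
     renewal_count \<tau> (service_epoch \<tau> s nb (Suc k)) - renewal_count \<tau> (service_epoch \<tau> s nb k)
     + nb (Suc k) (queue_behind \<tau> s nb k)"

definition cycle_length ::
  "(nat \<Rightarrow> real) \<Rightarrow> (nat \<Rightarrow> nat \<Rightarrow> real) \<Rightarrow> (nat \<Rightarrow> nat \<Rightarrow> nat) \<Rightarrow> nat \<Rightarrow> real" where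
  "cycle_length \<tau> s nb k = (\<Sum>i=0..queue_behind \<tau> s nb (k - 1). s k i)"

definition sojourn_time ::
  "(nat \<Rightarrow> real) \<Rightarrow> (nat \<Rightarrow> nat \<Rightarrow> real) \<Rightarrow> (nat \<Rightarrow> nat \<Rightarrow> nat) \<Rightarrow> nat \<Rightarrow> real" where
  "sojourn_time \<tau> s nb K = (\<Sum>k=1..K. cycle_length \<tau> s nb k)"

text \<open>
  The sources of randomness take values in different spaces, so their mutual independence is
  expressed through the \<open>\<sigma>\<close>-algebras they generate.  For each \<open>k\<close> the whole family
  \<open>N\<^sup>B\<^sub>k(\<cdot>)\<close> is one source: nothing is assumed on its dependence structure over \<open>n\<close>.
\<close>

datatype source = Interarrival nat | Service nat nat | Feedback nat | Services_of_tagged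

locale feedback_queue = prob_space M
  for M :: "'a measure" +
  fixes G :: "real measure"
    and a b p :: real
    and \<tau> :: "nat \<Rightarrow> 'a \<Rightarrow> real"
    and \<sigma> :: "nat \<Rightarrow> nat \<Rightarrow> 'a \<Rightarrow> real"
    and NB :: "nat \<Rightarrow> nat \<Rightarrow> 'a \<Rightarrow> nat"
    and K :: "'a \<Rightarrow> nat"
  assumes p_pos: "0 < p" and p_less_1: "p < 1"
    and G_distribution: "real_distribution G"
    and G_nonneg: "AE x in G. 0 \<le> x"
    and G_integrable: "integrable G (\<lambda>x. x)"
    and G_mean: "(\<integral>x. x \<partial>G) = b"
    and b_pos: "0 < b"
    and interarrival_measurable: "\<And>n. n \<ge> 1 \<Longrightarrow> random_variable borel (\<tau> n)"
    and interarrival_identically_distributed: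
      "\<And>n. n \<ge> 1 \<Longrightarrow> distr M borel (\<tau> n) = distr M borel (\<tau> 1)"
    and interarrival_nonneg: "AE \<omega> in M. 0 \<le> \<tau> 1 \<omega>"
    and interarrival_integrable: "integrable M (\<tau> 1)"
    and interarrival_mean: "expectation (\<tau> 1) = a"
    and a_pos: "0 < a"
    and service_measurable: "\<And>k i. k \<ge> 1 \<Longrightarrow> random_variable borel (\<sigma> k i)"
    and service_distribution: "\<And>k i. k \<ge> 1 \<Longrightarrow> distr M borel (\<sigma> k i) = G"
    and feedback_measurable:
      "\<And>k n. k \<ge> 1 \<Longrightarrow> random_variable (count_space UNIV) (NB k n)"
    and feedback_distribution:
      "\<And>k n. k \<ge> 1 \<Longrightarrow> distr M (count_space UNIV) (NB k n) = measure_pmf (binomial_pmf n p)"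
    and K_measurable: "random_variable (count_space UNIV) K"
    and K_distribution:
      "\<And>k. k \<ge> 1 \<Longrightarrow> prob {\<omega> \<in> space M. K \<omega> = k} = (1 - p) * p ^ (k - 1)"
    and independent_sources:
      "indep_sets
         (\<lambda>src. case src of
             Interarrival n \<Rightarrow> sets (vimage_algebra (space M) (\<tau> n) borel)
           | Service k i \<Rightarrow> sets (vimage_algebra (space M) (\<sigma> k i) borel)
           | Feedback k \<Rightarrow> sets (vimage_algebra (space M) (\<lambda>\<omega> n. NB k n \<omega>)
               (Pi\<^sub>M UNIV (\<lambda>_. count_space UNIV)))
           | Services_of_tagged \<Rightarrow> sets (vimage_algebra (space M) K (count_space UNIV)))
         ({Interarrival n |n. n \<ge> 1} \<union> {Service k i |k i. k \<ge> 1} \<union>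
          {Feedback k |k. k \<ge> 1} \<union> {Services_of_tagged})"

end

theory Submission
  imports Defs "HOL-Real_Asymp.Real_Asymp"
begin

text \<open>
  A long sojourn time is caused by one exceptionally long service.  Write \<open>F\<close> for the tail of \<open>G\<close>,
  and let a service of length \<open>y\<close> take place while the tagged customer waits for the end of some
  round, with \<open>l\<close> further rounds to come.  About \<open>lam * y\<close> customers arrive during that service.
  A customer present at the beginning of a round takes a time \<open>b\<close> of that round on average, and
  is replaced by \<open>r = p + lam * b\<close> customers at its end; so one queued customer costs
  \<open>b + b r + \<dots> + b r\<^sup>l\<^sup>-\<^sup>1\<close>, called \<open>backlog_time l\<close> below, and the service of length \<open>y\<close> postpones the
  end of the last round by \<open>stretch l * y\<close>, where \<open>stretch l = 1 + lam * backlog_time l\<close>.  Round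
  \<open>j + 1\<close> contains \<open>1 + X j\<close> services, any of which may be the long one, hence
  \<open>P (T k > x)\<close> is asymptotically \<open>\<Sum>j<k. E (1 + X j) * F (x / stretch (k - 1 - j))\<close>
  (\<open>prob_T_asymp\<close>).  Weighting with the geometric law of \<open>K\<close> turns this into a Cauchy product,
  which factorises into the expectation and the mixed tail of the theorem and leaves the factor
  \<open>1 / (1 - p)\<close> (\<open>jump_sum_mixture\<close>).

  For a fixed number \<open>k\<close> of rounds the argument follows the functional
  \<open>L j = T j + backlog_time (k - j) * X j\<close>, which predicts \<open>T k = L k\<close> from the state after \<open>j\<close>
  rounds.  Apart from a bounded mean contribution of the tagged customer, a round changes \<open>L\<close> only
  by fluctuations, and these are of order \<open>x\<close> with probability \<open>o (F x)\<close> unless the round contains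
  a service of order \<open>x\<close>; one such service \<open>y\<close> adds \<open>stretch (k - 1 - j) * y\<close>
  (\<open>prob_step_upper\<close> for the upper bound, \<open>T_large_after_jump\<close> for the lower one).
  The errors in the size of the jump disappear in the end because \<open>G\<close> is intermediate
  regularly varying.

  Two features of the model determine the tools.  The services only have a mean, so the
  fluctuations of a sum of \<open>n\<close> truncated services cannot be bounded by a power of \<open>x\<close>; the bound is
  the square of \<open>n * F (\<epsilon> * x)\<close> (\<open>truncated_sum_upper_tail\<close>), one factor of which is small.  And the
  arrivals during a round depend on the past through the residual inter-arrival time; instead of
  regenerating the arrival process, increments are bounded uniformly over a long time window
  (\<open>renewal_increment_le\<close>), where inter-arrival times being nonnegative gives exponential bounds.

  Finally, limit and sum over the number of rounds may be exchanged since
  \<open>P (T k > x)\<close> is at most a polynomial in \<open>k\<close> times \<open>F x\<close>, for all \<open>x\<close> (\<open>prob_T_gt_le\<close>).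
\<close>

section \<open>Intermediate regularly varying tails\<close>

locale irv_distribution = real_distribution G for G :: "real measure" +
  fixes b :: real
  assumes nonneg: "AE x in G. 0 \<le> x"
    and integrable_id: "integrable G (\<lambda>x. x)"
    and mean: "(\<integral>x. x \<partial>G) = b"
    and irv: "intermediate_regularly_varying G"
begin

lemma tail_eq: "tail G x = prob {x<..}"
proof -
  have "{x<..} = space G - {..x}" by auto
  then show ?thesis
    unfolding tail_def cdf_def by (subst \<open>{x<..} = _\<close>, subst prob_compl) auto
qed

lemma tail_antimono: "x \<le> y \<Longrightarrow> tail G y \<le> tail G x"
  unfolding tail_eq by (intro finite_measure_mono) auto

lemma tail_le_1: "tail G x \<le> 1"
  unfolding tail_eq by simp

lemma tail_pos: "0 < tail G x"
  using irv unfolding intermediate_regularly_varying_def by auto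

lemma tail_nonneg: "0 \<le> tail G x"
  using tail_pos[of x] by simp

lemma tail_stretch_ge:
  assumes "0 < \<eta>"
  shows "\<exists>\<alpha>>1. \<forall>\<^sub>F x in at_top. (1 - \<eta>) * tail G x \<le> tail G (\<alpha> * x)"
proof -
  let ?L = "\<lambda>\<alpha>. Liminf at_top (\<lambda>x. ereal (tail G (\<alpha> * x) / tail G x))"
  have "(?L \<longlongrightarrow> 1) (at_right 1)"
    using irv unfolding intermediate_regularly_varying_def by auto
  moreover have "ereal (1 - \<eta>) < 1" using assms by (simp add: one_ereal_def)
  ultimately have "\<forall>\<^sub>F \<alpha> in at_right 1. ereal (1 - \<eta>) < ?L \<alpha>"
    by (rule order_tendstoD)
  moreover have "\<forall>\<^sub>F \<alpha> in at_right (1::real). 1 < \<alpha>"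
    by (simp add: eventually_at_right_less)
  ultimately have "\<forall>\<^sub>F \<alpha> in at_right 1. 1 < \<alpha> \<and> ereal (1 - \<eta>) < ?L \<alpha>"
    by eventually_elim auto
  then obtain \<alpha> where \<alpha>: "1 < \<alpha>" "ereal (1 - \<eta>) < ?L \<alpha>"
    using eventually_happens'[OF trivial_limit_at_right_real] by blast
  from less_LiminfD[OF \<alpha>(2)]
  have "\<forall>\<^sub>F x in at_top. (1 - \<eta>) * tail G x \<le> tail G (\<alpha> * x)"
  proof eventually_elim
    case (elim x)
    then have "1 - \<eta> < tail G (\<alpha> * x) / tail G x" by simp
    then show ?case using tail_pos[of x] by (simp add: pos_less_divide_eq)
  qed
  with \<alpha>(1) show ?thesis by auto
qed

text \<open>
  The definition compares \<open>F (\<alpha> x)\<close> with \<open>F x\<close>; replacing \<open>x\<close> by \<open>x / \<alpha>\<close> gives the form with a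
  contracted argument, in which upper bounds use it.
\<close>

lemma tail_shrink_le:
  assumes "0 < \<eta>"
  obtains \<delta> where "0 < \<delta>" "\<delta> < 1/2" "\<forall>\<^sub>F x in at_top. tail G ((1 - \<delta>) * x) \<le> (1 + \<eta>) * tail G x"
proof -
  define \<eta>' where "\<eta>' = \<eta> / (1 + \<eta>)"
  have \<eta>': "0 < \<eta>'" "1 - \<eta>' = 1 / (1 + \<eta>)" using assms by (auto simp: \<eta>'_def field_simps)
  from tail_stretch_ge[OF \<eta>'(1)] obtain \<alpha> where \<alpha>: "1 < \<alpha>"
    "\<forall>\<^sub>F x in at_top. (1 - \<eta>') * tail G x \<le> tail G (\<alpha> * x)" by auto
  define \<delta> where "\<delta> = min (1/4) (1 - 1/\<alpha>)"
  have \<delta>: "0 < \<delta>" "\<delta> < 1/2" "1/\<alpha> \<le> 1 - \<delta>" using \<alpha>(1) by (auto simp: \<delta>_def min_def field_simps)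
  have "filterlim (\<lambda>x. x * (1 / \<alpha>)) at_top at_top"
    using \<alpha>(1) by (intro filterlim_at_top_mult_tendsto_pos[OF tendsto_const _ filterlim_ident]) auto
  then have "filterlim (\<lambda>x. x / \<alpha>) at_top at_top" by simp
  from eventually_compose_filterlim[OF \<alpha>(2) this]
  have "\<forall>\<^sub>F x in at_top. tail G (x / \<alpha>) \<le> (1 + \<eta>) * tail G x"
    by eventually_elim (use \<alpha>(1) \<eta>'(2) assms in \<open>auto simp: field_simps\<close>)
  moreover have "\<forall>\<^sub>F x in at_top. (0::real) < x" by (rule eventually_gt_at_top)
  ultimately have "\<forall>\<^sub>F x in at_top. tail G ((1 - \<delta>) * x) \<le> (1 + \<eta>) * tail G x"
  proof eventually_elim
    case (elim x)
    have "1/\<alpha> * x \<le> (1 - \<delta>) * x" using \<delta>(3) elim(2) by (intro mult_right_mono) auto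
    then have "tail G ((1 - \<delta>) * x) \<le> tail G (x/\<alpha>)" by (intro tail_antimono) auto
    with elim(1) show ?case by simp
  qed
  with \<delta> that show ?thesis by blast
qed

text \<open>
  For large \<open>x\<close>, finitely many contractions by a fixed factor, each of which at most doubles the
  tail, halve the argument.  On the remaining half-line up to some \<open>X\<close> the constant \<open>1 / F X\<close> does,
  as the tail is positive.  So dominated variation holds with one constant for all \<open>x\<close>.
\<close>

lemma tail_half_le:
  obtains D where "1 \<le> D" "\<And>x. tail G (x / 2) \<le> D * tail G x"
proof -
  from tail_shrink_le[of 1] obtain \<delta> where \<delta>: "0 < \<delta>" "\<delta> < 1/2"
    "\<forall>\<^sub>F x in at_top. tail G ((1 - \<delta>) * x) \<le> (1 + 1) * tail G x" by auto
  from \<delta>(3) obtain x0 where x0: "\<And>x. x \<ge> x0 \<Longrightarrow> tail G ((1 - \<delta>) * x) \<le> 2 * tail G x"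
    by (auto simp: eventually_at_top_linorder)
  define x1 where "x1 = max x0 1"
  obtain n where n: "(1 - \<delta>) ^ n < 1/2"
    using real_arch_pow_inv[of "1/2" "1 - \<delta>"] \<delta> by auto
  have iter: "tail G ((1 - \<delta>) ^ i * x) \<le> 2 ^ i * tail G x" if "x1 / (1 - \<delta>) ^ i \<le> x" for i x
    using that
  proof (induction i arbitrary: x)
    case (Suc i)
    have d: "0 < 1 - \<delta>" "1 - \<delta> < 1" using \<delta> by auto
    have p: "(1 - \<delta>) ^ i \<le> 1" "0 < (1 - \<delta>) ^ i" "(1 - \<delta>) ^ Suc i \<le> 1" "0 < (1 - \<delta>) ^ Suc i"
      using d by (auto simp: power_le_one simp del: power_Suc)
    have "x1 \<le> x * (1 - \<delta>) ^ Suc i" using Suc.prems p by (simp add: field_simps del: power_Suc)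
    moreover have "0 < x1" by (simp add: x1_def)
    ultimately have xp: "0 < x" using p by (metis less_le_trans zero_less_mult_pos2)
    have "x * (1 - \<delta>) ^ Suc i \<le> x * 1" using p xp by (intro mult_left_mono) auto
    then have "x0 \<le> x" using \<open>x1 \<le> _\<close> by (simp add: x1_def)
    have "x1 / (1 - \<delta>) ^ i \<le> (1 - \<delta>) * x"
      using \<open>x1 \<le> x * (1 - \<delta>) ^ Suc i\<close> p by (simp add: field_simps)
    from Suc.IH[OF this]
    have "tail G ((1 - \<delta>) ^ Suc i * x) \<le> 2 ^ i * tail G ((1 - \<delta>) * x)" by (simp add: mult_ac)
    also have "\<dots> \<le> 2 ^ i * (2 * tail G x)" using x0[OF \<open>x0 \<le> x\<close>] by simp
    finally show ?case by simp
  qed simp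
  define X where "X = x1 / (1 - \<delta>) ^ n"
  have Xp: "0 < X" using \<delta> by (simp add: X_def x1_def)
  define D where "D = max (2 ^ n) (1 / tail G X)"
  have D1: "1 \<le> D" by (auto simp: D_def le_max_iff_disj)
  have "tail G (x / 2) \<le> D * tail G x" for x
  proof (cases "X \<le> x")
    case True
    have "(1 - \<delta>) ^ n * x \<le> 1/2 * x" using n True Xp by (intro mult_right_mono) auto
    then have "tail G (x / 2) \<le> tail G ((1 - \<delta>) ^ n * x)" by (intro tail_antimono) auto
    also have "\<dots> \<le> 2 ^ n * tail G x" using True by (intro iter) (simp add: X_def)
    also have "\<dots> \<le> D * tail G x" by (intro mult_right_mono tail_nonneg) (simp add: D_def)
    finally show ?thesis .
  next
    case False
    have "tail G (x / 2) \<le> 1" by (rule tail_le_1)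
    also have "1 = 1 / tail G X * tail G X" using tail_pos[of X] by simp
    also have "\<dots> \<le> D * tail G x"
      using False D1 tail_pos[of X] by (intro mult_mono tail_antimono tail_nonneg) (auto simp: D_def)
    finally show ?thesis .
  qed
  with D1 that show ?thesis by blast
qed

text \<open>
  About \<open>log\<^sub>2 k\<close> halvings divide by \<open>k\<close>.  The bound is polynomial in \<open>k\<close>, which is what makes
  estimates for \<open>k\<close> rounds summable against the geometric weights \<open>p ^ k\<close>.
\<close>

lemma tail_divide_le:
  obtains C d where "1 \<le> C" "\<And>x k. 0 \<le> x \<Longrightarrow> 1 \<le> k \<Longrightarrow> tail G (x / real k) \<le> C * real k ^ d * tail G x"
proof -
  obtain D where D: "1 \<le> D" "\<And>x. tail G (x / 2) \<le> D * tail G x" using tail_half_le by blast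
  obtain d where d: "D \<le> 2 ^ d" using real_arch_pow[of 2 D] by (auto intro: less_imp_le)
  have iter: "tail G (x / 2 ^ i) \<le> D ^ i * tail G x" for i x
  proof (induction i arbitrary: x)
    case (Suc i)
    have "tail G (x / 2 ^ Suc i) = tail G ((x/2) / 2 ^ i)" by (simp add: field_simps)
    also have "\<dots> \<le> D ^ i * tail G (x/2)" by (rule Suc)
    also have "\<dots> \<le> D ^ i * (D * tail G x)" using D by (intro mult_left_mono) auto
    finally show ?case by (simp add: mult_ac)
  qed simp
  have "tail G (x / real k) \<le> D * real k ^ d * tail G x" if x: "0 \<le> x" and k: "1 \<le> k" for x k
  proof -
    obtain j where j: "2 ^ j \<le> k" "k < 2 ^ (j+1)"
      using ex_power_ivl1[of 2 k] k by auto
    have j': "2 ^ j \<le> real k" "real k < 2 ^ Suc j"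
      using j by (metis of_nat_le_iff of_nat_numeral of_nat_power)
       (metis j(2) Suc_eq_plus1 of_nat_less_iff of_nat_numeral of_nat_power)
    have "x / 2 ^ Suc j \<le> x / real k" using x j' k by (intro divide_left_mono) auto
    then have "tail G (x / real k) \<le> tail G (x / 2 ^ Suc j)" by (rule tail_antimono)
    also have "\<dots> \<le> D ^ Suc j * tail G x" by (rule iter)
    also have "\<dots> \<le> D * real k ^ d * tail G x"
    proof (rule mult_right_mono[OF _ tail_nonneg])
      have "D ^ j \<le> (2 ^ d) ^ j" using d D by (intro power_mono) auto
      also have "\<dots> = (2 ^ j) ^ d" by (simp add: mult.commute flip: power_mult)
      also have "\<dots> \<le> real k ^ d" using j' by (intro power_mono) auto
      finally show "D ^ Suc j \<le> D * real k ^ d" using D by simp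
    qed
    finally show ?thesis .
  qed
  with D(1) that show ?thesis by blast
qed

lemma tail_scale_le:
  assumes "0 < \<kappa>"
  obtains C where "1 \<le> C" "\<And>x. 0 \<le> x \<Longrightarrow> tail G (\<kappa> * x) \<le> C * tail G x"
proof -
  obtain C d where C: "1 \<le> C" "\<And>x k. 0 \<le> x \<Longrightarrow> 1 \<le> k \<Longrightarrow> tail G (x / real k) \<le> C * real k ^ d * tail G x"
    using tail_divide_le by metis
  obtain k where k: "1 / \<kappa> < real k" using reals_Archimedean2 by blast
  have k1: "1 \<le> k" using k assms by (cases k) (auto simp: divide_less_0_iff)
  have "tail G (\<kappa> * x) \<le> (C * real k ^ d) * tail G x" if "0 \<le> x" for x
  proof -
    have "1 / real k \<le> \<kappa>" using k assms k1 by (simp add: field_simps)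
    then have "x / real k \<le> x * \<kappa>" using mult_left_mono[OF _ that] by fastforce
    then have "tail G (\<kappa> * x) \<le> tail G (x / real k)" by (intro tail_antimono) (simp add: mult.commute)
    also have "\<dots> \<le> C * real k ^ d * tail G x" by (rule C(2)[OF that k1])
    finally show ?thesis .
  qed
  moreover have "1 \<le> C * real k ^ d" using C(1) k1 by (metis mult_ge1_I of_nat_1 of_nat_le_iff one_le_power)
  ultimately show ?thesis using that by blast
qed

text \<open>
  Division of \<open>x\<close> by an integer of its own size leads to a bounded argument.  Hence errors that
  are exponentially small in \<open>x\<close> are negligible against the tail.
\<close>

lemma tail_ge_inverse_power:
  obtains C d where "0 < C" "\<And>x. 1 \<le> x \<Longrightarrow> 1 \<le> C * x ^ d * tail G x"
proof -
  obtain C d where C: "1 \<le> C" "\<And>x k. 0 \<le> x \<Longrightarrow> 1 \<le> k \<Longrightarrow> tail G (x / real k) \<le> C * real k ^ d * tail G x"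
    using tail_divide_le by metis
  have "1 \<le> (C * 2 ^ d / tail G 1) * x ^ d * tail G x" if x: "1 \<le> x" for x
  proof -
    define k where "k = nat \<lceil>x\<rceil>"
    have k: "1 \<le> k" "x \<le> real k" "real k \<le> 2 * x" using x unfolding k_def by linarith+
    have "tail G 1 \<le> tail G (x / real k)" using k x by (intro tail_antimono) (auto simp: field_simps)
    also have "\<dots> \<le> C * real k ^ d * tail G x" using C(2) x k by simp
    also have "\<dots> \<le> C * (2 * x) ^ d * tail G x"
      using k C(1) by (intro mult_right_mono mult_left_mono power_mono tail_nonneg) auto
    finally show ?thesis using tail_pos[of 1] by (simp add: field_simps)
  qed
  moreover have "0 < C * 2 ^ d / tail G 1" using C(1) tail_pos[of 1] by simp
  ultimately show ?thesis using that by blast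
qed

lemma exp_smallo_tail:
  assumes "0 < c"
  shows "((\<lambda>x. exp (- c * x) / tail G x) \<longlongrightarrow> 0) at_top"
proof -
  obtain C d where C: "0 < C" "\<And>x. 1 \<le> x \<Longrightarrow> 1 \<le> C * x ^ d * tail G x" using tail_ge_inverse_power by blast
  have "filterlim (\<lambda>x. x * c) at_top at_top"
    using assms by (intro filterlim_at_top_mult_tendsto_pos[OF tendsto_const _ filterlim_ident]) auto
  from filterlim_compose[OF tendsto_power_div_exp_0 this]
  have "((\<lambda>x. (x * c) ^ d / exp (x * c)) \<longlongrightarrow> 0) at_top" .
  from tendsto_mult_left[OF this, of "C / c ^ d"]
  have lim: "((\<lambda>x. C * (x ^ d * exp (- c * x))) \<longlongrightarrow> 0) at_top"
    using assms by (simp add: power_mult_distrib exp_minus field_simps)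
  show ?thesis
  proof (rule tendsto_sandwich[OF _ _ tendsto_const lim])
    show "\<forall>\<^sub>F x in at_top. 0 \<le> exp (- c * x) / tail G x"
      by (intro always_eventually allI divide_nonneg_nonneg tail_nonneg) auto
    show "\<forall>\<^sub>F x in at_top. exp (- c * x) / tail G x \<le> C * (x ^ d * exp (- c * x))"
      using eventually_ge_at_top[of 1]
    proof eventually_elim
      case (elim x)
      have "1 * exp (- c * x) \<le> C * x ^ d * tail G x * exp (- c * x)"
        using C(2)[OF elim] by (intro mult_right_mono) auto
      then show ?case using tail_pos[of x] by (simp add: field_simps)
    qed
  qed
qed

lemma exp_le_tail:
  assumes "0 < c"
  obtains C where "1 \<le> C" "\<And>x. 0 \<le> x \<Longrightarrow> exp (- c * x) \<le> C * tail G x"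
proof -
  have "\<forall>\<^sub>F x in at_top. exp (- c * x) / tail G x < 1"
    using order_tendstoD(2)[OF exp_smallo_tail[OF assms], of 1] by simp
  then obtain x0 where x0: "\<And>x. x0 \<le> x \<Longrightarrow> exp (- c * x) / tail G x < 1"
    by (auto simp: eventually_at_top_linorder)
  define C where "C = max 1 (1 / tail G x0)"
  have "exp (- c * x) \<le> C * tail G x" if "0 \<le> x" for x
  proof (cases "x0 \<le> x")
    case True
    then have "exp (- c * x) \<le> 1 * tail G x" using x0[OF True] tail_pos[of x] by (simp add: field_simps)
    also have "\<dots> \<le> C * tail G x" by (intro mult_right_mono tail_nonneg) (simp add: C_def)
    finally show ?thesis .
  next
    case False
    have "exp (- c * x) \<le> 1" using assms that by simp
    also have "1 = 1 / tail G x0 * tail G x0" using tail_pos[of x0] by simp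
    also have "\<dots> \<le> C * tail G x"
      using False tail_pos[of x0] by (intro mult_mono tail_antimono tail_nonneg) (auto simp: C_def)
    finally show ?thesis .
  qed
  moreover have "1 \<le> C" by (simp add: C_def)
  ultimately show ?thesis using that by blast
qed

text \<open>
  By Markov's inequality restricted to the event itself, \<open>t * F t\<close> is at most the mean of the
  part of the distribution above \<open>t\<close>, which vanishes by dominated convergence.
\<close>

lemma mult_tail_tendsto_0: "((\<lambda>x. x * tail G x) \<longlongrightarrow> 0) at_top"
proof -
  have lim: "((\<lambda>t. \<integral>x. indicator {t<..} x * x \<partial>G) \<longlongrightarrow> (\<integral>x. 0 \<partial>G)) at_top"
  proof (rule integral_dominated_convergence_at_top[where w = "\<lambda>x. norm x"])
    show "\<forall>\<^sub>F t in at_top. AE x in G. norm (indicator {t<..} x * x) \<le> norm x"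
      by (intro always_eventually allI AE_I2) (auto simp: indicator_def)
    show "AE x in G. ((\<lambda>t. indicator {t<..} x * x) \<longlongrightarrow> 0) at_top"
    proof (rule AE_I2)
      fix x :: real
      have "\<forall>\<^sub>F t in at_top. indicator {t<..} x * x = 0"
        using eventually_ge_at_top[of x] by eventually_elim (auto simp: indicator_def)
      then show "((\<lambda>t. indicator {t<..} x * x) \<longlongrightarrow> 0) at_top" by (rule tendsto_eventually)
    qed
    show "integrable G (\<lambda>x. norm x)" by (rule integrable_norm[OF integrable_id])
  qed measurable
  show ?thesis
  proof (rule tendsto_sandwich[OF _ _ tendsto_const])
    show "((\<lambda>t. \<integral>x. indicator {t<..} x * x \<partial>G) \<longlongrightarrow> 0) at_top" using lim by simp
    show "\<forall>\<^sub>F x in at_top. 0 \<le> x * tail G x"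
      using eventually_ge_at_top[of 0] by eventually_elim (auto simp: tail_nonneg)
    show "\<forall>\<^sub>F t in at_top. t * tail G t \<le> (\<integral>x. indicator {t<..} x * x \<partial>G)"
      using eventually_ge_at_top[of 0]
    proof eventually_elim
      case (elim t)
      have "t * tail G t = (\<integral>x. indicator {t<..} x * t \<partial>G)" by (simp add: tail_eq)
      also have "\<dots> \<le> (\<integral>x. indicator {t<..} x * x \<partial>G)"
      proof (rule integral_mono)
        show "integrable G (\<lambda>x. indicator {t<..} x * t)" by (intro integrable_const_bound[where B = "\<bar>t\<bar>"]) (auto simp: indicator_def)
        show "integrable G (\<lambda>x. indicator {t<..} x * x)"
          using integrable_real_mult_indicator[OF _ integrable_id, of "{t<..}"] by (simp add: mult.commute)
      qed (auto simp: indicator_def)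
      finally show ?case .
    qed
  qed
qed

lemma integrable_min_power: "0 \<le> y \<Longrightarrow> integrable G (\<lambda>x. (min x y) ^ m)" for y :: real
  using nonneg by (intro integrable_const_bound[where B = "y ^ m"]) (auto simp: power_mono)

text \<open>
  Raising the truncation level from \<open>y / 2\<close> to \<open>y\<close> costs at most \<open>y ^ m * F (y / 2)\<close>.  This gives
  a recursion over dyadic levels, which closes as soon as \<open>2 ^ m\<close> is larger than twice the constant
  of \<open>tail_half_le\<close>.
\<close>

lemma truncated_moment_le:
  obtains m A where "1 \<le> A" "\<And>y. 1 \<le> y \<Longrightarrow> (\<integral>x. (min x y) ^ m \<partial>G) \<le> A * y ^ m * tail G y"
proof -
  obtain D where D: "1 \<le> D" "\<And>x. tail G (x / 2) \<le> D * tail G x" using tail_half_le by blast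
  obtain m where m: "2 * D < 2 ^ m" using real_arch_pow[of 2 "2 * D"] by auto
  define A where "A = max (2 * D) (1 / tail G 2)"
  have A1: "1 \<le> A" using D by (auto simp: A_def)
  have bound: "(\<integral>x. (min x y) ^ m \<partial>G) \<le> A * y ^ m * tail G y" if "1 \<le> y" "y \<le> 2 ^ Suc i" for y i
    using that
  proof (induction i arbitrary: y)
    case 0
    have "(\<integral>x. (min x y) ^ m \<partial>G) \<le> (\<integral>x. y ^ m \<partial>G)"
      using 0 nonneg by (intro integral_mono_AE integrable_min_power) (auto simp: power_mono)
    also have "\<dots> = 1 / tail G 2 * y ^ m * tail G 2" using tail_pos[of 2] prob_space by simp
    also have "\<dots> \<le> A * y ^ m * tail G y"
      using 0 A1 tail_pos[of 2] by (intro mult_mono mult_right_mono tail_antimono tail_nonneg) (auto simp: A_def)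
    finally show ?case .
  next
    case (Suc i)
    show ?case
    proof (cases "y \<le> 2")
      case True
      then have "y \<le> 2 ^ Suc i" unfolding power_Suc using one_le_power[of "2::real" i] by linarith
      then show ?thesis using Suc by blast
    next
      case False
      have "(\<integral>x. (min x y) ^ m \<partial>G) \<le> (\<integral>x. (min x (y/2)) ^ m + y ^ m * indicator {y/2<..} x \<partial>G)"
      proof (rule integral_mono_AE)
        show "AE x in G. (min x y) ^ m \<le> (min x (y/2)) ^ m + y ^ m * indicator {y/2<..} x"
          using nonneg
        proof eventually_elim
          case (elim x)
          show ?case
          proof (cases "x \<le> y/2")
            case True
            then have "min x y = x" "min x (y/2) = x" using elim by auto
            then show ?thesis using True by simp
          next
            case c: False
            have "min x y ^ m \<le> y ^ m" using elim False by (intro power_mono) auto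
            moreover have "0 \<le> min x (y/2) ^ m" using elim False by (intro zero_le_power) auto
            ultimately show ?thesis using c by simp
          qed
        qed
      qed (use False in \<open>auto intro!: integrable_min_power integrable_real_indicator simp: less_top[symmetric]\<close>)
      also have "\<dots> = (\<integral>x. (min x (y/2)) ^ m \<partial>G) + y ^ m * tail G (y/2)"
        using False by (subst Bochner_Integration.integral_add)
          (auto intro!: integrable_min_power integrable_real_indicator simp: tail_eq less_top[symmetric])
      also have "\<dots> \<le> A * (y/2) ^ m * tail G (y/2) + y ^ m * tail G (y/2)"
        using Suc.prems False by (intro add_mono Suc.IH) auto
      also have "\<dots> = (A / 2 ^ m + 1) * y ^ m * tail G (y/2)" by (simp add: field_simps)
      also have "\<dots> \<le> (A / 2 ^ m + 1) * y ^ m * (D * tail G y)"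
        using A1 False by (intro mult_left_mono D) auto
      also have "\<dots> = (A * (D / 2 ^ m) + D) * y ^ m * tail G y" by (simp add: field_simps)
      also have "\<dots> \<le> A * y ^ m * tail G y"
      proof -
        have "A * (D / 2 ^ m) \<le> A * (1/2)" using m A1 by (intro mult_left_mono) (auto simp: field_simps)
        moreover have "D \<le> A * (1/2)" by (simp add: A_def)
        ultimately have "A * (D / 2 ^ m) + D \<le> A" by linarith
        then show ?thesis using False by (intro mult_right_mono tail_nonneg) auto
      qed
      finally show ?thesis .
    qed
  qed
  have "(\<integral>x. (min x y) ^ m \<partial>G) \<le> A * y ^ m * tail G y" if "1 \<le> y" for y
  proof -
    obtain i where "y < 2 ^ i" using real_arch_pow[of 2 y] by auto
    then have "y \<le> 2 ^ Suc i" using that by simp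
    with that show ?thesis by (rule bound)
  qed
  with A1 that show ?thesis by blast
qed

end

section \<open>Exponential bounds for sums of independent variables\<close>

text \<open>
  Close to \<open>0\<close> the exponential is almost linear.  Away from \<open>0\<close> the quotient \<open>exp u / u ^ m\<close>
  decreases up to \<open>m\<close> and increases afterwards, so it is bounded by its values at the endpoints.
\<close>

lemma exp_le_linear_plus_power:
  fixes u v h :: real
  assumes h: "0 < h" "h \<le> 1" and u: "0 \<le> u" "u \<le> v"
  shows "exp u \<le> 1 + (1 + h) * u + u ^ m * (exp v / v ^ m + exp (real m) / h ^ m)"
proof (cases "u \<le> h")
  case True
  have "exp u \<le> 1 + u + u\<^sup>2" using u True h by (intro exp_bound) auto
  moreover have "u\<^sup>2 \<le> h * u" using True u by (simp add: power2_eq_square mult_right_mono)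
  moreover have "0 \<le> u ^ m * (exp v / v ^ m + exp (real m) / h ^ m)" using u h by auto
  ultimately show ?thesis by (simp add: algebra_simps)
next
  case False
  then have pos: "0 < u" "0 < v" using u h by auto
  have "exp u \<le> u ^ m * (exp v / v ^ m + exp (real m) / h ^ m)"
  proof (cases "u \<le> real m")
    case True
    have "1 \<le> (u / h) ^ m" using False h by (intro one_le_power) auto
    then have "exp u * 1 \<le> exp (real m) * (u / h) ^ m" using True pos by (intro mult_mono) auto
    also have "\<dots> = u ^ m * (exp (real m) / h ^ m)" by (simp add: power_divide)
    also have "\<dots> \<le> u ^ m * (exp v / v ^ m + exp (real m) / h ^ m)" using pos by (intro mult_left_mono) auto
    finally show ?thesis by simp
  next
    case False
    have "v / u \<le> exp (v / u - 1)" using exp_ge_add_one_self[of "v / u - 1"] by simp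
    then have "(v / u) ^ m \<le> exp (v / u - 1) ^ m" using pos by (intro power_mono) auto
    also have "\<dots> = exp (real m * (v / u - 1))" by (simp add: exp_of_nat_mult)
    also have "\<dots> \<le> exp (u * (v / u - 1))" using False u pos by (auto intro!: mult_right_mono)
    also have "u * (v / u - 1) = v - u" using pos by (simp add: field_simps)
    finally have "v ^ m / u ^ m \<le> exp v / exp u" by (simp add: power_divide exp_diff)
    then have "exp u \<le> u ^ m * (exp v / v ^ m)" using pos by (simp add: field_simps)
    also have "\<dots> \<le> u ^ m * (exp v / v ^ m + exp (real m) / h ^ m)" using pos h by (intro mult_left_mono) auto
    finally show ?thesis .
  qed
  moreover have "0 \<le> 1 + (1 + h) * u" using pos h by auto
  ultimately show ?thesis by linarith
qed

lemma power_le_fact_mult_exp: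
  fixes v :: real assumes "0 \<le> v" shows "v ^ m \<le> fact m * exp v"
proof -
  have "v ^ m /\<^sub>R fact m \<le> exp v"
    unfolding exp_def using assms
    by (intro sum_le_suminf[where I = "{m}", simplified] summable_exp_generic) auto
  then show ?thesis by (simp add: field_simps)
qed

context prob_space begin

lemma chernoff_sum_ge:
  assumes fin: "finite I" and ind: "indep_vars (\<lambda>_. borel) Y I"
    and mgf: "\<And>i. i \<in> I \<Longrightarrow> (\<integral>\<^sup>+\<omega>. ennreal (exp (Y i \<omega>)) \<partial>M) \<le> ennreal B" and B: "0 \<le> B"
  shows "\<P>(\<omega> in M. c \<le> (\<Sum>i\<in>I. Y i \<omega>)) \<le> exp (- c) * B ^ card I"
proof -
  have meas: "Y i \<in> borel_measurable M" if "i \<in> I" for i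
    using ind that by (auto simp: indep_vars_def)
  have sum_meas: "(\<lambda>\<omega>. \<Sum>i\<in>I. Y i \<omega>) \<in> borel_measurable M" by (intro borel_measurable_sum meas)
  have ind': "indep_vars (\<lambda>_. borel) (\<lambda>i \<omega>. ennreal (exp (Y i \<omega>))) I"
    by (rule indep_vars_compose2[OF ind]) auto
  have "emeasure M {\<omega> \<in> space M. c \<le> (\<Sum>i\<in>I. Y i \<omega>)}
      = emeasure M ({\<omega> \<in> space M. 1 \<le> ennreal (exp (- c)) * (\<Prod>i\<in>I. ennreal (exp (Y i \<omega>)))} \<inter> space M)"
  proof (intro arg_cong[where f = "emeasure M"] Collect_eqI set_eqI)
    fix \<omega>
    have "ennreal (exp (- c)) * (\<Prod>i\<in>I. ennreal (exp (Y i \<omega>))) = ennreal (exp ((\<Sum>i\<in>I. Y i \<omega>) - c))"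
      by (simp add: prod_ennreal exp_sum[OF fin, symmetric] ennreal_mult'[symmetric] exp_add[symmetric])
    then show "\<omega> \<in> {\<omega> \<in> space M. c \<le> (\<Sum>i\<in>I. Y i \<omega>)} \<longleftrightarrow>
      \<omega> \<in> {\<omega> \<in> space M. 1 \<le> ennreal (exp (- c)) * (\<Prod>i\<in>I. ennreal (exp (Y i \<omega>)))} \<inter> space M"
      by (auto simp flip: ennreal_1)
  qed
  also have "\<dots> = emeasure M {\<omega> \<in> space M. 1 \<le> ennreal (exp (- c)) * (\<Prod>i\<in>I. ennreal (exp (Y i \<omega>)))}"
    by (intro arg_cong[where f = "emeasure M"]) auto
  also have "\<dots> \<le> ennreal (exp (- c)) * (\<integral>\<^sup>+\<omega>. (\<Prod>i\<in>I. ennreal (exp (Y i \<omega>))) * indicator (space M) \<omega> \<partial>M)"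
    using meas by (intro order_trans[OF nn_integral_Markov_inequality]) (auto intro!: borel_measurable_prod_ennreal)
  also have "(\<integral>\<^sup>+\<omega>. (\<Prod>i\<in>I. ennreal (exp (Y i \<omega>))) * indicator (space M) \<omega> \<partial>M)
      = (\<integral>\<^sup>+\<omega>. (\<Prod>i\<in>I. ennreal (exp (Y i \<omega>))) \<partial>M)"
    by (intro nn_integral_cong) auto
  also have "\<dots> = (\<Prod>i\<in>I. \<integral>\<^sup>+\<omega>. ennreal (exp (Y i \<omega>)) \<partial>M)"
    by (intro indep_vars_nn_integral fin ind') auto
  also have "\<dots> \<le> (\<Prod>i\<in>I. ennreal B)" by (intro prod_mono_ennreal mgf)
  also have "\<dots> = ennreal (B ^ card I)" by (simp add: ennreal_power B)
  finally have "emeasure M {\<omega> \<in> space M. c \<le> (\<Sum>i\<in>I. Y i \<omega>)} \<le> ennreal (exp (- c) * B ^ card I)"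
    by (simp add: ennreal_mult' mult_left_mono)
  then show ?thesis
    using B by (simp add: emeasure_eq_measure)
qed

end

text \<open>
  The quotient \<open>(1 - exp (- \<theta> y)) / \<theta>\<close> tends to \<open>y\<close> as \<open>\<theta>\<close> decreases to \<open>0\<close> and is dominated by \<open>y\<close>,
  so a mean larger than \<open>\<mu>\<close> already shows in the Laplace transform at some \<open>\<theta>\<close>.
\<close>

lemma exp_moment_le:
  fixes D :: "real measure"
  assumes D: "prob_space D" "sets D = sets borel" "AE y in D. 0 \<le> y" "integrable D (\<lambda>y. y)"
    and \<mu>: "\<mu> < (\<integral>y. y \<partial>D)"
  obtains \<theta> where "0 < \<theta>" "(\<integral>\<^sup>+y. ennreal (exp (- \<theta> * y)) \<partial>D) \<le> ennreal (exp (- \<theta> * \<mu>))"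
proof -
  interpret D: prob_space D by fact
  note [measurable_cong] = D(2)
  let ?t = "\<lambda>n. inverse (real (Suc n))"
  have "(\<lambda>n. \<integral>y. (1 - exp (- ?t n * y)) / ?t n \<partial>D) \<longlonglongrightarrow> (\<integral>y. y \<partial>D)"
  proof (rule integral_dominated_convergence[where w = "\<lambda>y. y"])
    show "AE y in D. norm ((1 - exp (- ?t n * y)) / ?t n) \<le> y" for n
      using D(3)
    proof eventually_elim
      case (elim y)
      have "1 - exp (- ?t n * y) \<le> ?t n * y" using exp_ge_add_one_self[of "- ?t n * y"] by simp
      moreover have "0 \<le> 1 - exp (- ?t n * y)" using elim by simp
      ultimately have "(1 - exp (- ?t n * y)) / ?t n \<le> y" "0 \<le> (1 - exp (- ?t n * y)) / ?t n"
        by (auto simp: divide_simps mult_ac)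
      then show ?case by simp
    qed
    show "AE y in D. (\<lambda>n. (1 - exp (- ?t n * y)) / ?t n) \<longlonglongrightarrow> y"
    proof (rule AE_I2)
      fix y :: real
      have "((\<lambda>t. (1 - exp (- t * y)) / t) \<longlongrightarrow> y) (at_right 0)" by real_asymp
      moreover have "filterlim ?t (at_right 0) sequentially"
        by (rule filterlim_compose[OF filterlim_inverse_at_right_top])
          (rule filterlim_compose[OF filterlim_real_sequentially filterlim_Suc])
      ultimately show "(\<lambda>n. (1 - exp (- ?t n * y)) / ?t n) \<longlonglongrightarrow> y" by (rule filterlim_compose)
    qed
    show "integrable D (\<lambda>y. y)" by fact
  qed measurable
  from order_tendstoD(1)[OF this \<mu>] obtain n where n: "\<mu> < (\<integral>y. (1 - exp (- ?t n * y)) / ?t n \<partial>D)"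
    using eventually_happens'[OF sequentially_bot] by blast
  define \<theta> where "\<theta> = ?t n"
  have \<theta>: "0 < \<theta>" by (simp add: \<theta>_def)
  have int: "integrable D (\<lambda>y. exp (- \<theta> * y))"
    using D(3) \<theta> by (intro D.integrable_const_bound[where B = 1]) auto
  have "\<mu> < (1 - (\<integral>y. exp (- \<theta> * y) \<partial>D)) / \<theta>"
    using n[folded \<theta>_def] int D.prob_space by simp
  then have "(\<integral>y. exp (- \<theta> * y) \<partial>D) < 1 - \<theta> * \<mu>" using \<theta> by (simp add: field_simps)
  also have "\<dots> \<le> exp (- \<theta> * \<mu>)" using exp_ge_add_one_self[of "- \<theta> * \<mu>"] by simp
  finally have "(\<integral>\<^sup>+y. ennreal (exp (- \<theta> * y)) \<partial>D) \<le> ennreal (exp (- \<theta> * \<mu>))"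
    using int by (subst nn_integral_eq_integral) (auto intro!: ennreal_leI)
  with \<theta> that show ?thesis by blast
qed

context prob_space begin

text \<open>
  A sum of nonnegative variables falls below a fixed fraction of its mean only with exponentially
  small probability, however heavy the tails are.  Applied to inter-arrival times this limits the number
  of arrivals from above, applied to services it limits the work from below.
\<close>

lemma iid_sum_lower_tail:
  fixes D :: "real measure"
  assumes D: "prob_space D" "sets D = sets borel" "AE y in D. 0 \<le> y" "integrable D (\<lambda>y. y)"
    and \<mu>: "\<mu> < (\<integral>y. y \<partial>D)"
  obtains \<theta> where "0 < \<theta>"
    "\<And>(I :: 'i set) Y u. finite I \<Longrightarrow> indep_vars (\<lambda>_. borel) Y I \<Longrightarrow> (\<And>i. i \<in> I \<Longrightarrow> distr M borel (Y i) = D)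
      \<Longrightarrow> \<P>(\<omega> in M. (\<Sum>i\<in>I. Y i \<omega>) \<le> real (card I) * \<mu> - u) \<le> exp (- \<theta> * u)"
proof -
  obtain \<theta> where \<theta>: "0 < \<theta>" "(\<integral>\<^sup>+y. ennreal (exp (- \<theta> * y)) \<partial>D) \<le> ennreal (exp (- \<theta> * \<mu>))"
    using exp_moment_le[OF D \<mu>] by blast
  have "\<P>(\<omega> in M. (\<Sum>i\<in>I. Y i \<omega>) \<le> real (card I) * \<mu> - u) \<le> exp (- \<theta> * u)"
    if I: "finite I" and ind: "indep_vars (\<lambda>_. borel) Y I" and dist: "\<And>i. i \<in> I \<Longrightarrow> distr M borel (Y i) = D"
    for I :: "'i set" and Y u
  proof -
    have ind': "indep_vars (\<lambda>_. borel) (\<lambda>i \<omega>. - \<theta> * Y i \<omega>) I"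
      by (rule indep_vars_compose2[OF ind]) auto
    have mgf: "(\<integral>\<^sup>+\<omega>. ennreal (exp (- \<theta> * Y i \<omega>)) \<partial>M) \<le> ennreal (exp (- \<theta> * \<mu>))" if "i \<in> I" for i
    proof -
      have [measurable]: "Y i \<in> borel_measurable M" using ind that by (auto simp: indep_vars_def)
      have "(\<integral>\<^sup>+y. ennreal (exp (- \<theta> * y)) \<partial>distr M borel (Y i)) = (\<integral>\<^sup>+\<omega>. ennreal (exp (- \<theta> * Y i \<omega>)) \<partial>M)"
        by (subst nn_integral_distr) auto
      then show ?thesis using \<theta>(2) dist[OF that] by simp
    qed
    have "\<P>(\<omega> in M. (\<Sum>i\<in>I. Y i \<omega>) \<le> real (card I) * \<mu> - u)
        = \<P>(\<omega> in M. - \<theta> * (real (card I) * \<mu> - u) \<le> (\<Sum>i\<in>I. - \<theta> * Y i \<omega>))"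
      using \<theta>(1) by (simp add: sum_distrib_left[symmetric] sum_negf)
    also have "\<dots> \<le> exp (- (- \<theta> * (real (card I) * \<mu> - u))) * exp (- \<theta> * \<mu>) ^ card I"
      by (intro chernoff_sum_ge I ind' mgf) auto
    also have "\<dots> = exp (- \<theta> * u)"
      by (simp add: exp_of_nat_mult[symmetric] exp_add[symmetric] algebra_simps)
    finally show ?thesis .
  qed
  with \<theta>(1) that show ?thesis by blast
qed

text \<open>
  A weak law that is uniform in the number of summands.  The part of a summand above a high
  level \<open>t\<close> has small mean and is handled by Markov's inequality; the distance of the truncated
  summand from \<open>t\<close> is nonnegative, so \<open>iid_sum_lower_tail\<close> applies to it.
\<close>

lemma iid_sum_upper_tail_tendsto_0:
  fixes D :: "real measure"
  assumes D: "prob_space D" "sets D = sets borel" "AE y in D. 0 \<le> y" "integrable D (\<lambda>y. y)"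
    and pos: "0 < C" "0 < \<delta>" "0 < \<eta>"
  shows "\<forall>\<^sub>F x in at_top. \<forall>(I :: 'i set) Y. finite I \<longrightarrow> real (card I) \<le> C * x \<longrightarrow> indep_vars (\<lambda>_. borel) Y I \<longrightarrow>
     (\<forall>i\<in>I. distr M borel (Y i) = D) \<longrightarrow>
     \<P>(\<omega> in M. real (card I) * (\<integral>y. y \<partial>D) + \<delta> * x \<le> (\<Sum>i\<in>I. Y i \<omega>)) \<le> \<eta>"
proof -
  interpret D: prob_space D by fact
  note [measurable_cong] = D(2)
  define \<mu> where "\<mu> = (\<integral>y. y \<partial>D)"
  have "((\<lambda>t. \<integral>y. y - min y t \<partial>D) \<longlongrightarrow> (\<integral>y. 0 \<partial>D)) at_top"
  proof (rule integral_dominated_convergence_at_top[where w = "\<lambda>y. norm y"])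
    show "\<forall>\<^sub>F t in at_top. AE y in D. norm (y - min y t) \<le> norm y"
      using eventually_ge_at_top[of 0]
    proof eventually_elim
      case (elim t) show ?case using D(3) by eventually_elim (use elim in auto)
    qed
    show "AE y in D. ((\<lambda>t. y - min y t) \<longlongrightarrow> 0) at_top"
    proof (rule AE_I2)
      fix y :: real
      have "\<forall>\<^sub>F t in at_top. y - min y t = 0"
        using eventually_ge_at_top[of y] by eventually_elim auto
      then show "((\<lambda>t. y - min y t) \<longlongrightarrow> 0) at_top" by (rule tendsto_eventually)
    qed
    show "integrable D (\<lambda>y. norm y)" using D(4) by (rule integrable_norm)
  qed measurable
  then have "\<forall>\<^sub>F t in at_top. (\<integral>y. y - min y t \<partial>D) < \<eta> * \<delta> / (4 * C)"
    using pos by (intro order_tendstoD(2)[where y = 0]) auto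
  then have "\<forall>\<^sub>F t in at_top. (\<integral>y. y - min y t \<partial>D) < \<eta> * \<delta> / (4 * C) \<and> 0 \<le> t"
    using eventually_ge_at_top[of 0] by eventually_elim auto
  then obtain t where t: "(\<integral>y. y - min y t \<partial>D) < \<eta> * \<delta> / (4 * C)" "0 \<le> t"
    by (auto simp: eventually_at_top_linorder)
  have int_min: "integrable D (\<lambda>y. min y t)"
    using D(3) t by (intro D.integrable_const_bound[where B = t]) auto
  define E where "E = distr D borel (\<lambda>y. t - min y t)"
  have E: "prob_space E" "sets E = sets borel" "AE y in E. 0 \<le> y" "integrable E (\<lambda>y. y)"
    using int_min unfolding E_def
    by (auto intro!: D.prob_space_distr simp: AE_distr_iff integrable_distr_eq)
  have "(\<integral>y. y \<partial>E) = t - (\<integral>y. min y t \<partial>D)"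
    unfolding E_def using int_min by (subst integral_distr) (auto simp: D.prob_space)
  moreover have "(\<integral>y. min y t \<partial>D) \<le> \<mu>"
    unfolding \<mu>_def using int_min D(4) by (intro integral_mono) auto
  ultimately have "t - \<mu> - \<delta> / (4 * C) < (\<integral>y. y \<partial>E)" using pos by (smt (verit) divide_pos_pos)
  note \<mu>E = this
  obtain \<theta> where \<theta>: "0 < \<theta>"
    "\<And>(I :: 'i set) Y u. finite I \<Longrightarrow> indep_vars (\<lambda>_. borel) Y I \<Longrightarrow> (\<And>i. i \<in> I \<Longrightarrow> distr M borel (Y i) = E)
      \<Longrightarrow> \<P>(\<omega> in M. (\<Sum>i\<in>I. Y i \<omega>) \<le> real (card I) * (t - \<mu> - \<delta> / (4 * C)) - u) \<le> exp (- \<theta> * u)"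
    by (rule iid_sum_lower_tail[OF E \<mu>E, where 'i = 'i]) blast
  have "((\<lambda>x. exp (- \<theta> * (\<delta> / 4 * x))) \<longlongrightarrow> 0) at_top"
    using \<theta>(1) pos by real_asymp
  then have "\<forall>\<^sub>F x in at_top. exp (- \<theta> * (\<delta> / 4 * x)) < \<eta> / 2"
    using pos by (intro order_tendstoD(2)) auto
  then show ?thesis using eventually_gt_at_top[of 0]
  proof eventually_elim
    case (elim x)
    show ?case
    proof (intro allI impI)
      fix I :: "'i set" and Y
      assume I: "finite I" "real (card I) \<le> C * x" "indep_vars (\<lambda>_. borel) Y I" "\<forall>i\<in>I. distr M borel (Y i) = D"
      let ?n = "real (card I)"
      have meas: "Y i \<in> borel_measurable M" if "i \<in> I" for i
        using I that by (auto simp: indep_vars_def)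
      let ?A = "{\<omega> \<in> space M. (\<Sum>i\<in>I. t - min (Y i \<omega>) t) \<le> ?n * (t - \<mu> - \<delta> / (4 * C)) - \<delta> / 4 * x}"
      let ?B = "{\<omega> \<in> space M. \<delta> / 2 * x \<le> (\<Sum>i\<in>I. Y i \<omega> - min (Y i \<omega>) t)}"
      have mA: "(\<lambda>\<omega>. \<Sum>i\<in>I. t - min (Y i \<omega>) t) \<in> borel_measurable M"
        using meas by (intro borel_measurable_sum) auto
      have mB: "(\<lambda>\<omega>. \<Sum>i\<in>I. Y i \<omega> - min (Y i \<omega>) t) \<in> borel_measurable M"
        using meas by (intro borel_measurable_sum) auto
      have A: "prob ?A \<le> \<eta> / 2"
      proof -
        have "prob ?A \<le> exp (- \<theta> * (\<delta> / 4 * x))"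
        proof (rule \<theta>(2)[OF I(1)])
          show "indep_vars (\<lambda>_. borel) (\<lambda>i \<omega>. t - min (Y i \<omega>) t) I"
            by (rule indep_vars_compose2[OF I(3)]) auto
          fix i assume "i \<in> I"
          then show "distr M borel (\<lambda>\<omega>. t - min (Y i \<omega>) t) = E"
            using I(4) meas[of i] unfolding E_def by (subst distr_distr[symmetric, unfolded o_def]) auto
        qed
        then show ?thesis using elim by simp
      qed
      have exc: "(\<integral>\<omega>. Y i \<omega> - min (Y i \<omega>) t \<partial>M) = (\<integral>y. y - min y t \<partial>D)"
        "integrable M (\<lambda>\<omega>. Y i \<omega> - min (Y i \<omega>) t)" if "i \<in> I" for i
      proof -
        have [measurable]: "Y i \<in> borel_measurable M" and dist: "distr M borel (Y i) = D" using meas I(4) that by auto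
        have "(\<integral>y. y - min y t \<partial>distr M borel (Y i)) = (\<integral>\<omega>. Y i \<omega> - min (Y i \<omega>) t \<partial>M)"
          by (subst integral_distr) auto
        then show "(\<integral>\<omega>. Y i \<omega> - min (Y i \<omega>) t \<partial>M) = (\<integral>y. y - min y t \<partial>D)" by (simp add: dist)
        have "integrable (distr M borel (Y i)) (\<lambda>y. y - min y t)" using dist D(4) int_min by auto
        then show "integrable M (\<lambda>\<omega>. Y i \<omega> - min (Y i \<omega>) t)"
          by (subst (asm) integrable_distr_eq) auto
      qed
      have B: "prob ?B \<le> \<eta> / 2"
      proof -
        have "prob ?B \<le> (\<integral>\<omega>. (\<Sum>i\<in>I. Y i \<omega> - min (Y i \<omega>) t) \<partial>M) / (\<delta> / 2 * x)"
        proof (rule integral_Markov_inequality_measure[where A = "{}", simplified])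
          show "integrable M (\<lambda>\<omega>. \<Sum>i\<in>I. Y i \<omega> - min (Y i \<omega>) t)" using exc(2) by (intro Bochner_Integration.integrable_sum)
          show "AE \<omega> in M. 0 \<le> (\<Sum>i\<in>I. Y i \<omega> - min (Y i \<omega>) t)" by (intro AE_I2 sum_nonneg) auto
        qed (use pos elim in auto)
        also have "(\<integral>\<omega>. (\<Sum>i\<in>I. Y i \<omega> - min (Y i \<omega>) t) \<partial>M) = ?n * (\<integral>y. y - min y t \<partial>D)"
          using exc by (subst Bochner_Integration.integral_sum) auto
        also have "\<dots> \<le> (C * x) * (\<eta> * \<delta> / (4 * C))"
          using t(1) I(2) pos elim by (intro mult_mono integral_nonneg_AE) auto
        finally show ?thesis using pos elim by (simp add: field_simps)
      qed
      have "{\<omega> \<in> space M. ?n * \<mu> + \<delta> * x \<le> (\<Sum>i\<in>I. Y i \<omega>)} \<subseteq> ?A \<union> ?B"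
      proof (safe, rule ccontr)
        fix \<omega> assume w: "\<omega> \<in> space M" "?n * \<mu> + \<delta> * x \<le> (\<Sum>i\<in>I. Y i \<omega>)"
          "\<not> \<delta> / 2 * x \<le> (\<Sum>i\<in>I. Y i \<omega> - min (Y i \<omega>) t)"
          "\<not> (\<Sum>i\<in>I. t - min (Y i \<omega>) t) \<le> ?n * (t - \<mu> - \<delta> / (4 * C)) - \<delta> / 4 * x"
        have "?n * (\<delta> / (4 * C)) \<le> (C * x) * (\<delta> / (4 * C))" using I(2) pos by (intro mult_right_mono) auto
        also have "\<dots> = \<delta> / 4 * x" using pos by simp
        finally show False using w by (simp add: sum_subtractf algebra_simps)
      qed
      then have "\<P>(\<omega> in M. ?n * \<mu> + \<delta> * x \<le> (\<Sum>i\<in>I. Y i \<omega>)) \<le> prob (?A \<union> ?B)"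
        using mA mB by (intro finite_measure_mono) auto
      also have "\<dots> \<le> prob ?A + prob ?B" using mA mB by (intro measure_Un_le) auto
      finally show "\<P>(\<omega> in M. ?n * (\<integral>y. y \<partial>D) + \<delta> * x \<le> (\<Sum>i\<in>I. Y i \<omega>)) \<le> \<eta>"
        using A B by (simp add: \<mu>_def)
    qed
  qed
qed

end

context irv_distribution begin

text \<open>
  The linear part of \<open>exp_le_linear_plus_power\<close> produces the mean, with a factor arbitrarily
  close to \<open>1\<close>, and the power part is integrated by \<open>truncated_moment_le\<close>.
\<close>

lemma truncated_mgf_le:
  assumes "0 < h" "h \<le> 1"
  obtains A m where "1 \<le> A"
    "\<And>\<theta> y. 0 < \<theta> \<Longrightarrow> 1 \<le> y \<Longrightarrow>
      (\<integral>\<^sup>+x. ennreal (exp (\<theta> * min x y)) \<partial>G)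
        \<le> ennreal (exp ((1 + h) * b * \<theta> + A * tail G y * (exp (\<theta> * y) + (\<theta> * y) ^ m)))"
proof -
  obtain m A0 where A0: "1 \<le> A0" "\<And>y. 1 \<le> y \<Longrightarrow> (\<integral>x. (min x y) ^ m \<partial>G) \<le> A0 * y ^ m * tail G y"
    using truncated_moment_le by metis
  define K where "K = exp (real m) / h ^ m"
  have K: "0 < K" using assms by (simp add: K_def)
  define A where "A = A0 * (1 + K)"
  have A1: "1 \<le> A" using A0(1) K unfolding A_def by (simp add: mult_ge1_I)
  have "(\<integral>\<^sup>+x. ennreal (exp (\<theta> * min x y)) \<partial>G)
        \<le> ennreal (exp ((1 + h) * b * \<theta> + A * tail G y * (exp (\<theta> * y) + (\<theta> * y) ^ m)))"
    if \<theta>: "0 < \<theta>" and y: "1 \<le> y" for \<theta> y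
  proof -
    let ?v = "\<theta> * y"
    have v: "0 < ?v" using \<theta> y by simp
    have int1: "integrable G (\<lambda>x. min x y)" using integrable_min_power[of y 1] y by simp
    have intm: "integrable G (\<lambda>x. (min x y) ^ m)" using integrable_min_power[of y m] y by simp
    have inte: "integrable G (\<lambda>x. exp (\<theta> * min x y))"
      using nonneg \<theta> by (intro integrable_const_bound[where B = "exp (\<theta> * y)"]) auto
    have "(\<integral>x. exp (\<theta> * min x y) \<partial>G)
        \<le> (\<integral>x. 1 + (1 + h) * (\<theta> * min x y) + (\<theta> * min x y) ^ m * (exp ?v / ?v ^ m + K) \<partial>G)"
    proof (rule integral_mono_AE)
      show "AE x in G. exp (\<theta> * min x y) \<le> 1 + (1 + h) * (\<theta> * min x y) + (\<theta> * min x y) ^ m * (exp ?v / ?v ^ m + K)"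
        using nonneg
      proof eventually_elim
        case (elim x)
        show ?case unfolding K_def
          by (rule exp_le_linear_plus_power) (use assms elim \<theta> y in \<open>auto intro!: mult_nonneg_nonneg\<close>)
      qed
    qed (use int1 intm inte in \<open>auto simp: power_mult_distrib\<close>)
    also have "\<dots> = 1 + (1 + h) * \<theta> * (\<integral>x. min x y \<partial>G) + \<theta> ^ m * (exp ?v / ?v ^ m + K) * (\<integral>x. (min x y) ^ m \<partial>G)"
      using int1 intm prob_space by (simp add: power_mult_distrib mult_ac)
    also have "\<dots> \<le> 1 + (1 + h) * \<theta> * b + \<theta> ^ m * (exp ?v / ?v ^ m + K) * (A0 * y ^ m * tail G y)"
    proof (intro add_mono mult_left_mono order_refl A0(2)[OF y])
      show "(\<integral>x. min x y \<partial>G) \<le> b" unfolding mean[symmetric]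
        using int1 integrable_id by (intro integral_mono) auto
    qed (use assms \<theta> v K in auto)
    also have "\<theta> ^ m * (exp ?v / ?v ^ m + K) * (A0 * y ^ m * tail G y)
        = A0 * tail G y * (exp ?v + K * ?v ^ m)"
      using \<theta> y by (simp add: power_mult_distrib field_simps)
    also have "\<dots> \<le> A * tail G y * (exp ?v + ?v ^ m)"
    proof -
      have "0 \<le> K * exp ?v + ?v ^ m" using K v by (intro add_nonneg_nonneg zero_le_power) auto
      then have "exp ?v + K * ?v ^ m \<le> (1 + K) * (exp ?v + ?v ^ m)" by (simp add: algebra_simps)
      then have "A0 * tail G y * (exp ?v + K * ?v ^ m) \<le> A0 * tail G y * ((1 + K) * (exp ?v + ?v ^ m))"
        using A0(1) tail_nonneg by (intro mult_left_mono) auto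
      then show ?thesis by (simp add: A_def mult_ac)
    qed
    finally have "(\<integral>x. exp (\<theta> * min x y) \<partial>G) \<le> 1 + ((1 + h) * b * \<theta> + A * tail G y * (exp ?v + ?v ^ m))"
      by (simp add: mult_ac)
    also have "\<dots> \<le> exp ((1 + h) * b * \<theta> + A * tail G y * (exp ?v + ?v ^ m))"
      by (rule exp_ge_add_one_self)
    finally show ?thesis using inte by (subst nn_integral_eq_integral) (auto intro!: ennreal_leI)
  qed
  with A1 that show ?thesis by blast
qed

lemma b_nonneg: "0 \<le> b"
  unfolding mean[symmetric] using nonneg by (rule integral_nonneg_AE)

text \<open>
  Let \<open>n\<close> be the number of summands, \<open>y = \<epsilon> x\<close> and \<open>w = n * F y\<close>.  The exponent \<open>\<theta>\<close> with
  \<open>exp (\<theta> y) = 1 / w\<close> is the largest one for which the heavy part of the generating function in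
  \<open>truncated_mgf_le\<close> stays bounded after \<open>n\<close> multiplications.  Half of the deviation \<open>\<xi> x\<close> absorbs
  the error in the linear part, and the other half yields \<open>exp (- \<theta> \<xi> x / 2)\<close>, a power of \<open>w\<close> whose
  exponent \<open>\<xi> / (2 \<epsilon>)\<close> is at least \<open>2\<close> for small \<open>\<epsilon>\<close>.
\<close>

lemma truncated_sum_upper_tail:
  fixes N :: "'a measure"
  assumes N: "prob_space N" and pos: "0 < C" "0 < \<xi>"
  obtains \<epsilon> A where "0 < \<epsilon>" "1 \<le> A"
    "\<forall>\<^sub>F x in at_top. \<forall>(I :: 'i set) Y. finite I \<longrightarrow> I \<noteq> {} \<longrightarrow> real (card I) \<le> C * x \<longrightarrow>
       prob_space.indep_vars N (\<lambda>_. borel) Y I \<longrightarrow> (\<forall>i\<in>I. distr N borel (Y i) = G) \<longrightarrow>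
       measure N {\<omega> \<in> space N. real (card I) * b + \<xi> * x \<le> (\<Sum>i\<in>I. min (Y i \<omega>) (\<epsilon> * x))}
         \<le> A * (real (card I) * tail G (\<epsilon> * x))\<^sup>2"
proof -
  interpret N: prob_space N by fact
  \<comment> \<open>relative error in the linear part: over at most \<open>C * x\<close> summands it adds up to \<open>\<xi> / 2 * x\<close>\<close>
  define h where "h = min 1 (\<xi> / (2 * C * (b + 1)))"
  have h: "0 < h" "h \<le> 1" using pos b_nonneg by (auto simp: h_def)
  have hb: "h * b * C \<le> \<xi> / 2"
  proof -
    have "h * b * C \<le> (\<xi> / (2 * C * (b + 1))) * (b + 1) * C"
      using pos b_nonneg by (intro mult_right_mono mult_mono) (auto simp: h_def)
    also have "\<dots> = \<xi> / 2"
    proof -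
      have "b + 1 \<noteq> 0" "C \<noteq> 0" using pos b_nonneg by auto
      then show ?thesis by simp
    qed
    finally show ?thesis .
  qed
  obtain A m where A: "1 \<le> A" "\<And>\<theta> y. 0 < \<theta> \<Longrightarrow> 1 \<le> y \<Longrightarrow>
      (\<integral>\<^sup>+x. ennreal (exp (\<theta> * min x y)) \<partial>G)
        \<le> ennreal (exp ((1 + h) * b * \<theta> + A * tail G y * (exp (\<theta> * y) + (\<theta> * y) ^ m)))"
    using truncated_mgf_le[OF h] by metis
  define A' where "A' = exp (A * (1 + fact m))"
  have A': "1 \<le> A'" using A(1) by (simp add: A'_def)
  define \<epsilon> where "\<epsilon> = \<xi> / 4"
  have \<epsilon>: "0 < \<epsilon>" "\<epsilon> \<le> \<xi> / 4" using pos by (auto simp: \<epsilon>_def)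
  have fl: "filterlim (\<lambda>x. x * \<epsilon>) at_top at_top"
    using \<epsilon>(1) by (intro filterlim_at_top_mult_tendsto_pos[OF tendsto_const _ filterlim_ident]) auto
  have "((\<lambda>x. (C / \<epsilon>) * ((x * \<epsilon>) * tail G (x * \<epsilon>))) \<longlongrightarrow> (C / \<epsilon>) * 0) at_top"
    by (intro tendsto_mult_left filterlim_compose[OF mult_tail_tendsto_0 fl])
  then have "\<forall>\<^sub>F x in at_top. (C / \<epsilon>) * ((x * \<epsilon>) * tail G (x * \<epsilon>)) < 1"
    by (intro order_tendstoD(2)) auto
  then have ev: "\<forall>\<^sub>F x in at_top. C * x * tail G (\<epsilon> * x) < 1"
    by eventually_elim (use \<epsilon>(1) in \<open>simp add: mult_ac\<close>)
  have "\<forall>\<^sub>F x in at_top. \<forall>(I :: 'i set) Y. finite I \<longrightarrow> I \<noteq> {} \<longrightarrow> real (card I) \<le> C * x \<longrightarrow>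
     prob_space.indep_vars N (\<lambda>_. borel) Y I \<longrightarrow> (\<forall>i\<in>I. distr N borel (Y i) = G) \<longrightarrow>
     measure N {\<omega> \<in> space N. real (card I) * b + \<xi> * x \<le> (\<Sum>i\<in>I. min (Y i \<omega>) (\<epsilon> * x))}
       \<le> A' * (real (card I) * tail G (\<epsilon> * x))\<^sup>2"
    using ev eventually_ge_at_top[of "1 / \<epsilon>"]
  proof eventually_elim
    case (elim x)
    have x: "0 < x" "1 \<le> \<epsilon> * x" using elim(2) \<epsilon>(1)
      by (auto simp: field_simps intro: less_le_trans[of 0 "1/\<epsilon>"])
    show ?case
    proof (intro allI impI)
      fix I :: "'i set" and Y
      assume I: "finite I" "I \<noteq> {}" "real (card I) \<le> C * x" "N.indep_vars (\<lambda>_. borel) Y I" "\<forall>i\<in>I. distr N borel (Y i) = G"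
      let ?n = "real (card I)" and ?F = "tail G (\<epsilon> * x)"
      have n: "1 \<le> ?n" using I(1,2) by (metis Suc_leI card_gt_0_iff of_nat_1 of_nat_le_iff One_nat_def)
      define w where "w = ?n * ?F"
      have w0: "0 < w" using n tail_pos by (simp add: w_def)
      have "w \<le> C * x * ?F" unfolding w_def using I(3) tail_nonneg by (intro mult_right_mono)
      with elim(1) have w1: "w < 1" by simp
      \<comment> \<open>the exponent is chosen such that \<open>exp (\<theta> * (\<epsilon> * x)) = 1 / w\<close>\<close>
      define v where "v = - ln w"
      have v: "0 < v" "exp v = 1 / w" using w0 w1 by (auto simp: v_def exp_minus inverse_eq_divide)
      define \<theta> where "\<theta> = v / (\<epsilon> * x)"
      have \<theta>: "0 < \<theta>" "\<theta> * (\<epsilon> * x) = v" using v x \<epsilon> by (auto simp: \<theta>_def)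
      let ?B = "exp ((1 + h) * b * \<theta> + A * ?F * (exp v + v ^ m))"
      have ind: "N.indep_vars (\<lambda>_. borel) (\<lambda>i \<omega>. \<theta> * min (Y i \<omega>) (\<epsilon> * x)) I"
        by (rule N.indep_vars_compose2[OF I(4)]) auto
      have mgf: "(\<integral>\<^sup>+\<omega>. ennreal (exp (\<theta> * min (Y i \<omega>) (\<epsilon> * x))) \<partial>N) \<le> ennreal ?B" if "i \<in> I" for i
      proof -
        have [measurable]: "Y i \<in> borel_measurable N" using I(4) that by (auto simp: N.indep_vars_def)
        have "(\<integral>\<^sup>+y. ennreal (exp (\<theta> * min y (\<epsilon> * x))) \<partial>distr N borel (Y i))
            = (\<integral>\<^sup>+\<omega>. ennreal (exp (\<theta> * min (Y i \<omega>) (\<epsilon> * x))) \<partial>N)"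
          by (subst nn_integral_distr) auto
        then show ?thesis using A(2)[OF \<theta>(1) x(2)] I(5) that \<theta>(2) by simp
      qed
      have "measure N {\<omega> \<in> space N. ?n * b + \<xi> * x \<le> (\<Sum>i\<in>I. min (Y i \<omega>) (\<epsilon> * x))}
          = measure N {\<omega> \<in> space N. \<theta> * (?n * b + \<xi> * x) \<le> (\<Sum>i\<in>I. \<theta> * min (Y i \<omega>) (\<epsilon> * x))}"
        using \<theta>(1) by (simp add: sum_distrib_left[symmetric])
      also have "\<dots> \<le> exp (- (\<theta> * (?n * b + \<xi> * x))) * ?B ^ card I"
        by (intro N.chernoff_sum_ge I(1) ind mgf) auto
      also have "\<dots> = exp (\<theta> * (?n * b * h - \<xi> * x) + A * (w * exp v + w * v ^ m))"
        by (simp add: exp_of_nat_mult[symmetric] exp_add[symmetric] algebra_simps w_def)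
      also have "\<dots> \<le> exp (\<theta> * (- (\<xi> / 2 * x)) + A * (1 + fact m))"
      proof -
        have "?n * b * h \<le> (C * x) * b * h" using I(3) b_nonneg h by (intro mult_right_mono) auto
        also have "\<dots> \<le> \<xi> / 2 * x" using hb x by (metis mult.commute mult.left_commute mult_right_mono less_imp_le)
        finally have "\<theta> * (?n * b * h - \<xi> * x) \<le> \<theta> * (- (\<xi> / 2 * x))" using \<theta>(1) by (intro mult_left_mono) auto
        moreover have "w * exp v = 1" using v w0 by simp
        moreover have "w * v ^ m \<le> w * (fact m * exp v)" using w0 v power_le_fact_mult_exp[of v m] by (intro mult_left_mono) auto
        moreover have "w * (fact m * exp v) = fact m" using v w0 by simp
        ultimately have "\<theta> * (?n * b * h - \<xi> * x) \<le> \<theta> * (- (\<xi> / 2 * x))" "w * exp v + w * v ^ m \<le> 1 + fact m" by auto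
        moreover from this(2) have "A * (w * exp v + w * v ^ m) \<le> A * (1 + fact m)"
          using A(1) by (intro mult_left_mono) auto
        ultimately show ?thesis unfolding exp_le_cancel_iff by linarith
      qed
      also have "\<dots> \<le> exp (- 2 * v + A * (1 + fact m))"
      proof -
        have "2 * v = \<theta> * (2 * \<epsilon> * x)" using \<theta>(2) by (simp add: mult_ac)
        also have "\<dots> \<le> \<theta> * (\<xi> / 2 * x)" using \<epsilon> x \<theta> by (intro mult_left_mono mult_right_mono) auto
        finally show ?thesis by simp
      qed
      also have "\<dots> = A' * w\<^sup>2"
      proof -
        have "exp (- 2 * v) = exp (- v) ^ 2" by (simp add: exp_of_nat_mult[symmetric])
        also have "exp (- v) = w" using w0 by (simp add: v_def)
        finally show ?thesis unfolding A'_def exp_add by (simp add: mult.commute)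
      qed
      finally show "measure N {\<omega> \<in> space N. ?n * b + \<xi> * x \<le> (\<Sum>i\<in>I. min (Y i \<omega>) (\<epsilon> * x))} \<le> A' * (?n * ?F)\<^sup>2"
        by (simp add: w_def)
    qed
  qed
  with \<epsilon>(1) A' that show ?thesis by blast
qed

end

section \<open>The queue and its sources of randomness\<close>

lemma (in prob_space) indep_sets_reindex_inj:
  assumes F: "indep_sets F (f ` I)" and inj: "inj_on f I"
  shows "indep_sets (\<lambda>i. F (f i)) I"
proof (rule indep_setsI)
  show "F (f i) \<subseteq> events" if "i \<in> I" for i
    using F that by (auto simp: indep_sets_def)
next
  fix A J assume J: "J \<noteq> {}" "J \<subseteq> I" "finite J" and A: "\<forall>j\<in>J. A j \<in> F (f j)"
  have inj': "inj_on f J" using inj J(2) by (rule inj_on_subset)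
  let ?A = "\<lambda>s. A (the_inv_into J f s)"
  have eq: "?A (f j) = A j" if "j \<in> J" for j
    using the_inv_into_f_f[OF inj' that] by simp
  have "prob (\<Inter>s\<in>f ` J. ?A s) = (\<Prod>s\<in>f ` J. prob (?A s))"
    using J A eq by (intro indep_setsD[OF F]) auto
  moreover have "(\<Inter>s\<in>f ` J. ?A s) = (\<Inter>j\<in>J. A j)" using eq by auto
  moreover have "(\<Prod>s\<in>f ` J. prob (?A s)) = (\<Prod>j\<in>J. prob (A j))"
    using inj' eq by (simp add: prod.reindex)
  ultimately show "prob (\<Inter>j\<in>J. A j) = (\<Prod>j\<in>J. prob (A j))" by simp
qed

lemma nn_integral_binomial_pmf:
  assumes "0 \<le> p" "p \<le> 1"
  shows "(\<integral>\<^sup>+k. of_nat k \<partial>measure_pmf (binomial_pmf n p)) = ennreal (real n * p)"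
proof (induction n)
  case 0
  then show ?case using assms by (simp add: binomial_pmf_0)
next
  case (Suc n)
  have "(\<integral>\<^sup>+k. of_nat k \<partial>measure_pmf (binomial_pmf (Suc n) p))
      = (\<integral>\<^sup>+c. (\<integral>\<^sup>+k. of_nat ((if c then 1 else 0) + k) \<partial>measure_pmf (binomial_pmf n p)) \<partial>measure_pmf (bernoulli_pmf p))"
    using assms by (simp add: binomial_pmf_Suc nn_integral_bind_pmf nn_integral_return_pmf)
  also have "\<dots> = (\<integral>\<^sup>+c. (if c then 1 else 0) + ennreal (real n * p) \<partial>measure_pmf (bernoulli_pmf p))"
  proof (intro nn_integral_cong)
    fix c :: bool
    have "(\<integral>\<^sup>+k. of_nat ((if c then 1 else 0) + k) \<partial>measure_pmf (binomial_pmf n p))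
        = (\<integral>\<^sup>+k. (if c then 1 else 0) + of_nat k \<partial>measure_pmf (binomial_pmf n p))"
      by (intro nn_integral_cong) auto
    also have "\<dots> = (if c then 1 else 0) + ennreal (real n * p)"
      by (subst nn_integral_add) (auto simp: Suc measure_pmf.emeasure_space_1)
    finally show "(\<integral>\<^sup>+k. of_nat ((if c then 1 else 0) + k) \<partial>measure_pmf (binomial_pmf n p)) = (if c then 1 else 0) + ennreal (real n * p)" .
  qed
  also have "\<dots> = ennreal p * (1 + ennreal (real n * p)) + ennreal (1 - p) * ennreal (real n * p)"
    using assms by (subst nn_integral_bernoulli_pmf) (auto simp: mult.commute)
  also have "\<dots> = ennreal (p * (1 + real n * p) + (1 - p) * (real n * p))"
    using assms by (simp add: ennreal_mult'' ennreal_plus[symmetric] flip: ennreal_1)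
  also have "p * (1 + real n * p) + (1 - p) * (real n * p) = real (Suc n) * p" by (simp add: algebra_simps)
  finally show ?case .
qed

locale stable_feedback_queue = feedback_queue M G a b p \<tau> \<sigma> NB K
  for M :: "'a measure" and G a b p \<tau> \<sigma> NB K +
  fixes lam r :: real
  assumes lam_eq: "lam = 1 / a" and r_eq: "r = p + lam * b" and r_less_1: "r < 1"
    and irv: "intermediate_regularly_varying G"
begin

sublocale G: irv_distribution G b
  by (intro irv_distribution.intro G_distribution irv_distribution_axioms.intro G_nonneg G_integrable G_mean irv)

abbreviation F :: "real \<Rightarrow> real" where "F \<equiv> tail G"

definition X :: "nat \<Rightarrow> 'a \<Rightarrow> nat" where
  "X k \<omega> = queue_behind (\<lambda>n. \<tau> n \<omega>) (\<lambda>k i. \<sigma> k i \<omega>) (\<lambda>k n. NB k n \<omega>) k"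

definition T :: "nat \<Rightarrow> 'a \<Rightarrow> real" where
  "T k \<omega> = service_epoch (\<lambda>n. \<tau> n \<omega>) (\<lambda>k i. \<sigma> k i \<omega>) (\<lambda>k n. NB k n \<omega>) k"

definition N :: "real \<Rightarrow> 'a \<Rightarrow> nat" where
  "N t \<omega> = renewal_count (\<lambda>n. \<tau> n \<omega>) t"

text \<open>
  The arrival epochs.  Epochs equal to \<open>0\<close> occur with positive probability if the inter-arrival
  times may vanish, and are not counted by \<open>N\<close>.
\<close>

definition S :: "nat \<Rightarrow> 'a \<Rightarrow> real" where
  "S n \<omega> = (\<Sum>j=1..n. \<tau> j \<omega>)"

text \<open>
  The work served in round \<open>k + 1\<close> when \<open>n\<close> customers are behind the tagged one.  Its \<open>n + 1\<close>
  terms include the service of the tagged customer, which has index \<open>0\<close>.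
\<close>

definition W :: "nat \<Rightarrow> nat \<Rightarrow> 'a \<Rightarrow> real" where
  "W k n \<omega> = (\<Sum>i=0..n. \<sigma> (Suc k) i \<omega>)"

lemma X_0 [simp]: "X 0 \<omega> = 0" and T_0 [simp]: "T 0 \<omega> = 0"
  by (simp_all add: X_def T_def)

lemma T_Suc: "T (Suc k) \<omega> = T k \<omega> + W k (X k \<omega>) \<omega>"
  by (simp add: T_def X_def W_def)

lemma X_Suc: "X (Suc k) \<omega> = N (T (Suc k) \<omega>) \<omega> - N (T k \<omega>) \<omega> + NB (Suc k) (X k \<omega>) \<omega>"
  by (simp add: T_def X_def N_def)

lemma N_eq: "N t \<omega> = card {n. 1 \<le> n \<and> 0 < S n \<omega> \<and> S n \<omega> \<le> t}"
  by (simp add: N_def renewal_count_def S_def)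

lemma S_0 [simp]: "S 0 \<omega> = 0"
  by (simp add: S_def)

lemma sojourn_time_eq:
  "sojourn_time (\<lambda>n. \<tau> n \<omega>) (\<lambda>k i. \<sigma> k i \<omega>) (\<lambda>k n. NB k n \<omega>) k = T k \<omega>"
  by (induction k) (simp_all add: sojourn_time_def T_def cycle_length_def)

section \<open>Independence of the past and the current round\<close>

definition sources :: "source set" where
  "sources = {Interarrival n |n. n \<ge> 1} \<union> {Service k i |k i. k \<ge> 1} \<union> {Feedback k |k. k \<ge> 1} \<union> {Services_of_tagged}"

definition source_events :: "source \<Rightarrow> 'a set set" where
  "source_events src = (case src of
             Interarrival n \<Rightarrow> sets (vimage_algebra (space M) (\<tau> n) borel)
           | Service k i \<Rightarrow> sets (vimage_algebra (space M) (\<sigma> k i) borel)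
           | Feedback k \<Rightarrow> sets (vimage_algebra (space M) (\<lambda>\<omega> n. NB k n \<omega>)
               (Pi\<^sub>M UNIV (\<lambda>_. count_space UNIV)))
           | Services_of_tagged \<Rightarrow> sets (vimage_algebra (space M) K (count_space UNIV)))"

definition alg :: "source set \<Rightarrow> 'a measure" where
  "alg I = sigma (space M) (\<Union>s\<in>I. source_events s)"

lemma indep_source_events: "indep_sets source_events sources"
  using independent_sources unfolding source_events_def[abs_def] sources_def .

lemma source_events_subset: "source_events s \<subseteq> Pow (space M)"
  unfolding source_events_def by (cases s) (auto dest!: sets.sets_into_space)

lemma space_alg [simp]: "space (alg I) = space M"
  unfolding alg_def using source_events_subset by (subst space_measure_of) auto

lemma sets_alg: "sets (alg I) = sigma_sets (space M) (\<Union>s\<in>I. source_events s)"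
  unfolding alg_def using source_events_subset by (subst sets_measure_of) auto

lemma sets_alg_mono: "I \<subseteq> J \<Longrightarrow> sets (alg I) \<subseteq> sets (alg J)"
  unfolding sets_alg by (intro sigma_sets_mono') auto

lemma sets_alg_events: "I \<subseteq> sources \<Longrightarrow> sets (alg I) \<subseteq> events"
  unfolding sets_alg using indep_source_events
  by (intro sets.sigma_sets_subset) (auto simp: indep_sets_def)

lemma measurable_alg_mono: "f \<in> measurable (alg I) P \<Longrightarrow> I \<subseteq> J \<Longrightarrow> f \<in> measurable (alg J) P"
  using sets_alg_mono[of I J] by (auto simp: measurable_def)

lemma measurable_algD: "f \<in> measurable (alg I) P \<Longrightarrow> I \<subseteq> sources \<Longrightarrow> f \<in> measurable M P"
  using sets_alg_events[of I] by (auto simp: measurable_def)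

lemma measurable_alg_source:
  assumes "s \<in> I" "f \<in> measurable (vimage_algebra (space M) g Q) P"
    and "source_events s = sets (vimage_algebra (space M) g Q)"
  shows "f \<in> measurable (alg I) P"
proof -
  have "sets (vimage_algebra (space M) g Q) \<subseteq> sets (alg I)"
    unfolding sets_alg assms(3)[symmetric] using assms(1) by auto
  then show ?thesis using assms(2) by (auto simp: measurable_def)
qed

lemma measurable_alg_interarrival: "Interarrival n \<in> I \<Longrightarrow> \<tau> n \<in> borel_measurable (alg I)"
  by (rule measurable_alg_source[OF _ measurable_vimage_algebra1]) (auto simp: source_events_def)

lemma measurable_alg_service: "Service k i \<in> I \<Longrightarrow> \<sigma> k i \<in> borel_measurable (alg I)"
  by (rule measurable_alg_source[OF _ measurable_vimage_algebra1]) (auto simp: source_events_def)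

lemma measurable_alg_tagged: "Services_of_tagged \<in> I \<Longrightarrow> K \<in> measurable (alg I) (count_space UNIV)"
  by (rule measurable_alg_source[OF _ measurable_vimage_algebra1]) (auto simp: source_events_def)

lemma measurable_alg_feedback: "Feedback k \<in> I \<Longrightarrow> NB k n \<in> measurable (alg I) (count_space UNIV)"
proof -
  assume I: "Feedback k \<in> I"
  have "(\<lambda>\<omega> n. NB k n \<omega>) \<in> measurable (alg I) (Pi\<^sub>M UNIV (\<lambda>_. count_space UNIV))"
    by (rule measurable_alg_source[OF I measurable_vimage_algebra1]) (auto simp: source_events_def space_PiM)
  from measurable_compose[OF this measurable_component_singleton[of n]]
  show ?thesis by simp
qed

lemma indep_alg:
  assumes "I \<inter> J = {}" "I \<subseteq> sources" "J \<subseteq> sources" "A \<in> sets (alg I)" "B \<in> sets (alg J)"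
  shows "prob (A \<inter> B) = prob A * prob B"
proof -
  have "indep_sets (\<lambda>c. sigma_sets (space M) (\<Union>i\<in>case_bool I J c. source_events i)) UNIV"
  proof (rule indep_sets_collect_sigma)
    show "indep_sets source_events (\<Union>c\<in>UNIV. case_bool I J c)"
      using assms by (intro indep_sets_mono_index[OF _ indep_source_events]) (auto split: bool.splits)
    show "Int_stable (source_events i)" for i
      by (cases i) (auto simp: source_events_def Int_stable_def)
    show "disjoint_family_on (case_bool I J) UNIV"
      using assms(1) by (auto simp: disjoint_family_on_def split: bool.splits)
  qed
  then have "indep_set (sets (alg I)) (sets (alg J))"
    unfolding indep_set_def sets_alg
    by (rule indep_sets_mono_sets) (auto split: bool.splits)
  then show ?thesis using assms by (intro indep_setD)
qed

text \<open>
  The product rule with an indicator as one factor: the queue length takes countably many values,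
  so conditioning on it is a sum over indicators of the past.
\<close>

lemma nn_integral_indicator_alg:
  assumes IJ: "I \<inter> J = {}" "I \<subseteq> sources" "J \<subseteq> sources" and A: "A \<in> sets (alg I)"
    and g: "g \<in> borel_measurable (alg J)"
  shows "(\<integral>\<^sup>+\<omega>. indicator A \<omega> * g \<omega> \<partial>M) = emeasure M A * (\<integral>\<^sup>+\<omega>. g \<omega> \<partial>M)"
  using g
proof (induction rule: borel_measurable_induct)
  have AM [measurable]: "A \<in> events" using sets_alg_events[OF IJ(2)] A by auto
  case (cong f g)
  have "(\<integral>\<^sup>+\<omega>. f \<omega> \<partial>M) = (\<integral>\<^sup>+\<omega>. g \<omega> \<partial>M)" "(\<integral>\<^sup>+\<omega>. indicator A \<omega> * f \<omega> \<partial>M) = (\<integral>\<^sup>+\<omega>. indicator A \<omega> * g \<omega> \<partial>M)"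
    using cong(3) by (auto intro!: nn_integral_cong)
  with cong show ?case by simp
next
  have AM [measurable]: "A \<in> events" using sets_alg_events[OF IJ(2)] A by auto
  case (set B)
  have BM [measurable]: "B \<in> events" using sets_alg_events[OF IJ(3)] set by auto
  have "(\<integral>\<^sup>+\<omega>. indicator A \<omega> * indicator B \<omega> \<partial>M) = emeasure M (A \<inter> B)"
    by (simp add: indicator_inter_arith[symmetric])
  then show ?case using indep_alg[OF IJ A set] by (simp add: emeasure_eq_measure ennreal_mult'')
next
  have AM [measurable]: "A \<in> events" using sets_alg_events[OF IJ(2)] A by auto
  case (mult u c)
  have [measurable]: "u \<in> borel_measurable M" using mult(2) IJ(3) by (rule measurable_algD)
  show ?case using mult by (simp add: mult.left_commute[of _ c] nn_integral_cmult)
next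
  have AM [measurable]: "A \<in> events" using sets_alg_events[OF IJ(2)] A by auto
  case (add u v)
  have [measurable]: "u \<in> borel_measurable M" "v \<in> borel_measurable M"
    using add(1,3) IJ(3) by (auto intro: measurable_algD)
  show ?case using add by (simp add: distrib_left nn_integral_add)
next
  have AM [measurable]: "A \<in> events" using sets_alg_events[OF IJ(2)] A by auto
  case (seq U)
  have [measurable]: "\<And>i. U i \<in> borel_measurable M"
    using seq(1) IJ(3) by (auto intro: measurable_algD)
  have "(\<integral>\<^sup>+\<omega>. indicator A \<omega> * (SUP i. U i) \<omega> \<partial>M) = (\<integral>\<^sup>+\<omega>. (SUP i. indicator A \<omega> * U i \<omega>) \<partial>M)"
    by (intro nn_integral_cong) (simp add: SUP_mult_left_ennreal image_comp)
  also have "\<dots> = (SUP i. \<integral>\<^sup>+\<omega>. indicator A \<omega> * U i \<omega> \<partial>M)"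
    using seq by (intro nn_integral_monotone_convergence_SUP) (auto simp: incseq_def le_fun_def intro!: mult_left_mono)
  also have "\<dots> = (SUP i. emeasure M A * (\<integral>\<^sup>+\<omega>. U i \<omega> \<partial>M))" using seq by simp
  also have "\<dots> = emeasure M A * (SUP i. \<integral>\<^sup>+\<omega>. U i \<omega> \<partial>M)" by (simp add: SUP_mult_left_ennreal)
  also have "(SUP i. \<integral>\<^sup>+\<omega>. U i \<omega> \<partial>M) = (\<integral>\<^sup>+\<omega>. (SUP i. U i \<omega>) \<partial>M)"
    using seq by (intro nn_integral_monotone_convergence_SUP[symmetric]) auto
  finally show ?case by (simp add: image_comp)
qed

definition arrivals :: "source set" where
  "arrivals = {Interarrival n |n. n \<ge> 1}"

text \<open>
  Rounds are numbered from \<open>1\<close>: the state \<open>X l\<close>, \<open>T l\<close> is a function of \<open>past l\<close>, and round \<open>l + 1\<close>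
  uses in addition only the services and feedback decisions in \<open>stage l\<close>.  All arrivals belong to
  every past, so the past knows the arrivals of later rounds as well; what is independent of it is
  the work of the next round and the feedback at its end.
\<close>

definition past :: "nat \<Rightarrow> source set" where
  "past l = arrivals \<union> {Service k i |k i. 1 \<le> k \<and> k \<le> l} \<union> {Feedback k |k. 1 \<le> k \<and> k \<le> l}"

definition stage :: "nat \<Rightarrow> source set" where
  "stage l = {Service (Suc l) i |i. True} \<union> {Feedback (Suc l)}"

lemma arrivals_sources [simp]: "arrivals \<subseteq> sources"
  and past_sources [simp]: "past l \<subseteq> sources"
  and stage_sources [simp]: "stage l \<subseteq> sources"
  and past_stage [simp]: "past l \<inter> stage l = {}"
  and arrivals_past [simp]: "arrivals \<subseteq> past l"
  and past_mono: "l \<le> l' \<Longrightarrow> past l \<subseteq> past l'"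
  and stage_past: "stage l \<subseteq> past (Suc l)"
  by (auto simp: arrivals_def past_def stage_def sources_def)

lemma measurable_S: "S n \<in> borel_measurable (alg arrivals)"
  unfolding S_def[abs_def] by (intro borel_measurable_sum measurable_alg_interarrival) (auto simp: arrivals_def)

lemma measurable_W: "W l n \<in> borel_measurable (alg (stage l))"
  unfolding W_def[abs_def] by (intro borel_measurable_sum measurable_alg_service) (auto simp: stage_def)

lemma measurable_N_compose:
  assumes I: "arrivals \<subseteq> I" and t: "t \<in> borel_measurable (alg I)"
  shows "(\<lambda>\<omega>. N (t \<omega>) \<omega>) \<in> measurable (alg I) (count_space UNIV)"
proof -
  note [measurable] = measurable_alg_mono[OF measurable_S I] t
  show ?thesis unfolding N_eq by measurable
qed

lemma measurable_XT:
  "X l \<in> measurable (alg (past l)) (count_space UNIV) \<and> T l \<in> borel_measurable (alg (past l))"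
proof (induction l)
  case 0
  have "X 0 = (\<lambda>_. 0)" "T 0 = (\<lambda>_. 0)" by auto
  then show ?case by simp
next
  case (Suc l)
  have sub: "past l \<subseteq> past (Suc l)" by (rule past_mono) simp
  have [measurable]: "X l \<in> measurable (alg (past (Suc l))) (count_space UNIV)"
    "T l \<in> borel_measurable (alg (past (Suc l)))"
    using Suc measurable_alg_mono[OF _ sub] by auto
  have [measurable]: "W l n \<in> borel_measurable (alg (past (Suc l)))" for n
    by (rule measurable_alg_mono[OF measurable_W stage_past])
  have [measurable]: "NB (Suc l) n \<in> measurable (alg (past (Suc l))) (count_space UNIV)" for n
    by (rule measurable_alg_feedback) (simp add: past_def)
  have [measurable]: "(\<lambda>\<omega>. W l (X l \<omega>) \<omega>) \<in> borel_measurable (alg (past (Suc l)))"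
    by (rule measurable_compose_countable[where g = "X l"]) measurable
  have [measurable]: "(\<lambda>\<omega>. NB (Suc l) (X l \<omega>) \<omega>) \<in> measurable (alg (past (Suc l))) (count_space UNIV)"
    by (rule measurable_compose_countable[where g = "X l"]) measurable
  have T: "T (Suc l) \<in> borel_measurable (alg (past (Suc l)))"
    unfolding T_Suc[abs_def] by measurable
  note [measurable] = measurable_N_compose[OF arrivals_past[of "Suc l"] T]
    measurable_N_compose[OF arrivals_past[of "Suc l"] \<open>T l \<in> borel_measurable (alg (past (Suc l)))\<close>]
  have "X (Suc l) \<in> measurable (alg (past (Suc l))) (count_space UNIV)"
    unfolding X_Suc[abs_def] by measurable
  with T show ?case by simp
qed

lemmas measurable_X_past = measurable_XT[THEN conjunct1] and measurable_T_past = measurable_XT[THEN conjunct2]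

lemma measurable_X [measurable]: "X l \<in> measurable M (count_space UNIV)"
  by (rule measurable_algD[OF measurable_X_past past_sources])

lemma measurable_T [measurable]: "T l \<in> borel_measurable M"
  by (rule measurable_algD[OF measurable_T_past past_sources])

lemma measurable_S' [measurable]: "S n \<in> borel_measurable M"
  by (rule measurable_algD[OF measurable_S arrivals_sources])

lemma measurable_W' [measurable]: "W l n \<in> borel_measurable M"
  by (rule measurable_algD[OF measurable_W stage_sources])

lemma measurable_sigma [measurable]: "\<sigma> (Suc l) i \<in> borel_measurable M"
  by (rule service_measurable) simp

lemma measurable_NB [measurable]: "NB (Suc l) n \<in> measurable M (count_space UNIV)"
  by (rule feedback_measurable) simp

lemma measurable_K [measurable]: "K \<in> measurable M (count_space UNIV)"
  by (rule K_measurable)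

lemma measurable_N [measurable (raw)]:
  assumes [measurable]: "t \<in> borel_measurable M"
  shows "(\<lambda>\<omega>. N (t \<omega>) \<omega>) \<in> measurable M (count_space UNIV)"
  unfolding N_eq by measurable

lemma measurable_W_X [measurable]: "(\<lambda>\<omega>. W l (X l \<omega>) \<omega>) \<in> borel_measurable M"
  by (rule measurable_compose_countable[where g = "X l"]) measurable

lemma measurable_NB_X [measurable]: "(\<lambda>\<omega>. NB (Suc l) (X l \<omega>) \<omega>) \<in> measurable M (count_space UNIV)"
  by (rule measurable_compose_countable[where g = "X l"]) measurable

text \<open>
  Conditionally on the past, the random index \<open>X l\<close> may be treated as a constant: on each event
  \<open>X l = n\<close> the function \<open>f n\<close> of the current round is independent of the past.
\<close>

lemma nn_integral_past_stage:
  fixes f :: "nat \<Rightarrow> 'a \<Rightarrow> ennreal"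
  assumes A: "A \<in> sets (alg (past l))" and f: "\<And>n. f n \<in> borel_measurable (alg (stage l))"
  shows "(\<integral>\<^sup>+\<omega>. indicator A \<omega> * f (X l \<omega>) \<omega> \<partial>M)
       = (\<integral>\<^sup>+\<omega>. indicator A \<omega> * (\<integral>\<^sup>+\<omega>'. f (X l \<omega>) \<omega>' \<partial>M) \<partial>M)"
proof -
  let ?A = "\<lambda>n. A \<inter> {\<omega> \<in> space M. X l \<omega> = n}"
  have AM [measurable]: "A \<in> events" using sets_alg_events[OF past_sources] A by auto
  have [measurable]: "f n \<in> borel_measurable M" for n
    using f by (rule measurable_algD) simp
  have An: "?A n \<in> sets (alg (past l))" for n
  proof -
    have "{\<omega> \<in> space (alg (past l)). X l \<omega> = n} \<in> sets (alg (past l))"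
      using measurable_X_past[of l] by measurable
    then show ?thesis using A by auto
  qed
  have AnM [measurable]: "?A n \<in> events" for n
    using An sets_alg_events[OF past_sources] by auto
  have split: "indicator A \<omega> * h (X l \<omega>) = (\<Sum>n. indicator (?A n) \<omega> * h n)" if "\<omega> \<in> space M" for \<omega> and h :: "nat \<Rightarrow> ennreal"
  proof -
    have "(\<Sum>n. indicator (?A n) \<omega> * h n) = (\<Sum>n\<in>{X l \<omega>}. indicator (?A n) \<omega> * h n)"
      using that by (intro suminf_finite) auto
    also have "\<dots> = indicator A \<omega> * h (X l \<omega>)" using that by (auto simp: indicator_def)
    finally show ?thesis by simp
  qed
  have meas_ind: "(\<lambda>\<omega>. indicator (?A n) \<omega> * h \<omega>) \<in> borel_measurable M" if "h \<in> borel_measurable M" for n and h :: "'a \<Rightarrow> ennreal"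
    using that AnM by (intro borel_measurable_times_ennreal borel_measurable_indicator)
  have "(\<integral>\<^sup>+\<omega>. indicator A \<omega> * f (X l \<omega>) \<omega> \<partial>M) = (\<integral>\<^sup>+\<omega>. (\<Sum>n. indicator (?A n) \<omega> * f n \<omega>) \<partial>M)"
    using split[of _ "\<lambda>n. f n _"] by (intro nn_integral_cong) auto
  also have "\<dots> = (\<Sum>n. \<integral>\<^sup>+\<omega>. indicator (?A n) \<omega> * f n \<omega> \<partial>M)" by (intro nn_integral_suminf meas_ind) measurable
  also have "\<dots> = (\<Sum>n. emeasure M (?A n) * (\<integral>\<^sup>+\<omega>. f n \<omega> \<partial>M))"
    by (intro suminf_cong nn_integral_indicator_alg[OF past_stage past_sources stage_sources An f])
  also have "\<dots> = (\<Sum>n. \<integral>\<^sup>+\<omega>. indicator (?A n) \<omega> * (\<integral>\<^sup>+\<omega>'. f n \<omega>' \<partial>M) \<partial>M)"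
    by (intro suminf_cong, subst nn_integral_multc) (auto intro: AnM)
  also have "\<dots> = (\<integral>\<^sup>+\<omega>. (\<Sum>n. indicator (?A n) \<omega> * (\<integral>\<^sup>+\<omega>'. f n \<omega>' \<partial>M)) \<partial>M)"
    by (intro nn_integral_suminf[symmetric] meas_ind) measurable
  also have "\<dots> = (\<integral>\<^sup>+\<omega>. indicator A \<omega> * (\<integral>\<^sup>+\<omega>'. f (X l \<omega>) \<omega>' \<partial>M) \<partial>M)"
    using split[of _ "\<lambda>n. \<integral>\<^sup>+\<omega>'. f n \<omega>' \<partial>M"] by (intro nn_integral_cong) auto
  finally show ?thesis .
qed

lemma alg_past_events: "A \<in> sets (alg (past l)) \<Longrightarrow> A \<in> events"
  and alg_arrivals_events: "A \<in> sets (alg arrivals) \<Longrightarrow> A \<in> events"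
  using sets_alg_events[OF past_sources] sets_alg_events[OF arrivals_sources] by auto

lemma space_past: "space M \<in> sets (alg (past l))"
  using sets.top[of "alg (past l)"] by simp

lemma past_stage_event:
  assumes A: "A \<in> sets (alg (past l))" and P: "\<And>n. {\<omega> \<in> space M. P n \<omega>} \<in> sets (alg (stage l))"
  shows "{\<omega> \<in> space M. \<omega> \<in> A \<and> Q (X l \<omega>) \<and> P (X l \<omega>) \<omega>} \<in> events"
proof -
  have AM [measurable]: "A \<in> events" using A by (rule alg_past_events)
  have PM [measurable]: "{\<omega> \<in> space M. P n \<omega>} \<in> events" for n
    using sets_alg_events[OF stage_sources] P by auto
  have "{\<omega> \<in> space M. \<omega> \<in> A \<and> Q (X l \<omega>) \<and> P (X l \<omega>) \<omega>}
      = (\<Union>n\<in>{n. Q n}. A \<inter> {\<omega> \<in> space M. X l \<omega> = n} \<inter> {\<omega> \<in> space M. P n \<omega>})"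
    by auto
  also have "\<dots> \<in> events" by measurable
  finally show ?thesis .
qed

lemma stage_event:
  assumes P: "\<And>n. {\<omega> \<in> space M. P n \<omega>} \<in> sets (alg (stage l))"
  shows "{\<omega> \<in> space M. Q (X l \<omega>) \<and> P (X l \<omega>) \<omega>} \<in> events"
proof -
  have "{\<omega> \<in> space M. \<omega> \<in> space M \<and> Q (X l \<omega>) \<and> P (X l \<omega>) \<omega>} = {\<omega> \<in> space M. Q (X l \<omega>) \<and> P (X l \<omega>) \<omega>}"
    by auto
  with past_stage_event[OF space_past P, where Q = Q] show ?thesis by simp
qed

text \<open>
  The form in which independence of past and current round enters all tail estimates: \<open>A\<close> is an
  event of the past, \<open>Q\<close> restricts the queue length, and \<open>P n\<close> is an event of the current round if
  the queue length is \<open>n\<close>.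
\<close>

lemma prob_stage_le:
  assumes A: "A \<in> sets (alg (past l))" and P: "\<And>n. {\<omega> \<in> space M. P n \<omega>} \<in> sets (alg (stage l))"
    and w: "\<And>n. 0 \<le> w n" "integrable M (\<lambda>\<omega>. w (X l \<omega>))" and c: "0 \<le> c"
    and le: "\<And>n. Q n \<Longrightarrow> \<P>(\<omega> in M. P n \<omega>) \<le> c * w n"
  shows "\<P>(\<omega> in M. \<omega> \<in> A \<and> Q (X l \<omega>) \<and> P (X l \<omega>) \<omega>) \<le> c * (\<integral>\<omega>. indicator A \<omega> * w (X l \<omega>) \<partial>M)"
proof -
  let ?E = "{\<omega> \<in> space M. \<omega> \<in> A \<and> Q (X l \<omega>) \<and> P (X l \<omega>) \<omega>}"
  let ?B = "\<lambda>n. if Q n then {\<omega> \<in> space M. P n \<omega>} else {}"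
  have AM [measurable]: "A \<in> events" using A by (rule alg_past_events)
  have BM: "?B n \<in> events" for n using sets_alg_events[OF stage_sources] P by auto
  have "emeasure M ?E = (\<integral>\<^sup>+\<omega>. indicator ?E \<omega> \<partial>M)" using past_stage_event[OF A P, where Q = Q] by simp
  also have "\<dots> = (\<integral>\<^sup>+\<omega>. indicator A \<omega> * indicator (?B (X l \<omega>)) \<omega> \<partial>M)"
    by (intro nn_integral_cong) (auto simp: indicator_def)
  also have "\<dots> = (\<integral>\<^sup>+\<omega>. indicator A \<omega> * (\<integral>\<^sup>+\<omega>'. indicator (?B (X l \<omega>)) \<omega>' \<partial>M) \<partial>M)"
    using P by (intro nn_integral_past_stage[OF A]) auto
  also have "\<dots> \<le> (\<integral>\<^sup>+\<omega>. ennreal (c * (indicator A \<omega> * w (X l \<omega>))) \<partial>M)"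
  proof (intro nn_integral_mono)
    fix \<omega>
    have "(\<integral>\<^sup>+\<omega>'. indicator (?B (X l \<omega>)) \<omega>' \<partial>M) = ennreal (prob (?B (X l \<omega>)))"
      using BM[of "X l \<omega>"] by (simp only: nn_integral_indicator emeasure_eq_measure)
    also have "\<dots> \<le> ennreal (c * w (X l \<omega>))" using le c w by (intro ennreal_leI) auto
    finally show "indicator A \<omega> * (\<integral>\<^sup>+\<omega>'. indicator (?B (X l \<omega>)) \<omega>' \<partial>M) \<le> ennreal (c * (indicator A \<omega> * w (X l \<omega>)))"
      by (auto simp: indicator_def)
  qed
  also have "\<dots> = ennreal (\<integral>\<omega>. c * (indicator A \<omega> * w (X l \<omega>)) \<partial>M)"
    using w c integrable_real_mult_indicator[OF AM w(2)]
    by (intro nn_integral_eq_integral) (auto simp: mult.commute)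
  finally have "prob ?E \<le> (\<integral>\<omega>. c * (indicator A \<omega> * w (X l \<omega>)) \<partial>M)"
    using w c by (simp add: emeasure_eq_measure)
  then show "prob ?E \<le> c * (\<integral>\<omega>. indicator A \<omega> * w (X l \<omega>) \<partial>M)" by simp
qed

lemma prob_stage_const_le:
  assumes A: "A \<in> sets (alg (past l))" and P: "\<And>n. {\<omega> \<in> space M. P n \<omega>} \<in> sets (alg (stage l))" and c: "0 \<le> c"
    and le: "\<And>n. Q n \<Longrightarrow> \<P>(\<omega> in M. P n \<omega>) \<le> c"
  shows "\<P>(\<omega> in M. \<omega> \<in> A \<and> Q (X l \<omega>) \<and> P (X l \<omega>) \<omega>) \<le> c * prob A"
proof -
  have "\<P>(\<omega> in M. \<omega> \<in> A \<and> Q (X l \<omega>) \<and> P (X l \<omega>) \<omega>) \<le> c * (\<integral>\<omega>. indicator A \<omega> * 1 \<partial>M)"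
    by (rule prob_stage_le[OF A P]) (use c le in auto)
  then show ?thesis using alg_past_events[OF A] by simp
qed

lemma source_events_eq:
  assumes "f \<in> measurable M P" "source_events s = sets (vimage_algebra (space M) f P)"
  shows "source_events s = {f -` A \<inter> space M |A. A \<in> sets P}"
  using assms measurable_space[OF assms(1)] by (simp add: sets_vimage_algebra2)

lemma indep_vars_service: "indep_vars (\<lambda>_. borel) (\<sigma> (Suc l)) I"
  unfolding indep_vars_def2
proof (intro conjI ballI)
  have "indep_sets (\<lambda>i. source_events (Service (Suc l) i)) I"
    by (rule indep_sets_reindex_inj[of _ "Service (Suc l)"], rule indep_sets_mono_index[OF _ indep_source_events])
      (auto simp: sources_def inj_on_def)
  moreover have "source_events (Service (Suc l) i) = {\<sigma> (Suc l) i -` A \<inter> space M |A. A \<in> sets borel}" for i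
    by (rule source_events_eq) (auto simp: source_events_def)
  ultimately show "indep_sets (\<lambda>i. {\<sigma> (Suc l) i -` A \<inter> space M |A. A \<in> sets borel}) I" by simp
qed simp

lemma indep_vars_interarrival: "I \<subseteq> {1..} \<Longrightarrow> indep_vars (\<lambda>_. borel) \<tau> I"
  unfolding indep_vars_def2
proof (intro conjI ballI)
  assume I: "I \<subseteq> {1..}"
  have ind: "indep_sets (\<lambda>i. source_events (Interarrival i)) I"
    using I by (intro indep_sets_reindex_inj[of _ "Interarrival"] indep_sets_mono_index[OF _ indep_source_events])
      (auto simp: sources_def inj_on_def)
  have eq: "source_events (Interarrival i) = {\<tau> i -` A \<inter> space M |A. A \<in> sets borel}" if "i \<in> I" for i
    using I that by (intro source_events_eq interarrival_measurable) (auto simp: source_events_def)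
  show "indep_sets (\<lambda>i. {\<tau> i -` A \<inter> space M |A. A \<in> sets borel}) I"
    by (rule indep_sets_mono_sets[OF ind]) (simp only: eq order_refl)
  show "random_variable borel (\<tau> i)" if "i \<in> I" for i
    using I that by (intro interarrival_measurable) auto
qed

lemma prob_service_gt: "\<P>(\<omega> in M. x < \<sigma> (Suc l) i \<omega>) = F x"
proof -
  have "F x = measure (distr M borel (\<sigma> (Suc l) i)) {x<..}"
    using service_distribution[of "Suc l" i] by (simp add: G.tail_eq)
  also have "\<dots> = \<P>(\<omega> in M. x < \<sigma> (Suc l) i \<omega>)"
    by (subst measure_distr) (auto intro!: arg_cong[where f = prob])
  finally show ?thesis by simp
qed

lemma AE_service_nonneg: "AE \<omega> in M. \<forall>l i. 0 \<le> \<sigma> (Suc l) i \<omega>"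
  unfolding AE_all_countable
proof (intro allI)
  fix l i
  have "AE x in distr M borel (\<sigma> (Suc l) i). 0 \<le> x" by (subst service_distribution) (use G_nonneg in auto)
  then show "AE \<omega> in M. 0 \<le> \<sigma> (Suc l) i \<omega>" by (subst (asm) AE_distr_iff) auto
qed

lemma nn_integral_service: "(\<integral>\<^sup>+\<omega>. ennreal (\<sigma> (Suc l) i \<omega>) \<partial>M) = ennreal b"
proof -
  have "(\<integral>\<^sup>+\<omega>. ennreal (\<sigma> (Suc l) i \<omega>) \<partial>M) = (\<integral>\<^sup>+x. ennreal x \<partial>distr M borel (\<sigma> (Suc l) i))"
    by (subst nn_integral_distr) auto
  also have "\<dots> = ennreal b"
    using service_distribution[of "Suc l" i] G_integrable G_nonneg G_mean by (simp add: nn_integral_eq_integral)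
  finally show ?thesis .
qed

lemma nn_integral_NB: "(\<integral>\<^sup>+\<omega>. of_nat (NB (Suc l) n \<omega>) \<partial>M) = ennreal (real n * p)"
proof -
  have "(\<integral>\<^sup>+\<omega>. of_nat (NB (Suc l) n \<omega>) \<partial>M) = (\<integral>\<^sup>+k. of_nat k \<partial>distr M (count_space UNIV) (NB (Suc l) n))"
    by (subst nn_integral_distr) auto
  also have "\<dots> = ennreal (real n * p)"
    using p_pos p_less_1 by (simp add: feedback_distribution nn_integral_binomial_pmf)
  finally show ?thesis .
qed

lemma prob_NB: "\<P>(\<omega> in M. NB (Suc l) n \<omega> \<in> B) = measure (measure_pmf (binomial_pmf n p)) B"
proof -
  have "measure (measure_pmf (binomial_pmf n p)) B = measure (distr M (count_space UNIV) (NB (Suc l) n)) B"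
    by (simp add: feedback_distribution)
  also have "\<dots> = \<P>(\<omega> in M. NB (Suc l) n \<omega> \<in> B)"
    by (subst measure_distr) (auto intro!: arg_cong[where f = prob])
  finally show ?thesis by simp
qed

lemma AE_interarrival_nonneg: "AE \<omega> in M. \<forall>n\<ge>1. 0 \<le> \<tau> n \<omega>"
proof -
  have "AE \<omega> in M. 0 \<le> \<tau> n \<omega>" if "n \<ge> 1" for n
  proof -
    have "AE x in distr M borel (\<tau> 1). 0 \<le> x"
      using interarrival_nonneg interarrival_measurable[of 1] by (subst AE_distr_iff) auto
    then have "AE x in distr M borel (\<tau> n). 0 \<le> x" by (subst interarrival_identically_distributed[OF that])
    then show ?thesis using interarrival_measurable[OF that] by (subst (asm) AE_distr_iff) auto
  qed
  then show ?thesis by (auto simp: AE_all_countable intro: AE_impI)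
qed

lemma lam_pos: "0 < lam" using a_pos by (simp add: lam_eq)

lemma r_pos: "0 < r" using p_pos lam_pos b_pos by (simp add: r_eq add_pos_pos)

end

section \<open>The arrival process\<close>

context stable_feedback_queue begin

text \<open>
  The almost sure properties on which pathwise arguments rest.  The last one makes the counts
  \<open>N\<close> monotone in time, since the cardinality of an infinite set is \<open>0\<close>.
\<close>

definition good :: "'a \<Rightarrow> bool" where
  "good \<omega> \<longleftrightarrow> (\<forall>l i. 0 \<le> \<sigma> (Suc l) i \<omega>) \<and> (\<forall>n\<ge>1. 0 \<le> \<tau> n \<omega>) \<and> (\<forall>t. finite {n. S n \<omega> \<le> t})"

lemma S_add: "S (m + c) \<omega> = S m \<omega> + (\<Sum>j=m+1..m+c. \<tau> j \<omega>)"
  unfolding S_def by (rule sum.ub_add_nat) simp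

lemma interarrival_distribution:
  "prob_space (distr M borel (\<tau> 1))" "sets (distr M borel (\<tau> 1)) = sets borel"
  "AE y in distr M borel (\<tau> 1). 0 \<le> y" "integrable (distr M borel (\<tau> 1)) (\<lambda>y. y)"
  "(\<integral>y. y \<partial>distr M borel (\<tau> 1)) = a"
  using interarrival_measurable[of 1] interarrival_nonneg interarrival_integrable interarrival_mean
  by (auto intro!: prob_space_distr simp: AE_distr_iff integrable_distr_eq integral_distr)

text \<open>
  A run of \<open>c\<close> inter-arrival times that takes less than \<open>a' c\<close>, with \<open>a'\<close> below the mean, is a
  downward deviation of a sum of nonnegative variables.
\<close>

lemma prob_arrival_run_le:
  assumes "a' < a"
  obtains \<eta> where "0 < \<eta>"
    "\<And>m c. \<P>(\<omega> in M. S (m + c) \<omega> - S m \<omega> \<le> a' * real c) \<le> exp (- \<eta> * real c)"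
proof -
  let ?\<mu> = "(a + a') / 2"
  have \<mu>: "?\<mu> < (\<integral>y. y \<partial>distr M borel (\<tau> 1))" using assms interarrival_distribution(5) by simp
  obtain \<theta> where \<theta>: "0 < \<theta>"
    "\<And>(I :: nat set) Y u. finite I \<Longrightarrow> indep_vars (\<lambda>_. borel) Y I \<Longrightarrow> (\<And>i. i \<in> I \<Longrightarrow> distr M borel (Y i) = distr M borel (\<tau> 1))
      \<Longrightarrow> \<P>(\<omega> in M. (\<Sum>i\<in>I. Y i \<omega>) \<le> real (card I) * ?\<mu> - u) \<le> exp (- \<theta> * u)"
    by (rule iid_sum_lower_tail[OF interarrival_distribution(1-4) \<mu>, where 'i = nat]) blast
  show ?thesis
  proof (rule that[of "\<theta> * (a - a') / 2"])
    show "0 < \<theta> * (a - a') / 2" using \<theta>(1) assms by simp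
    fix m c
    have eq: "real (card {m+1..m+c}) * ?\<mu> - real c * (a - a') / 2 = a' * real c"
      by (simp add: field_simps)
    have "\<P>(\<omega> in M. S (m + c) \<omega> - S m \<omega> \<le> a' * real c)
        = \<P>(\<omega> in M. (\<Sum>j\<in>{m+1..m+c}. \<tau> j \<omega>) \<le> real (card {m+1..m+c}) * ?\<mu> - real c * (a - a') / 2)"
      unfolding eq S_add by simp
    also have "\<dots> \<le> exp (- \<theta> * (real c * (a - a') / 2))"
      by (intro \<theta>(2) indep_vars_interarrival interarrival_identically_distributed) auto
    finally show "\<P>(\<omega> in M. S (m + c) \<omega> - S m \<omega> \<le> a' * real c) \<le> exp (- (\<theta> * (a - a') / 2) * real c)"
      by (simp add: mult_ac)
  qed
qed

text \<open>
  Let \<open>n\<close> be the index of the last arrival up to time \<open>t\<close>.  Either \<open>S n\<close> is larger than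
  \<open>n / lam'\<close>, and then \<open>n < lam' t\<close>; or \<open>n\<close> belongs to the exceptional indices with
  \<open>S n \<le> n / lam'\<close>.  Taking for \<open>C\<close> the sum of all exceptional indices covers the second case, and
  the exponential bounds for runs make its mean finite.  The same sum dominates the number of
  arrivals at epoch \<open>0\<close>, which are exceptional.
\<close>

lemma renewal_linear_bound:
  assumes lam': "lam < lam'"
  obtains C where "C \<in> borel_measurable (alg arrivals)" "(\<integral>\<^sup>+\<omega>. C \<omega> \<partial>M) < \<top>"
    "\<And>\<omega> t. 0 \<le> t \<Longrightarrow> of_nat (N t \<omega>) \<le> ennreal (lam' * t) + C \<omega>"
    "\<And>\<omega>. C \<omega> < \<top> \<Longrightarrow> (\<forall>t. finite {n. S n \<omega> \<le> t}) \<and> of_nat (card {n. 1 \<le> n \<and> S n \<omega> \<le> 0}) \<le> C \<omega>"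
proof -
  have lam'_pos: "0 < lam'" using lam' lam_pos by simp
  define a' where "a' = 1 / lam'"
  have a': "0 < a'" "a' < a" using lam' lam_pos lam'_pos a_pos by (auto simp: a'_def lam_eq field_simps)
  obtain \<eta> where \<eta>: "0 < \<eta>"
    "\<And>m c. \<P>(\<omega> in M. S (m + c) \<omega> - S m \<omega> \<le> a' * real c) \<le> exp (- \<eta> * real c)"
    using prob_arrival_run_le[OF a'(2)] by blast
  define Bd where "Bd n = {\<omega> \<in> space M. S n \<omega> \<le> a' * real n}" for n
  define C :: "'a \<Rightarrow> ennreal" where "C \<omega> = (\<Sum>n. of_nat n * indicator {n. S n \<omega> \<le> a' * real n} n)" for \<omega>
  note [measurable] = measurable_S
  have C_ge: "of_nat n \<le> C \<omega>" if "S n \<omega> \<le> a' * real n" for n \<omega>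
  proof -
    have "(\<Sum>k\<in>{n}. of_nat k * indicator {n. S n \<omega> \<le> a' * real n} k) \<le> C \<omega>"
      unfolding C_def by (intro sum_le_suminf) auto
    then show ?thesis using that by simp
  qed
  show ?thesis
  proof (rule that[of C])
    show "C \<in> borel_measurable (alg arrivals)"
      unfolding C_def[abs_def] by (intro borel_measurable_suminf_order) measurable
    show "(\<integral>\<^sup>+\<omega>. C \<omega> \<partial>M) < \<top>"
    proof -
      have "(\<integral>\<^sup>+\<omega>. C \<omega> \<partial>M) = (\<Sum>n. \<integral>\<^sup>+\<omega>. of_nat n * indicator (Bd n) \<omega> \<partial>M)"
        unfolding C_def
        by (subst nn_integral_suminf[symmetric]) (auto simp: Bd_def intro!: nn_integral_cong suminf_cong split: split_indicator)
      also have "\<dots> = (\<Sum>n. ennreal (real n * prob (Bd n)))"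
        by (intro suminf_cong) (simp add: Bd_def nn_integral_cmult_indicator emeasure_eq_measure ennreal_mult'' flip: ennreal_of_nat_eq_real_of_nat)
      also have "\<dots> \<le> (\<Sum>n. ennreal (2 / \<eta> * exp (- \<eta> / 2) ^ n))"
      proof (intro suminf_le ennreal_leI)
        fix n
        have "prob (Bd n) \<le> exp (- \<eta> * real n)" using \<eta>(2)[of 0 n] by (simp add: Bd_def)
        also have "\<dots> = exp (- \<eta> / 2) ^ n * exp (- (\<eta> / 2 * real n))"
          by (simp add: exp_of_nat_mult[symmetric] exp_add[symmetric] field_simps)
        finally have "real n * prob (Bd n) \<le> real n * (exp (- \<eta> / 2) ^ n * exp (- (\<eta> / 2 * real n)))"
          by (rule mult_left_mono) simp
        then have "real n * prob (Bd n) \<le> (real n * exp (- (\<eta> / 2 * real n))) * exp (- \<eta> / 2) ^ n"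
          by (simp only: mult_ac)
        also have "\<dots> \<le> 2 / \<eta> * exp (- \<eta> / 2) ^ n"
        proof (rule mult_right_mono)
          have "\<eta> / 2 * real n \<le> exp (\<eta> / 2 * real n)" using exp_ge_add_one_self[of "\<eta> / 2 * real n"] by linarith
          then show "real n * exp (- (\<eta> / 2 * real n)) \<le> 2 / \<eta>" using \<eta>(1) by (simp add: exp_minus field_simps)
        qed simp
        finally show "real n * prob (Bd n) \<le> 2 / \<eta> * exp (- \<eta> / 2) ^ n" .
      qed auto
      also have "\<dots> < \<top>"
      proof -
        have "summable (\<lambda>n. 2 / \<eta> * exp (- \<eta> / 2) ^ n)"
          using \<eta>(1) by (intro summable_mult summable_geometric) auto
        then show ?thesis using \<eta>(1) by (subst suminf_ennreal2) auto
      qed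
      finally show ?thesis .
    qed
    show "of_nat (N t \<omega>) \<le> ennreal (lam' * t) + C \<omega>" if t: "0 \<le> t" for t \<omega>
    proof -
      define A where "A = {n. 1 \<le> n \<and> 0 < S n \<omega> \<and> S n \<omega> \<le> t}"
      have NA: "N t \<omega> = card A" by (simp only: N_eq A_def)
      show ?thesis
      proof (cases "finite A \<and> A \<noteq> {}")
        case False
        then have "N t \<omega> = 0" unfolding NA by auto
        then show ?thesis by simp
      next
        case True
        define n where "n = Max A"
        have "n \<in> A" using Max_in[of A] True by (simp add: n_def)
        then have n: "1 \<le> n" "S n \<omega> \<le> t" by (simp_all add: A_def)
        have "A \<subseteq> {1..n}"
        proof
          fix k assume "k \<in> A"
          then have "k \<le> n" using True by (simp add: n_def)
          moreover have "1 \<le> k" using \<open>k \<in> A\<close> by (simp add: A_def)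
          ultimately show "k \<in> {1..n}" by simp
        qed
        from card_mono[OF _ this] have Nn: "N t \<omega> \<le> n" unfolding NA by simp
        show ?thesis
        proof (cases "S n \<omega> \<le> a' * real n")
          case True
          have "of_nat (N t \<omega>) \<le> (of_nat n :: ennreal)" using Nn by simp
          also have "\<dots> \<le> C \<omega>" using True by (rule C_ge)
          also have "\<dots> \<le> ennreal (lam' * t) + C \<omega>" by (rule order_trans[OF _ add_increasing]) auto
          finally show ?thesis .
        next
          case False
          then have "real n \<le> lam' * S n \<omega>" using lam'_pos by (simp add: a'_def field_simps)
          also have "\<dots> \<le> lam' * t" using n lam'_pos by simp
          finally have "real n \<le> lam' * t" .
          then have "real (N t \<omega>) \<le> lam' * t" using Nn by linarith
          then have "of_nat (N t \<omega>) \<le> ennreal (lam' * t)"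
            by (metis ennreal_leI ennreal_of_nat_eq_real_of_nat)
          then show ?thesis by (rule order_trans) simp
        qed
      qed
    qed
    show "(\<forall>t. finite {n. S n \<omega> \<le> t}) \<and> of_nat (card {n. 1 \<le> n \<and> S n \<omega> \<le> 0}) \<le> C \<omega>" if C: "C \<omega> < \<top>" for \<omega>
    proof -
      let ?B = "{n. S n \<omega> \<le> a' * real n}"
      have finB: "finite ?B"
      proof (rule ccontr)
        assume inf: "infinite ?B"
        obtain n0 :: nat where n0: "C \<omega> < of_nat n0" using C ennreal_Ex_less_of_nat by (auto simp: less_top)
        obtain n where "n \<ge> n0" "n \<in> ?B" using inf by (auto simp: infinite_nat_iff_unbounded_le)
        then have "of_nat n0 \<le> C \<omega>" using C_ge[of n \<omega>] by (metis (mono_tags, lifting) mem_Collect_eq of_nat_le_iff order_trans)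
        with n0 show False by simp
      qed
      have "finite {n. S n \<omega> \<le> t}" for t
      proof (rule finite_subset)
        show "{n. S n \<omega> \<le> t} \<subseteq> ?B \<union> {..nat \<lceil>t / a'\<rceil>}"
        proof safe
          fix n assume "S n \<omega> \<le> t" "\<not> n \<le> nat \<lceil>t / a'\<rceil>"
          then have "t / a' \<le> real n" by linarith
          then show "S n \<omega> \<le> a' * real n" using \<open>S n \<omega> \<le> t\<close> a'(1) by (simp add: field_simps)
        qed
        show "finite (?B \<union> {..nat \<lceil>t / a'\<rceil>})" using finB by simp
      qed
      moreover have "of_nat (card {n. 1 \<le> n \<and> S n \<omega> \<le> 0}) \<le> C \<omega>"
      proof -
        let ?Z = "{n. 1 \<le> n \<and> S n \<omega> \<le> 0}"
        have ZB: "?Z \<subseteq> ?B" using a'(1) by (auto intro: order_trans)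
        then have fin: "finite ?Z" using finB by (rule finite_subset)
        show ?thesis
        proof (cases "?Z = {}")
          case False
          define n where "n = Max ?Z"
          have "n \<in> ?Z" using Max_in[OF fin False] by (simp add: n_def)
          have "?Z \<subseteq> {1..n}" using fin by (auto simp: n_def)
          from card_mono[OF _ this] have "card ?Z \<le> n" by simp
          then have "of_nat (card ?Z) \<le> (of_nat n :: ennreal)" by simp
          also have "\<dots> \<le> C \<omega>" using \<open>n \<in> ?Z\<close> ZB by (intro C_ge) auto
          finally show ?thesis .
        qed (simp only: card.empty, simp)
      qed
      ultimately show ?thesis by blast
    qed
  qed
qed

lemma AE_good: "AE \<omega> in M. good \<omega>"
proof -
  have "lam < lam + 1" by simp
  from renewal_linear_bound[OF this] obtain C where C: "C \<in> borel_measurable (alg arrivals)" "(\<integral>\<^sup>+\<omega>. C \<omega> \<partial>M) < \<top>"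
    "\<And>\<omega>. C \<omega> < \<top> \<Longrightarrow> (\<forall>t. finite {n. S n \<omega> \<le> t})"
    by metis
  have "AE \<omega> in M. C \<omega> \<noteq> \<infinity>"
    using C(1,2) by (intro nn_integral_PInf_AE measurable_algD[OF C(1)]) auto
  then show ?thesis using AE_service_nonneg AE_interarrival_nonneg
    by eventually_elim (use C(3) in \<open>auto simp: good_def less_top\<close>)
qed

lemma good_finite: "good \<omega> \<Longrightarrow> finite {n. 1 \<le> n \<and> 0 < S n \<omega> \<and> S n \<omega> \<le> t}"
  by (rule finite_subset[of _ "{n. S n \<omega> \<le> t}"]) (auto simp: good_def)

lemma N_mono: "good \<omega> \<Longrightarrow> s \<le> t \<Longrightarrow> N s \<omega> \<le> N t \<omega>"
  unfolding N_eq by (intro card_mono good_finite) auto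

lemma N_0 [simp]: "N 0 \<omega> = 0"
proof -
  have "{n. 1 \<le> n \<and> 0 < S n \<omega> \<and> S n \<omega> \<le> 0} = {}" by auto
  then show ?thesis unfolding N_eq by (simp only: card.empty)
qed

lemma W_nonneg: "good \<omega> \<Longrightarrow> 0 \<le> W l n \<omega>"
  unfolding W_def good_def by (intro sum_nonneg) auto

lemma T_mono_Suc: "good \<omega> \<Longrightarrow> T l \<omega> \<le> T (Suc l) \<omega>"
  using W_nonneg by (simp add: T_Suc)

lemma T_mono: "good \<omega> \<Longrightarrow> l \<le> l' \<Longrightarrow> T l \<omega> \<le> T l' \<omega>"
  using lift_Suc_mono_le[of "\<lambda>l. T l \<omega>"] T_mono_Suc by blast

lemma T_nonneg: "good \<omega> \<Longrightarrow> 0 \<le> T l \<omega>"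
  using T_mono[of \<omega> 0 l] by simp

lemma S_mono:
  assumes "good \<omega>" "m \<le> n" shows "S m \<omega> \<le> S n \<omega>"
proof -
  obtain c where n: "n = m + c" using assms(2) le_Suc_ex by blast
  show ?thesis unfolding n S_add using assms(1) by (auto simp: good_def intro!: sum_nonneg)
qed

section \<open>Linear growth of the mean queue length\<close>

text \<open>
  Summing the recursion over the rounds telescopes the arrivals.  The mean of the total queue
  length then follows from the mean of \<open>N\<close> at a single time, and the arrivals during an individual
  round, which depend on the past, need not be examined.
\<close>

lemma sum_X_eq:
  assumes "good \<omega>"
  shows "(\<Sum>j\<le>k. X j \<omega>) = N (T k \<omega>) \<omega> + (\<Sum>j<k. NB (Suc j) (X j \<omega>) \<omega>)"
proof (induction k)
  case (Suc k)
  have "N (T k \<omega>) \<omega> \<le> N (T (Suc k) \<omega>) \<omega>" using assms by (intro N_mono T_mono_Suc)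
  with Suc show ?case by (simp add: X_Suc)
qed simp

lemma nn_integral_W_X:
  "(\<integral>\<^sup>+\<omega>. ennreal (W l (X l \<omega>) \<omega>) \<partial>M) = ennreal b * (1 + (\<integral>\<^sup>+\<omega>. of_nat (X l \<omega>) \<partial>M))"
proof -
  have W: "(\<integral>\<^sup>+\<omega>. ennreal (W l n \<omega>) \<partial>M) = ennreal b * (1 + of_nat n)" for n
  proof -
    have "AE \<omega> in M. ennreal (W l n \<omega>) = (\<Sum>i=0..n. ennreal (\<sigma> (Suc l) i \<omega>))"
      using AE_service_nonneg by eventually_elim (simp add: W_def sum_ennreal)
    then have "(\<integral>\<^sup>+\<omega>. ennreal (W l n \<omega>) \<partial>M) = (\<integral>\<^sup>+\<omega>. (\<Sum>i=0..n. ennreal (\<sigma> (Suc l) i \<omega>)) \<partial>M)"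
      by (rule nn_integral_cong_AE)
    also have "\<dots> = of_nat (Suc n) * ennreal b" by (subst nn_integral_sum) (auto simp: nn_integral_service)
    finally show ?thesis by (simp add: mult.commute)
  qed
  have "(\<integral>\<^sup>+\<omega>. indicator (space M) \<omega> * ennreal (W l (X l \<omega>) \<omega>) \<partial>M)
      = (\<integral>\<^sup>+\<omega>. indicator (space M) \<omega> * (\<integral>\<^sup>+\<omega>'. ennreal (W l (X l \<omega>) \<omega>') \<partial>M) \<partial>M)"
    using measurable_W space_past by (intro nn_integral_past_stage) auto
  then have "(\<integral>\<^sup>+\<omega>. ennreal (W l (X l \<omega>) \<omega>) \<partial>M) = (\<integral>\<^sup>+\<omega>. ennreal b * (1 + of_nat (X l \<omega>)) \<partial>M)"
    unfolding W by (simp cong: nn_integral_cong_simp)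
  also have "\<dots> = ennreal b * (1 + (\<integral>\<^sup>+\<omega>. of_nat (X l \<omega>) \<partial>M))"
    by (simp add: nn_integral_cmult nn_integral_add emeasure_space_1)
  finally show ?thesis .
qed

lemma nn_integral_NB_X:
  "(\<integral>\<^sup>+\<omega>. of_nat (NB (Suc l) (X l \<omega>) \<omega>) \<partial>M) = ennreal p * (\<integral>\<^sup>+\<omega>. of_nat (X l \<omega>) \<partial>M)"
proof -
  have NBm: "NB (Suc l) n \<in> measurable (alg (stage l)) (count_space UNIV)" for n
    by (rule measurable_alg_feedback) (simp add: stage_def)
  have eq: "ennreal (real n * p) = ennreal p * of_nat n" for n
    using p_pos by (simp add: ennreal_mult'' mult.commute ennreal_of_nat_eq_real_of_nat)
  have "(\<integral>\<^sup>+\<omega>. indicator (space M) \<omega> * of_nat (NB (Suc l) (X l \<omega>) \<omega>) \<partial>M)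
      = (\<integral>\<^sup>+\<omega>. indicator (space M) \<omega> * (\<integral>\<^sup>+\<omega>'. of_nat (NB (Suc l) (X l \<omega>) \<omega>') \<partial>M) \<partial>M)"
    using NBm space_past by (intro nn_integral_past_stage) auto
  then have "(\<integral>\<^sup>+\<omega>. of_nat (NB (Suc l) (X l \<omega>) \<omega>) \<partial>M) = (\<integral>\<^sup>+\<omega>. ennreal p * of_nat (X l \<omega>) \<partial>M)"
    unfolding nn_integral_NB eq by (simp cong: nn_integral_cong_simp)
  also have "\<dots> = ennreal p * (\<integral>\<^sup>+\<omega>. of_nat (X l \<omega>) \<partial>M)" by (simp add: nn_integral_cmult)
  finally show ?thesis .
qed

lemma ex_stable_larger_rate:
  obtains lam' where "lam < lam'" "p + lam' * b < 1"
proof -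
  define lam' where "lam' = lam + (1 - r) / (2 * b)"
  have "lam < lam'" using r_less_1 b_pos by (simp add: lam'_def)
  moreover have "p + lam' * b = (1 + r) / 2" using b_pos by (simp add: lam'_def r_eq field_simps)
  ultimately show ?thesis using that r_less_1 by simp
qed

text \<open>
  With \<open>sum_X_eq\<close> the mean total queue length \<open>Y k\<close> satisfies
  \<open>Y (k + 1) \<le> (p + lam' b) * Y k + O(k)\<close>, and \<open>p + lam' b < 1\<close> for \<open>lam'\<close> close to \<open>lam\<close>, by stability.
\<close>

lemma nn_integral_XT_le:
  obtains c where "0 \<le> c" "\<And>k. (\<integral>\<^sup>+\<omega>. of_nat (X k \<omega>) \<partial>M) \<le> ennreal (c * (1 + real k))"
    "\<And>k. (\<integral>\<^sup>+\<omega>. ennreal (T k \<omega>) \<partial>M) \<le> ennreal (c * (1 + real k))"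
proof -
  obtain lam' where lam': "lam < lam'" "p + lam' * b < 1" using ex_stable_larger_rate by blast
  have lam'_pos: "0 < lam'" using lam' lam_pos by simp
  obtain C where C: "C \<in> borel_measurable (alg arrivals)" "(\<integral>\<^sup>+\<omega>. C \<omega> \<partial>M) < \<top>"
    "\<And>\<omega> t. 0 \<le> t \<Longrightarrow> of_nat (N t \<omega>) \<le> ennreal (lam' * t) + C \<omega>"
    using renewal_linear_bound[OF lam'(1)] by metis
  have [measurable]: "C \<in> borel_measurable M" using C(1) by (rule measurable_algD) simp
  obtain ec where ec: "0 \<le> ec" "(\<integral>\<^sup>+\<omega>. C \<omega> \<partial>M) = ennreal ec"
    using C(2) by (cases "\<integral>\<^sup>+\<omega>. C \<omega> \<partial>M") auto
  define Y where "Y k = (\<integral>\<^sup>+\<omega>. (\<Sum>j\<le>k. of_nat (X j \<omega>)) \<partial>M)" for k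
  have Y_sum: "Y k = (\<Sum>j\<le>k. \<integral>\<^sup>+\<omega>. of_nat (X j \<omega>) \<partial>M)" for k
    unfolding Y_def by (intro nn_integral_sum) auto
  have ET: "(\<integral>\<^sup>+\<omega>. ennreal (T (Suc k) \<omega>) \<partial>M) = ennreal b * (of_nat (Suc k) + Y k)" for k
  proof -
    have T_sum: "T k \<omega> = (\<Sum>j<k. W j (X j \<omega>) \<omega>)" for k \<omega>
      by (induction k) (auto simp: T_Suc)
    have "AE \<omega> in M. ennreal (T (Suc k) \<omega>) = (\<Sum>j<Suc k. ennreal (W j (X j \<omega>) \<omega>))"
      using AE_good unfolding T_sum
      by eventually_elim (simp add: sum_ennreal W_nonneg del: sum.lessThan_Suc)
    then have "(\<integral>\<^sup>+\<omega>. ennreal (T (Suc k) \<omega>) \<partial>M) = (\<integral>\<^sup>+\<omega>. (\<Sum>j<Suc k. ennreal (W j (X j \<omega>) \<omega>)) \<partial>M)"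
      by (rule nn_integral_cong_AE)
    also have "\<dots> = (\<Sum>j<Suc k. ennreal b * (1 + (\<integral>\<^sup>+\<omega>. of_nat (X j \<omega>) \<partial>M)))"
      by (subst nn_integral_sum) (auto simp: nn_integral_W_X simp del: sum.lessThan_Suc)
    also have "\<dots> = ennreal b * (of_nat (Suc k) + Y k)"
      unfolding Y_sum lessThan_Suc_atMost by (simp add: sum_distrib_left[symmetric] sum.distrib)
    finally show ?thesis .
  qed
  have Y_step: "Y (Suc k) \<le> ennreal lam' * (ennreal b * (of_nat (Suc k) + Y k)) + ennreal ec + ennreal p * Y k" for k
  proof -
    have "Y (Suc k) \<le> (\<integral>\<^sup>+\<omega>. ennreal lam' * ennreal (T (Suc k) \<omega>) + C \<omega> + (\<Sum>j\<le>k. of_nat (NB (Suc j) (X j \<omega>) \<omega>)) \<partial>M)"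
      unfolding Y_def
    proof (intro nn_integral_mono_AE)
      show "AE \<omega> in M. (\<Sum>j\<le>Suc k. of_nat (X j \<omega>)) \<le> ennreal lam' * ennreal (T (Suc k) \<omega>) + C \<omega> + (\<Sum>j\<le>k. of_nat (NB (Suc j) (X j \<omega>) \<omega>))"
        using AE_good
      proof eventually_elim
        case (elim \<omega>)
        have "(\<Sum>j\<le>Suc k. of_nat (X j \<omega>)) = (of_nat (\<Sum>j\<le>Suc k. X j \<omega>) :: ennreal)" by simp
        also have "\<dots> = of_nat (N (T (Suc k) \<omega>) \<omega>) + (\<Sum>j\<le>k. of_nat (NB (Suc j) (X j \<omega>) \<omega>))"
          unfolding sum_X_eq[OF elim] lessThan_Suc_atMost by simp
        also have "of_nat (N (T (Suc k) \<omega>) \<omega>) \<le> ennreal (lam' * T (Suc k) \<omega>) + C \<omega>"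
          using T_nonneg[OF elim] by (rule C(3))
        also have "ennreal (lam' * T (Suc k) \<omega>) = ennreal lam' * ennreal (T (Suc k) \<omega>)"
          using lam'_pos by (simp add: ennreal_mult')
        finally show ?case by (simp add: add_right_mono)
      qed
    qed
    also have "\<dots> = ennreal lam' * (ennreal b * (of_nat (Suc k) + Y k)) + ennreal ec + ennreal p * Y k"
      by (simp add: nn_integral_add nn_integral_cmult nn_integral_sum nn_integral_NB_X ec ET Y_sum sum_distrib_left del: of_nat_Suc)
    finally show ?thesis .
  qed
  \<comment> \<open>the solution of \<open>c = (p + lam' * b) * c + (lam' * b + ec)\<close>, so that \<open>c * (1 + k)\<close> is preserved by the recursion\<close>
  define c where "c = (lam' * b + ec) / (1 - (p + lam' * b))"
  have c0: "0 \<le> c" using lam'(2) lam'_pos b_pos ec by (simp add: c_def)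
  have c_eq: "lam' * b + ec = c * (1 - (p + lam' * b))" using lam'(2) by (simp add: c_def)
  have Y_le: "Y k \<le> ennreal (c * (1 + real k))" for k
  proof (induction k)
    case 0
    then show ?case by (simp add: Y_def)
  next
    case (Suc k)
    have "Y (Suc k) \<le> ennreal lam' * (ennreal b * (of_nat (Suc k) + Y k)) + ennreal ec + ennreal p * Y k"
      by (rule Y_step)
    also have "\<dots> \<le> ennreal lam' * (ennreal b * (ennreal (real (Suc k)) + ennreal (c * (1 + real k)))) + ennreal ec + ennreal p * ennreal (c * (1 + real k))"
      using Suc by (intro add_mono mult_left_mono) (auto simp flip: ennreal_of_nat_eq_real_of_nat)
    also have "\<dots> = ennreal (lam' * (b * (real (Suc k) + c * (1 + real k))) + ec + p * (c * (1 + real k)))"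
      using lam'_pos b_pos c0 ec(1) p_pos
      by (simp add: ennreal_mult' ennreal_plus_if add_nonneg_nonneg mult_nonneg_nonneg del: of_nat_Suc)
    also have "\<dots> \<le> ennreal (c * (1 + real (Suc k)))"
    proof (intro ennreal_leI)
      have "0 \<le> real k * ec" using ec by simp
      moreover have "(lam' * b + ec) * (1 + real k) = c * (1 - (p + lam' * b)) * (1 + real k)"
        using c_eq by simp
      ultimately show "lam' * (b * (real (Suc k) + c * (1 + real k))) + ec + p * (c * (1 + real k)) \<le> c * (1 + real (Suc k))"
        using c0 by (simp add: algebra_simps)
    qed
    finally show ?case .
  qed
  have X_le: "(\<integral>\<^sup>+\<omega>. of_nat (X k \<omega>) \<partial>M) \<le> ennreal (c * (1 + real k))" for k
  proof -
    have "(\<integral>\<^sup>+\<omega>. of_nat (X k \<omega>) \<partial>M) \<le> Y k"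
      unfolding Y_sum by (rule member_le_sum) auto
    then show ?thesis using Y_le[of k] by (rule order_trans)
  qed
  have T_le: "(\<integral>\<^sup>+\<omega>. ennreal (T k \<omega>) \<partial>M) \<le> ennreal (b * (1 + c) * (1 + real k))" for k
  proof (cases k)
    case (Suc j)
    have "(\<integral>\<^sup>+\<omega>. ennreal (T k \<omega>) \<partial>M) \<le> ennreal b * (ennreal (real (Suc j)) + ennreal (c * (1 + real j)))"
      unfolding Suc ET using Y_le[of j] by (intro mult_left_mono add_mono) (auto simp flip: ennreal_of_nat_eq_real_of_nat)
    also have "\<dots> = ennreal (b * (real (Suc j) + c * (1 + real j)))"
      using b_pos c0
      by (simp add: ennreal_mult' ennreal_plus_if add_nonneg_nonneg mult_nonneg_nonneg del: of_nat_Suc)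
    also have "\<dots> \<le> ennreal (b * (1 + c) * (1 + real k))"
    proof (intro ennreal_leI)
      have "b * (real (Suc j) + c * (1 + real j)) = b * (1 + c) * real k" by (simp add: Suc algebra_simps)
      also have "\<dots> \<le> b * (1 + c) * (1 + real k)" using b_pos c0 by (intro mult_left_mono) auto
      finally show "b * (real (Suc j) + c * (1 + real j)) \<le> b * (1 + c) * (1 + real k)" .
    qed
    finally show ?thesis .
  qed simp
  show ?thesis
  proof (rule that[of "max c (b * (1 + c))"])
    show "0 \<le> max c (b * (1 + c))" using c0 by simp
    show "(\<integral>\<^sup>+\<omega>. of_nat (X k \<omega>) \<partial>M) \<le> ennreal (max c (b * (1 + c)) * (1 + real k))" for k
      by (rule order_trans[OF X_le]) (intro ennreal_leI mult_right_mono, auto)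
    show "(\<integral>\<^sup>+\<omega>. ennreal (T k \<omega>) \<partial>M) \<le> ennreal (max c (b * (1 + c)) * (1 + real k))" for k
      by (rule order_trans[OF T_le]) (intro ennreal_leI mult_right_mono, auto)
  qed
qed

lemma integrable_X [simp]: "integrable M (\<lambda>\<omega>. real (X k \<omega>))"
proof -
  obtain c where c: "\<And>k. (\<integral>\<^sup>+\<omega>. of_nat (X k \<omega>) \<partial>M) \<le> ennreal (c * (1 + real k))"
    using nn_integral_XT_le by metis
  show ?thesis
    using order_le_less_trans[OF c[of k]] by (intro integrableI_bounded) (auto simp: ennreal_of_nat_eq_real_of_nat[symmetric])
qed

lemma expectation_X_le:
  obtains c where "0 \<le> c" "\<And>k. expectation (\<lambda>\<omega>. real (X k \<omega>)) \<le> c * (1 + real k)"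
    "\<And>k u. 0 < u \<Longrightarrow> \<P>(\<omega> in M. u \<le> T k \<omega>) \<le> c * (1 + real k) / u"
proof -
  obtain c where c: "0 \<le> c" "\<And>k. (\<integral>\<^sup>+\<omega>. of_nat (X k \<omega>) \<partial>M) \<le> ennreal (c * (1 + real k))"
    "\<And>k. (\<integral>\<^sup>+\<omega>. ennreal (T k \<omega>) \<partial>M) \<le> ennreal (c * (1 + real k))"
    using nn_integral_XT_le by metis
  show ?thesis
  proof (rule that[OF c(1)])
    fix k
    have "ennreal (expectation (\<lambda>\<omega>. real (X k \<omega>))) = (\<integral>\<^sup>+\<omega>. of_nat (X k \<omega>) \<partial>M)"
      by (subst nn_integral_eq_integral[symmetric]) (auto simp: ennreal_of_nat_eq_real_of_nat)
    also have "\<dots> \<le> ennreal (c * (1 + real k))" by (rule c)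
    finally show "expectation (\<lambda>\<omega>. real (X k \<omega>)) \<le> c * (1 + real k)" using c(1) by simp
    fix u :: real assume u: "0 < u"
    have "emeasure M {\<omega> \<in> space M. u \<le> T k \<omega>} = emeasure M {\<omega> \<in> space M. 1 \<le> ennreal (1/u) * ennreal (T k \<omega>)}"
      using u by (intro arg_cong[where f = "emeasure M"] Collect_cong)
        (auto simp: ennreal_mult'[symmetric] ennreal_le_iff2 simp flip: ennreal_1)
    also have "\<dots> \<le> ennreal (1/u) * (\<integral>\<^sup>+\<omega>. ennreal (T k \<omega>) * indicator (space M) \<omega> \<partial>M)"
      by (intro order_trans[OF nn_integral_Markov_inequality]) auto
    also have "(\<integral>\<^sup>+\<omega>. ennreal (T k \<omega>) * indicator (space M) \<omega> \<partial>M) = (\<integral>\<^sup>+\<omega>. ennreal (T k \<omega>) \<partial>M)"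
      by (intro nn_integral_cong) auto
    also have "ennreal (1/u) * \<dots> \<le> ennreal (1/u) * ennreal (c * (1 + real k))" by (intro mult_left_mono c) auto
    also have "\<dots> = ennreal (c * (1 + real k) / u)" using u by (simp add: ennreal_mult'[symmetric])
    finally show "\<P>(\<omega> in M. u \<le> T k \<omega>) \<le> c * (1 + real k) / u"
      using u c(1) by (simp add: emeasure_eq_measure)
  qed
qed

end

section \<open>Arrivals during one round\<close>

context stable_feedback_queue begin

lemma N_diff_eq:
  assumes "good \<omega>" "0 \<le> s" "s \<le> t"
  shows "N t \<omega> = N s \<omega> + card {n. 1 \<le> n \<and> s < S n \<omega> \<and> S n \<omega> \<le> t}"
proof -
  define A where "A u = {n. 1 \<le> n \<and> 0 < S n \<omega> \<and> S n \<omega> \<le> u}" for u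
  define D where "D = {n. 1 \<le> n \<and> s < S n \<omega> \<and> S n \<omega> \<le> t}"
  have fin: "finite (A u)" for u using good_finite[OF assms(1)] by (simp only: A_def)
  have "A t = A s \<union> D" using assms(2,3) unfolding A_def D_def by (intro set_eqI iffI) auto
  moreover have "A s \<inter> D = {}" unfolding A_def D_def by auto
  moreover have "finite D" using fin[of t] \<open>A t = A s \<union> D\<close> by simp
  ultimately have "card (A t) = card (A s) + card D" using fin[of s] by (simp add: card_Un_disjoint)
  then show ?thesis by (simp only: N_eq A_def D_def)
qed

text \<open>
  If the interval from \<open>s\<close> to \<open>t\<close> contains too many arrivals, then the inter-arrival times following
  the first arrival after \<open>s\<close> form a run that is too short.  For a run starting at a given index this
  is exponentially unlikely.  The starting index is random but, for \<open>s\<close> in a window of length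
  \<open>\<rho> * exp (\<eta> * u)\<close>, it is smaller than \<open>M0\<close> outside a small event; so a union bound over
  exponentially many indices suffices as long as the window grows more slowly than the
  probabilities decay.
\<close>

lemma renewal_increment_le:
  assumes lam': "lam < lam'"
  obtains C \<eta> \<rho> where "0 < C" "0 < \<eta>" "0 < \<rho>"
    "\<And>u. 0 \<le> u \<Longrightarrow> \<exists>V\<in>sets (alg arrivals). prob V \<le> C * exp (- \<eta> * u) \<and>
      (\<forall>\<omega>\<in>space M - V. good \<omega> \<longrightarrow> (\<forall>s t. 0 \<le> s \<longrightarrow> s \<le> t \<longrightarrow> s \<le> \<rho> * exp (\<eta> * u) \<longrightarrow>
        real (N t \<omega>) - real (N s \<omega>) \<le> lam' * (t - s) + 1 + u))"
proof -
  have lam'_pos: "0 < lam'" using lam' lam_pos by simp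
  define a' where "a' = 1 / lam'"
  have a': "0 < a'" "a' < a" using lam' lam_pos lam'_pos a_pos by (auto simp: a'_def lam_eq field_simps)
  obtain \<eta>0 where \<eta>0: "0 < \<eta>0"
    "\<And>m c. \<P>(\<omega> in M. S (m + c) \<omega> - S m \<omega> \<le> a' * real c) \<le> exp (- \<eta>0 * real c)"
    using prob_arrival_run_le[OF a'(2)] by blast
  define B where "B m c = {\<omega> \<in> space M. S (m + c) \<omega> - S m \<omega> \<le> a' * real c}" for m c
  have B_arr: "B m c \<in> sets (alg arrivals)" for m c
  proof -
    note [measurable] = measurable_S
    have "{\<omega> \<in> space (alg arrivals). S (m + c) \<omega> - S m \<omega> \<le> a' * real c} \<in> sets (alg arrivals)" by measurable
    then show ?thesis by (simp add: B_def)
  qed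
  have B_ev [measurable]: "B m c \<in> events" for m c using B_arr sets_alg_events[OF arrivals_sources] by auto
  define \<kappa> where "\<kappa> = 1 / (1 - exp (- \<eta>0))"
  have e1: "0 < 1 - exp (- \<eta>0)" using \<eta>0(1) by simp
  have \<kappa>: "0 < \<kappa>" using e1 by (simp add: \<kappa>_def)
  define \<eta> where "\<eta> = min (\<eta>0 / 2) (\<eta>0 * \<eta>0 / 2)"
  have \<eta>: "0 < \<eta>" "\<eta> \<le> \<eta>0 / 2" "\<eta> \<le> \<eta>0 * \<eta>0 / 2" using \<eta>0(1) by (auto simp: \<eta>_def)
  show ?thesis
  proof (rule that[of "3 * \<kappa> + 1" \<eta> a'])
    fix u :: real assume u: "0 \<le> u"
    define k where "k = nat \<lceil>u\<rceil>"
    have k: "u \<le> real k" unfolding k_def by linarith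
    \<comment> \<open>half of the exponential decay pays for the number of starting indices\<close>
    define E where "E = exp (\<eta>0 * u / 2)"
    define M0 where "M0 = nat \<lceil>E\<rceil>"
    have E1: "1 \<le> E" "1 + \<eta>0 * u / 2 \<le> E" using u \<eta>0(1) exp_ge_add_one_self[of "\<eta>0 * u / 2"] by (auto simp: E_def)
    have M0: "E \<le> real M0" "real M0 + 1 \<le> 3 * E" using E1 unfolding M0_def by linarith+
    \<comment> \<open>\<open>V1\<close>: some run starting at an index up to \<open>M0\<close> is too short; \<open>B 0 M0\<close>: the first \<open>M0\<close> arrivals
      come so early that a run may start beyond \<open>M0\<close>\<close>
    define V1 where "V1 = (\<Union>m\<le>M0. \<Union>i. B m (k + i))"
    define V where "V = V1 \<union> B 0 M0"
    have V1: "V1 \<in> sets (alg arrivals)" unfolding V1_def using B_arr by (intro sets.finite_UN sets.countable_UN) auto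
    have V: "V \<in> sets (alg arrivals)" unfolding V_def using V1 B_arr by auto
    have V1_ev: "V1 \<in> events" using V1 sets_alg_events[OF arrivals_sources] by auto
    have row: "prob (\<Union>i. B m (k + i)) \<le> \<kappa> * exp (- \<eta>0 * u)" for m
    proof -
      have le: "prob (B m (k + i)) \<le> exp (- \<eta>0 * u) * exp (- \<eta>0) ^ i" for i
      proof -
        have "prob (B m (k + i)) \<le> exp (- \<eta>0 * real (k + i))" unfolding B_def by (rule \<eta>0)
        also have "\<dots> \<le> exp (- \<eta>0 * u + real i * (- \<eta>0))"
          using k \<eta>0(1) by (simp add: algebra_simps mult_left_mono)
        finally show ?thesis by (simp only: exp_add exp_of_nat_mult)
      qed
      have sm: "summable (\<lambda>i. exp (- \<eta>0 * u) * exp (- \<eta>0) ^ i)"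
        using \<eta>0(1) by (intro summable_mult summable_geometric) auto
      have sm': "summable (\<lambda>i. prob (B m (k + i)))"
        using le by (intro summable_comparison_test'[OF sm, of 0]) auto
      have "prob (\<Union>i. B m (k + i)) \<le> (\<Sum>i. prob (B m (k + i)))"
        by (intro finite_measure_subadditive_countably sm') auto
      also have "\<dots> \<le> (\<Sum>i. exp (- \<eta>0 * u) * exp (- \<eta>0) ^ i)" by (intro suminf_le le sm sm')
      also have "\<dots> = \<kappa> * exp (- \<eta>0 * u)"
        using \<eta>0(1) by (subst suminf_mult) (auto simp: suminf_geometric \<kappa>_def intro!: summable_geometric)
      finally show ?thesis .
    qed
    have "prob V \<le> (3 * \<kappa> + 1) * exp (- \<eta> * u)"
    proof -
      have "prob V \<le> prob V1 + prob (B 0 M0)" unfolding V_def using V1_ev by (intro measure_Un_le) auto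
      also have "prob V1 \<le> (\<Sum>m\<le>M0. prob (\<Union>i. B m (k + i)))"
        unfolding V1_def by (intro finite_measure_subadditive_finite) auto
      also have "\<dots> \<le> (\<Sum>m\<le>M0. \<kappa> * exp (- \<eta>0 * u))" by (intro sum_mono row)
      also have "\<dots> = (real M0 + 1) * (\<kappa> * exp (- \<eta>0 * u))" by simp
      also have "\<dots> \<le> (3 * E) * (\<kappa> * exp (- \<eta>0 * u))" using M0 \<kappa> by (intro mult_right_mono) auto
      also have "\<dots> = 3 * \<kappa> * exp (- \<eta>0 / 2 * u)"
        by (simp add: E_def exp_add[symmetric] mult_ac field_simps)
      also have "\<dots> \<le> 3 * \<kappa> * exp (- \<eta> * u)"
      proof -
        have "\<eta> * u \<le> \<eta>0 / 2 * u" using \<eta>(2) u by (rule mult_right_mono)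
        then show ?thesis using \<kappa> by simp
      qed
      also have "prob (B 0 M0) \<le> exp (- \<eta> * u)"
      proof -
        have "prob (B 0 M0) \<le> exp (- \<eta>0 * real M0)" unfolding B_def by (rule \<eta>0)
        also have "\<dots> \<le> exp (- \<eta> * u)"
        proof -
          have "\<eta> * u \<le> \<eta>0 * \<eta>0 / 2 * u" using \<eta>(3) u by (rule mult_right_mono)
          also have "\<dots> = \<eta>0 * (\<eta>0 * u / 2)" by simp
          also have "\<dots> \<le> \<eta>0 * real M0" using E1 M0 \<eta>0(1) by (intro mult_left_mono) auto
          finally show ?thesis by simp
        qed
        finally show ?thesis .
      qed
      finally show ?thesis by (simp add: algebra_simps)
    qed
    moreover have "real (N t \<omega>) - real (N s \<omega>) \<le> lam' * (t - s) + 1 + u"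
      if \<omega>: "\<omega> \<in> space M - V" "good \<omega>" and st: "0 \<le> s" "s \<le> t" "s \<le> a' * exp (\<eta> * u)" for \<omega> s t
    proof -
      define D where "D = {n. 1 \<le> n \<and> s < S n \<omega> \<and> S n \<omega> \<le> t}"
      have N_eq': "real (N t \<omega>) - real (N s \<omega>) = real (card D)"
        using N_diff_eq[OF \<omega>(2) st(1,2)] by (simp add: D_def)
      show ?thesis
      proof (cases "real (card D) \<le> 1 + u")
        case True
        moreover have "0 \<le> lam' * (t - s)" using lam'_pos st by simp
        ultimately show ?thesis unfolding N_eq' by linarith
      next
        case False
        then have card: "1 \<le> card D" using u by (cases "card D") auto
        have finD: "finite D" using card card.infinite[of D] by (cases "finite D") auto
        have neD: "D \<noteq> {}" using card by auto
        define m where "m = Min D"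
        define c where "c = card D - 1"
        have m: "m \<in> D" unfolding m_def using finD neD by (rule Min_in)
        then have m1: "1 \<le> m" "s < S m \<omega>" "S m \<omega> \<le> t" by (auto simp: D_def)
        have "D \<subseteq> {m..Max D}" using finD by (auto simp: m_def)
        from card_mono[OF _ this] have "card D \<le> Max D + 1 - m" by simp
        then have "m + c \<le> Max D" using card unfolding c_def by linarith
        then have "S (m + c) \<omega> \<le> S (Max D) \<omega>" using \<omega>(2) by (intro S_mono)
        also have "\<dots> \<le> t" using Max_in[OF finD neD] by (simp add: D_def)
        finally have Sc: "S (m + c) \<omega> \<le> t" .
        have c_real: "real (card D) = real c + 1" using card by (simp add: c_def of_nat_diff)
        have "u < real c" using False c_real by simp
        then have "k \<le> c" unfolding k_def by linarith
        then obtain i where i: "c = k + i" using le_Suc_ex by blast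
        \<comment> \<open>otherwise \<open>S M0 \<le> S (m - 1) \<le> s\<close>, and the first \<open>M0\<close> arrivals are a run that is too short\<close>
        have "m \<le> M0"
        proof (rule ccontr)
          assume "\<not> m \<le> M0"
          then have M0m: "M0 \<le> m - 1" by simp
          have "S (m - 1) \<omega> \<le> s"
          proof (cases "m - 1 = 0")
            case False
            have "m - 1 \<notin> D" using Min_le[OF finD, of "m - 1"] m1(1) unfolding m_def[symmetric] by auto
            moreover have "S (m - 1) \<omega> \<le> t" using S_mono[OF \<omega>(2), of "m - 1" m] m1 by auto
            ultimately show ?thesis using False unfolding D_def by auto
          next
            case True
            then show ?thesis using st(1) by simp
          qed
          moreover have "S M0 \<omega> \<le> S (m - 1) \<omega>" using M0m \<omega>(2) by (intro S_mono)
          moreover have "s \<le> a' * real M0"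
          proof -
            have "\<eta> * u \<le> \<eta>0 / 2 * u" using \<eta>(2) u by (rule mult_right_mono)
            then have "exp (\<eta> * u) \<le> E" by (simp add: E_def)
            then have "exp (\<eta> * u) \<le> real M0" using M0 by linarith
            then have "a' * exp (\<eta> * u) \<le> a' * real M0" using a' by (intro mult_left_mono) auto
            with st(3) show ?thesis by simp
          qed
          ultimately have "\<omega> \<in> B 0 M0" using \<omega>(1) by (auto simp: B_def)
          then show False using \<omega>(1) by (auto simp: V_def)
        qed
        then have "\<omega> \<notin> B m c" using \<omega>(1) i by (auto simp: V_def V1_def)
        then have "a' * real c < S (m + c) \<omega> - S m \<omega>" using \<omega>(1) by (auto simp: B_def)
        also have "\<dots> \<le> t - s" using Sc m1(2) by simp
        finally have "real c < lam' * (t - s)" using lam'_pos by (simp add: a'_def field_simps)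
        then show ?thesis unfolding N_eq' c_real using u by simp
      qed
    qed
    ultimately show "\<exists>V\<in>sets (alg arrivals). prob V \<le> (3 * \<kappa> + 1) * exp (- \<eta> * u) \<and>
      (\<forall>\<omega>\<in>space M - V. good \<omega> \<longrightarrow> (\<forall>s t. 0 \<le> s \<longrightarrow> s \<le> t \<longrightarrow> s \<le> a' * exp (\<eta> * u) \<longrightarrow>
        real (N t \<omega>) - real (N s \<omega>) \<le> lam' * (t - s) + 1 + u))"
      using V by blast
  qed (use \<kappa> \<eta> a' in auto)
qed

text \<open>
  The window of \<open>renewal_increment_le\<close> contains the random time \<open>T l\<close> except with probability
  \<open>O((1 + l) * exp (- \<eta> u))\<close>, by Markov's inequality and the linear growth of the mean of \<open>T l\<close>.
\<close>

lemma arrivals_in_stage_upper_tail: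
  assumes lam': "lam < lam'" and \<xi>: "0 < \<xi>"
  obtains C \<eta> where "1 \<le> C" "0 < \<eta>"
    "\<And>l x. 0 \<le> x \<Longrightarrow> \<P>(\<omega> in M. lam' * W l (X l \<omega>) \<omega> + \<xi> * x < real (N (T (Suc l) \<omega>) \<omega>) - real (N (T l \<omega>) \<omega>))
       \<le> C * (1 + real l) * exp (- \<eta> * x)"
proof -
  obtain C \<eta> \<rho> where C: "0 < C" "0 < \<eta>" "0 < \<rho>"
    "\<And>u. 0 \<le> u \<Longrightarrow> \<exists>V\<in>sets (alg arrivals). prob V \<le> C * exp (- \<eta> * u) \<and>
      (\<forall>\<omega>\<in>space M - V. good \<omega> \<longrightarrow> (\<forall>s t. 0 \<le> s \<longrightarrow> s \<le> t \<longrightarrow> s \<le> \<rho> * exp (\<eta> * u) \<longrightarrow>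
        real (N t \<omega>) - real (N s \<omega>) \<le> lam' * (t - s) + 1 + u))"
    using renewal_increment_le[OF lam'] by metis
  obtain c where c: "0 \<le> c" "\<And>k u. 0 < u \<Longrightarrow> \<P>(\<omega> in M. u \<le> T k \<omega>) \<le> c * (1 + real k) / u"
    using expectation_X_le by metis
  define C' where "C' = (C + c / \<rho> + 1) * exp \<eta>"
  have C'1: "1 \<le> C'"
    using C c one_le_exp_iff[of \<eta>] unfolding C'_def by (intro mult_ge1_I) (auto intro: add_nonneg_nonneg)
  show ?thesis
  proof (rule that[OF C'1])
    show "0 < \<eta> * \<xi>" using C \<xi> by simp
    fix l and x :: real assume x: "0 \<le> x"
    let ?E = "{\<omega> \<in> space M. lam' * W l (X l \<omega>) \<omega> + \<xi> * x < real (N (T (Suc l) \<omega>) \<omega>) - real (N (T l \<omega>) \<omega>)}"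
    have split: "exp \<eta> * exp (- (\<eta> * \<xi>) * x) = exp (- \<eta> * (\<xi> * x - 1))"
      by (simp add: exp_add[symmetric] algebra_simps)
    show "prob ?E \<le> C' * (1 + real l) * exp (- (\<eta> * \<xi>) * x)"
    proof (cases "1 \<le> \<xi> * x")
      case True
      define u where "u = \<xi> * x - 1"
      have u: "0 \<le> u" using True by (simp add: u_def)
      obtain V where V: "V \<in> sets (alg arrivals)" "prob V \<le> C * exp (- \<eta> * u)"
        "\<And>\<omega> s t. \<omega> \<in> space M - V \<Longrightarrow> good \<omega> \<Longrightarrow> 0 \<le> s \<Longrightarrow> s \<le> t \<Longrightarrow> s \<le> \<rho> * exp (\<eta> * u) \<Longrightarrow>
        real (N t \<omega>) - real (N s \<omega>) \<le> lam' * (t - s) + 1 + u"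
        using C(4)[OF u] by metis
      have [measurable]: "V \<in> events" using V(1) sets_alg_events[OF arrivals_sources] by auto
      let ?R = "{\<omega> \<in> space M. \<rho> * exp (\<eta> * u) \<le> T l \<omega>}"
      have "prob ?E \<le> prob (V \<union> ?R)"
      proof (rule finite_measure_mono_AE)
        show "AE \<omega> in M. \<omega> \<in> ?E \<longrightarrow> \<omega> \<in> V \<union> ?R"
          using AE_good
        proof eventually_elim
          case (elim \<omega>)
          show ?case
          proof (intro impI, rule ccontr)
            assume E: "\<omega> \<in> ?E" "\<omega> \<notin> V \<union> ?R"
            then have "real (N (T (Suc l) \<omega>) \<omega>) - real (N (T l \<omega>) \<omega>) \<le> lam' * (T (Suc l) \<omega> - T l \<omega>) + 1 + u"
              using elim by (intro V(3) T_nonneg T_mono_Suc) auto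
            then show False using E by (auto simp: u_def T_Suc)
          qed
        qed
      qed measurable
      also have "\<dots> \<le> prob V + prob ?R" by (intro measure_Un_le) auto
      also have "\<dots> \<le> C * exp (- \<eta> * u) + c * (1 + real l) / (\<rho> * exp (\<eta> * u))"
        using C by (intro add_mono V c) auto
      also have "c * (1 + real l) / (\<rho> * exp (\<eta> * u)) = (c / \<rho>) * (1 + real l) * exp (- \<eta> * u)"
        by (simp add: exp_minus field_simps)
      also have "C * exp (- \<eta> * u) \<le> C * (1 + real l) * exp (- \<eta> * u)"
        using C(1) by (simp add: algebra_simps)
      finally have "prob ?E \<le> (C + c / \<rho>) * ((1 + real l) * exp (- \<eta> * u))" by (simp add: algebra_simps)
      also have "\<dots> \<le> (C + c / \<rho> + 1) * ((1 + real l) * exp (- \<eta> * u))" by (intro mult_right_mono) auto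
      also have "\<dots> = C' * (1 + real l) * exp (- (\<eta> * \<xi>) * x)"
        unfolding u_def split[symmetric] C'_def by (simp only: mult_ac)
      finally show ?thesis .
    next
      case False
      have "prob ?E \<le> 1 * 1 * 1" by simp
      also have "\<dots> \<le> (C + c / \<rho> + 1) * (1 + real l) * exp (- \<eta> * (\<xi> * x - 1))"
        using C c False by (intro mult_mono) (auto intro!: add_nonneg_nonneg mult_nonneg_nonpos)
      also have "\<dots> = C' * (1 + real l) * exp (- (\<eta> * \<xi>) * x)"
        unfolding split[symmetric] C'_def by (simp add: mult_ac)
      finally show ?thesis .
    qed
  qed
qed

text \<open>
  Upward deviations are controlled by \<open>renewal_linear_bound\<close>.  For downward deviations \<open>N\<close> is
  monotone, so it suffices to look at a fixed number \<open>J\<close> of grid points \<open>tg i x\<close>; there, too few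
  arrivals mean that \<open>S n\<close> is too large for a deterministic \<open>n = ng i x\<close>, and the weak law applies.
\<close>

lemma renewal_uniform_weak_lln:
  assumes \<xi>: "0 < \<xi>"
  obtains V where "\<And>x. V x \<in> sets (alg arrivals)" "((\<lambda>x. prob (V x)) \<longlongrightarrow> 0) at_top"
    "\<And>x \<omega> t. 0 < x \<Longrightarrow> \<omega> \<in> space M - V x \<Longrightarrow> good \<omega> \<Longrightarrow> 0 \<le> t \<Longrightarrow> t \<le> x \<Longrightarrow> \<bar>real (N t \<omega>) - lam * t\<bar> \<le> \<xi> * x"
proof -
  have "lam < lam + \<xi> / 2" using \<xi> by simp
  from renewal_linear_bound[OF this] obtain C where C: "C \<in> borel_measurable (alg arrivals)" "(\<integral>\<^sup>+\<omega>. C \<omega> \<partial>M) < \<top>"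
    "\<And>\<omega> t. 0 \<le> t \<Longrightarrow> of_nat (N t \<omega>) \<le> ennreal ((lam + \<xi> / 2) * t) + C \<omega>"
    "\<And>\<omega>. C \<omega> < \<top> \<Longrightarrow> (\<forall>t. finite {n. S n \<omega> \<le> t}) \<and> of_nat (card {n. 1 \<le> n \<and> S n \<omega> \<le> 0}) \<le> C \<omega>"
    by blast
  have CM [measurable]: "C \<in> borel_measurable M" using C(1) by (rule measurable_algD) simp
  obtain ec where ec: "0 \<le> ec" "(\<integral>\<^sup>+\<omega>. C \<omega> \<partial>M) = ennreal ec"
    using C(2) by (cases "\<integral>\<^sup>+\<omega>. C \<omega> \<partial>M") auto
  define J where "J = nat \<lceil>4 * lam / \<xi>\<rceil> + 1"
  have J: "0 < real J" "lam / real J \<le> \<xi> / 4"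
  proof -
    show "0 < real J" by (simp add: J_def)
    moreover have "4 * lam / \<xi> \<le> real J" unfolding J_def by linarith
    ultimately show "lam / real J \<le> \<xi> / 4" using \<xi> by (simp add: field_simps)
  qed
  define V1 where "V1 x = {\<omega> \<in> space M. ennreal (\<xi> / 4 * x) \<le> C \<omega>}" for x
  define tg where "tg i x = real i * x / real J" for i x
  define ng where "ng i x = nat \<lceil>lam * tg i x - \<xi> / 4 * x\<rceil>" for i x
  define V2 where "V2 i x = {\<omega> \<in> space M. tg i x < S (ng i x) \<omega>}" for i x
  define V where "V x = V1 x \<union> (\<Union>i\<le>J. V2 i x)" for x
  have V1_arr: "V1 x \<in> sets (alg arrivals)" for x
  proof -
    have "{\<omega> \<in> space (alg arrivals). ennreal (\<xi> / 4 * x) \<le> C \<omega>} \<in> sets (alg arrivals)" using C(1) by measurable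
    then show ?thesis by (simp add: V1_def)
  qed
  have V2_arr: "V2 i x \<in> sets (alg arrivals)" for i x
  proof -
    note [measurable] = measurable_S
    have "{\<omega> \<in> space (alg arrivals). tg i x < S (ng i x) \<omega>} \<in> sets (alg arrivals)" by measurable
    then show ?thesis by (simp add: V2_def)
  qed
  have V1_ev [measurable]: "V1 x \<in> events" for x using V1_arr sets_alg_events[OF arrivals_sources] by auto
  have V2_ev [measurable]: "V2 i x \<in> events" for i x using V2_arr sets_alg_events[OF arrivals_sources] by auto
  have lim1: "((\<lambda>x. prob (V1 x)) \<longlongrightarrow> 0) at_top"
  proof -
    have le: "\<forall>\<^sub>F x in at_top. prob (V1 x) \<le> ec * 4 / \<xi> / x"
      using eventually_gt_at_top[of 0]
    proof eventually_elim
      case (elim x)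
      have "emeasure M (V1 x) = emeasure M {\<omega> \<in> space M. 1 \<le> ennreal (4 / \<xi> / x) * C \<omega>}"
      proof (intro arg_cong[where f = "emeasure M"], unfold V1_def, intro Collect_cong conj_cong refl)
        fix \<omega>
        have "ennreal (4 / \<xi> / x) * ennreal (\<xi> / 4 * x) = 1" using elim \<xi> by (simp add: ennreal_mult'[symmetric])
        moreover have "ennreal (\<xi> / 4 * x) * ennreal (4 / \<xi> / x) = 1" using elim \<xi> by (simp add: ennreal_mult'[symmetric])
        ultimately show "ennreal (\<xi> / 4 * x) \<le> C \<omega> \<longleftrightarrow> 1 \<le> ennreal (4 / \<xi> / x) * C \<omega>"
          using mult_left_mono[of "ennreal (\<xi> / 4 * x)" "C \<omega>" "ennreal (4 / \<xi> / x)"]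
            mult_left_mono[of 1 "ennreal (4 / \<xi> / x) * C \<omega>" "ennreal (\<xi> / 4 * x)"]
          by (auto simp: mult.assoc[symmetric])
      qed
      also have "\<dots> \<le> ennreal (4 / \<xi> / x) * (\<integral>\<^sup>+\<omega>. C \<omega> * indicator (space M) \<omega> \<partial>M)"
        by (intro order_trans[OF nn_integral_Markov_inequality]) auto
      also have "(\<integral>\<^sup>+\<omega>. C \<omega> * indicator (space M) \<omega> \<partial>M) = ennreal ec"
        unfolding ec(2)[symmetric] by (intro nn_integral_cong) auto
      finally show ?case using elim \<xi> ec(1) by (simp add: emeasure_eq_measure ennreal_mult'[symmetric] mult_ac)
    qed
    have "((\<lambda>x. ec * 4 / \<xi> / x) \<longlongrightarrow> 0) at_top" by real_asymp
    from tendsto_sandwich[OF _ le tendsto_const this] show ?thesis by auto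
  qed
  have lim2: "((\<lambda>x. prob (V2 i x)) \<longlongrightarrow> 0) at_top" if i: "i \<le> J" for i
  proof (rule order_tendstoI)
    fix e :: real assume e: "0 < e"
    let ?D = "distr M borel (\<tau> 1)"
    have "\<forall>\<^sub>F x in at_top. \<forall>(I :: nat set) Y. finite I \<longrightarrow> real (card I) \<le> (lam + 1) * x \<longrightarrow> indep_vars (\<lambda>_. borel) Y I \<longrightarrow>
     (\<forall>i\<in>I. distr M borel (Y i) = ?D) \<longrightarrow>
     \<P>(\<omega> in M. real (card I) * (\<integral>y. y \<partial>?D) + a * \<xi> / 8 * x \<le> (\<Sum>i\<in>I. Y i \<omega>)) \<le> e / 2"
      using e \<xi> a_pos lam_pos by (intro iid_sum_upper_tail_tendsto_0 interarrival_distribution(1-4)) auto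
    then show "\<forall>\<^sub>F x in at_top. prob (V2 i x) < e"
      using eventually_ge_at_top[of "max 1 (8 / \<xi>)"]
    proof eventually_elim
      case (elim x)
      have x: "1 \<le> x" "8 / \<xi> \<le> x" using elim(2) by auto
      show ?case
      proof (cases "ng i x = 0")
        case True
        have "0 \<le> tg i x" using x by (simp add: tg_def)
        then have "V2 i x = {}" using True by (auto simp: V2_def)
        then show ?thesis using e by simp
      next
        case False
        let ?n = "real (ng i x)"
        have n1: "?n \<le> lam * tg i x - \<xi> / 4 * x + 1" using False unfolding ng_def by linarith
        have "real i * x \<le> real J * x" using i x by (intro mult_right_mono) auto
        then have tx: "tg i x \<le> x" using J by (simp add: tg_def field_simps)
        have \<xi>x: "1 \<le> \<xi> / 8 * x" using x \<xi> by (simp add: field_simps)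
        have n2: "?n \<le> lam * tg i x - \<xi> / 8 * x" using n1 \<xi>x by linarith
        have "lam * tg i x \<le> lam * x" using tx lam_pos by simp
        then have n3: "?n \<le> (lam + 1) * x" using n2 \<xi> x \<xi>x by (simp add: algebra_simps)
        have "a * ?n \<le> a * (lam * tg i x - \<xi> / 8 * x)" using n2 a_pos by (intro mult_left_mono) auto
        also have "\<dots> = tg i x - a * \<xi> / 8 * x" using a_pos by (simp add: lam_eq algebra_simps)
        finally have n4: "?n * a + a * \<xi> / 8 * x \<le> tg i x" by (simp add: mult.commute)
        have "prob (V2 i x) \<le> \<P>(\<omega> in M. real (card {1..ng i x}) * (\<integral>y. y \<partial>?D) + a * \<xi> / 8 * x \<le> (\<Sum>i\<in>{1..ng i x}. \<tau> i \<omega>))"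
          unfolding S_def[symmetric] interarrival_distribution(5)
        proof (intro finite_measure_mono subsetI)
          show "{\<omega> \<in> space M. real (card {1..ng i x}) * a + a * \<xi> / 8 * x \<le> S (ng i x) \<omega>} \<in> events" by measurable
        qed (use n4 in \<open>auto simp: V2_def\<close>)
        also have "\<dots> \<le> e / 2"
        proof (rule elim(1)[rule_format])
          show "real (card {1..ng i x}) \<le> (lam + 1) * x" using n3 by simp
          show "indep_vars (\<lambda>_. borel) \<tau> {1..ng i x}" by (intro indep_vars_interarrival) auto
          show "distr M borel (\<tau> j) = ?D" if "j \<in> {1..ng i x}" for j
            using that by (intro interarrival_identically_distributed) auto
        qed simp
        finally show ?thesis using e by simp
      qed
    qed
  next
    fix e :: real assume "e < 0"
    then show "\<forall>\<^sub>F x in at_top. e < prob (V2 i x)" by (auto intro!: always_eventually less_le_trans[of e 0])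
  qed
  show ?thesis
  proof (rule that[of V])
    show "V x \<in> sets (alg arrivals)" for x unfolding V_def using V1_arr V2_arr by auto
    show "((\<lambda>x. prob (V x)) \<longlongrightarrow> 0) at_top"
    proof (rule tendsto_sandwich[OF _ _ tendsto_const])
      show "((\<lambda>x. prob (V1 x) + (\<Sum>i\<le>J. prob (V2 i x))) \<longlongrightarrow> 0) at_top"
        using lim1 lim2 by (intro tendsto_add_zero tendsto_null_sum) auto
      show "\<forall>\<^sub>F x in at_top. prob (V x) \<le> prob (V1 x) + (\<Sum>i\<le>J. prob (V2 i x))"
      proof (intro always_eventually allI)
        fix x
        have "prob (V x) \<le> prob (V1 x) + prob (\<Union>i\<le>J. V2 i x)" unfolding V_def by (intro measure_Un_le) auto
        also have "prob (\<Union>i\<le>J. V2 i x) \<le> (\<Sum>i\<le>J. prob (V2 i x))"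
          by (intro finite_measure_subadditive_finite) auto
        finally show "prob (V x) \<le> prob (V1 x) + (\<Sum>i\<le>J. prob (V2 i x))" by simp
      qed
    qed auto
    fix x t :: real and \<omega> assume x: "0 < x" and \<omega>: "\<omega> \<in> space M - V x" "good \<omega>" and t: "0 \<le> t" "t \<le> x"
    have C\<omega>: "C \<omega> < ennreal (\<xi> / 4 * x)" using \<omega>(1) by (auto simp: V_def V1_def)
    obtain c where c: "0 \<le> c" "C \<omega> = ennreal c" using C\<omega> by (cases "C \<omega>") auto
    have c_le: "c \<le> \<xi> / 4 * x" using C\<omega> c by (simp add: ennreal_less_iff)
    have up: "real (N t \<omega>) \<le> lam * t + \<xi> * x"
    proof -
      have "0 \<le> (lam + \<xi> / 2) * t" using t lam_pos \<xi> by simp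
      then have "ennreal (real (N t \<omega>)) \<le> ennreal ((lam + \<xi> / 2) * t + c)"
        using C(3)[OF t(1), of \<omega>] c by (simp add: ennreal_of_nat_eq_real_of_nat)
      then have "real (N t \<omega>) \<le> (lam + \<xi> / 2) * t + c"
        using \<open>0 \<le> (lam + \<xi> / 2) * t\<close> c(1) by (subst (asm) ennreal_le_iff) auto
      also have "\<dots> = lam * t + \<xi> / 2 * t + c" by (simp add: algebra_simps)
      also have "\<xi> / 2 * t \<le> \<xi> / 2 * x" using t \<xi> by (intro mult_left_mono) auto
      finally have "real (N t \<omega>) \<le> lam * t + \<xi> / 2 * x + c" by simp
      moreover have "\<xi> / 2 * x + \<xi> / 4 * x \<le> \<xi> * x" using \<xi> x by simp
      ultimately show ?thesis using c_le by linarith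
    qed
    have lo: "lam * t - \<xi> * x \<le> real (N t \<omega>)"
    proof -
      define i where "i = nat \<lfloor>t * real J / x\<rfloor>"
      have tJ: "0 \<le> t * real J / x" using t x by simp
      have i: "real i \<le> t * real J / x" "t * real J / x < real i + 1" unfolding i_def using tJ by linarith+
      have "t * real J / x \<le> real J" using t x J by (simp add: field_simps mult_left_mono)
      then have iJ: "i \<le> J" using i by linarith
      have ti: "tg i x \<le> t" "t \<le> tg i x + x / real J"
        using i x J by (simp_all add: tg_def field_simps)
      have "\<omega> \<notin> V2 i x" using \<omega>(1) iJ by (auto simp: V_def)
      then have S_le: "S (ng i x) \<omega> \<le> tg i x" using \<omega>(1) by (auto simp: V2_def)
      define A where "A = {n. 1 \<le> n \<and> 0 < S n \<omega> \<and> S n \<omega> \<le> tg i x}"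
      define Z where "Z = {n. 1 \<le> n \<and> S n \<omega> \<le> 0}"
      have finZ: "finite Z" using \<omega>(2) unfolding good_def Z_def by (auto intro: finite_subset[of _ "{n. S n \<omega> \<le> 0}"])
      have finA: "finite A" using good_finite[OF \<omega>(2)] unfolding A_def .
      have "{1..ng i x} \<subseteq> A \<union> Z"
      proof
        fix n assume n: "n \<in> {1..ng i x}"
        then have "S n \<omega> \<le> S (ng i x) \<omega>" using \<omega>(2) by (intro S_mono) auto
        with S_le n show "n \<in> A \<union> Z" by (auto simp: A_def Z_def)
      qed
      from card_mono[OF _ this] have "ng i x \<le> card (A \<union> Z)" using finA finZ by simp
      also have "\<dots> \<le> card A + card Z" by (rule card_Un_le)
      also have "card A = N (tg i x) \<omega>" by (simp only: N_eq A_def)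
      finally have nN: "real (ng i x) \<le> real (N (tg i x) \<omega>) + real (card Z)" by linarith
      have "ennreal (real (card Z)) \<le> ennreal c"
        using C(4)[of \<omega>] C\<omega> c by (simp add: Z_def ennreal_of_nat_eq_real_of_nat)
      then have Zc: "real (card Z) \<le> c" using c(1) by simp
      have "N (tg i x) \<omega> \<le> N t \<omega>" using \<omega>(2) ti(1) by (rule N_mono)
      moreover have "lam * tg i x - \<xi> / 4 * x \<le> real (ng i x)" unfolding ng_def by linarith
      moreover have "lam * t \<le> lam * tg i x + \<xi> / 4 * x"
      proof -
        have "lam * t \<le> lam * (tg i x + x / real J)" using ti(2) lam_pos by (intro mult_left_mono) auto
        also have "\<dots> = lam * tg i x + lam / real J * x" by (simp add: algebra_simps)
        also have "lam / real J * x \<le> \<xi> / 4 * x" using J x by (intro mult_right_mono) auto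
        finally show ?thesis by simp
      qed
      ultimately have "lam * t - 3 * (\<xi> / 4 * x) \<le> real (N t \<omega>)" using nN Zc c_le by linarith
      moreover have "3 * (\<xi> / 4 * x) \<le> \<xi> * x" using \<xi> x by simp
      ultimately show ?thesis by linarith
    qed
    show "\<bar>real (N t \<omega>) - lam * t\<bar> \<le> \<xi> * x" using up lo by linarith
  qed
qed

end

section \<open>Tail bounds polynomial in the number of rounds\<close>

context stable_feedback_queue begin

lemma measurable_service_stage: "\<sigma> (Suc l) i \<in> borel_measurable (alg (stage l))"
  by (rule measurable_alg_service) (simp add: stage_def)

lemma measurable_NB_stage: "NB (Suc l) n \<in> measurable (alg (stage l)) (count_space UNIV)"
  by (rule measurable_alg_feedback) (simp add: stage_def)

text \<open>
  Hoeffding's inequality for the binomial distribution; restricting \<open>n\<close> to \<open>C * x\<close> turns the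
  Gaussian bound into one that is exponential in \<open>x\<close>.
\<close>

lemma prob_NB_deviation:
  assumes "0 < C" "0 \<le> \<xi>" "real n \<le> C * x"
  shows "\<P>(\<omega> in M. real n * p + \<xi> * x < real (NB (Suc l) n \<omega>)) \<le> exp (- (2 * \<xi>\<^sup>2 / C) * x)"
    and "\<P>(\<omega> in M. real (NB (Suc l) n \<omega>) < real n * p - \<xi> * x) \<le> exp (- (2 * \<xi>\<^sup>2 / C) * x)"
proof -
  interpret B: binomial_distribution n p using p_pos p_less_1 by unfold_locales auto
  have "0 \<le> C * x" using assms(3) of_nat_0_le_iff[of n] by linarith
  then have x: "0 \<le> x" using assms(1) by (simp add: zero_le_mult_iff)
  have \<xi>x: "0 \<le> \<xi> * x" using assms(2) x by simp
  let ?P = "measure (measure_pmf (binomial_pmf n p))"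
  have "\<P>(\<omega> in M. real n * p + \<xi> * x < real (NB (Suc l) n \<omega>)) = ?P {k. real n * p + \<xi> * x < real k}"
    using prob_NB[of l n "{k. real n * p + \<xi> * x < real k}"] by simp
  moreover have "\<P>(\<omega> in M. real (NB (Suc l) n \<omega>) < real n * p - \<xi> * x) = ?P {k. real k < real n * p - \<xi> * x}"
    using prob_NB[of l n "{k. real k < real n * p - \<xi> * x}"] by simp
  moreover have "?P {k. real n * p + \<xi> * x < real k} \<le> exp (- (2 * \<xi>\<^sup>2 / C) * x)
      \<and> ?P {k. real k < real n * p - \<xi> * x} \<le> exp (- (2 * \<xi>\<^sup>2 / C) * x)"
  proof (cases "n = 0")
    case True
    then show ?thesis using p_pos p_less_1 \<xi>x by (simp add: binomial_pmf_0 measure_return_pmf not_less[symmetric])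
  next
    case False
    then have xp: "0 < x" using assms x by (cases "x = 0") auto
    have "?P {k. real n * p + \<xi> * x < real k} \<le> ?P {k. real n * p + \<xi> * x \<le> real k}"
      by (intro measure_pmf.finite_measure_mono) auto
    moreover have "\<dots> \<le> exp (- 2 * (\<xi> * x)\<^sup>2 / real n)" using False \<xi>x by (intro B.prob_ge) auto
    moreover have "?P {k. real k < real n * p - \<xi> * x} \<le> ?P {k. real k \<le> real n * p - \<xi> * x}"
      by (intro measure_pmf.finite_measure_mono) auto
    moreover have "\<dots> \<le> exp (- 2 * (\<xi> * x)\<^sup>2 / real n)" using False \<xi>x by (intro B.prob_le) auto
    moreover have "exp (- 2 * (\<xi> * x)\<^sup>2 / real n) \<le> exp (- (2 * \<xi>\<^sup>2 / C) * x)"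
    proof -
      have "(2 * \<xi>\<^sup>2 / C) * x = 2 * (\<xi> * x)\<^sup>2 / (C * x)" using xp by (simp add: power2_eq_square field_simps)
      also have "\<dots> \<le> 2 * (\<xi> * x)\<^sup>2 / real n" using assms False xp by (intro divide_left_mono) auto
      finally show ?thesis by simp
    qed
    ultimately show ?thesis by linarith
  qed
  ultimately show "\<P>(\<omega> in M. real n * p + \<xi> * x < real (NB (Suc l) n \<omega>)) \<le> exp (- (2 * \<xi>\<^sup>2 / C) * x)"
    and "\<P>(\<omega> in M. real (NB (Suc l) n \<omega>) < real n * p - \<xi> * x) \<le> exp (- (2 * \<xi>\<^sup>2 / C) * x)"
    by simp_all
qed

lemma prob_ex_service_gt:
  "\<P>(\<omega> in M. \<exists>i\<le>n. y < \<sigma> (Suc l) i \<omega>) \<le> (real n + 1) * F y"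
proof -
  have "\<P>(\<omega> in M. \<exists>i\<le>n. y < \<sigma> (Suc l) i \<omega>) = prob (\<Union>i\<le>n. {\<omega> \<in> space M. y < \<sigma> (Suc l) i \<omega>})"
    by (intro arg_cong[where f = prob]) auto
  also have "\<dots> \<le> (\<Sum>i\<le>n. \<P>(\<omega> in M. y < \<sigma> (Suc l) i \<omega>))"
    by (intro finite_measure_subadditive_finite) auto
  also have "\<dots> = (real n + 1) * F y" by (simp add: prob_service_gt)
  finally show ?thesis .
qed

lemma prob_stage_linear_le:
  assumes P: "\<And>n. {\<omega> \<in> space M. P n \<omega>} \<in> sets (alg (stage l))" and c: "0 \<le> c"
    and le: "\<And>n. Q n \<Longrightarrow> \<P>(\<omega> in M. P n \<omega>) \<le> c * (real n + 1)"
  shows "\<P>(\<omega> in M. Q (X l \<omega>) \<and> P (X l \<omega>) \<omega>) \<le> c * (1 + expectation (\<lambda>\<omega>. real (X l \<omega>)))"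
proof -
  have "\<P>(\<omega> in M. Q (X l \<omega>) \<and> P (X l \<omega>) \<omega>) = \<P>(\<omega> in M. \<omega> \<in> space M \<and> Q (X l \<omega>) \<and> P (X l \<omega>) \<omega>)"
    by (intro arg_cong[where f = prob]) auto
  also have "\<dots> \<le> c * (\<integral>\<omega>. indicator (space M) \<omega> * (real (X l \<omega>) + 1) \<partial>M)"
    by (rule prob_stage_le[where w = "\<lambda>n. real n + 1", OF space_past P]) (use c le in auto)
  also have "(\<integral>\<omega>. indicator (space M) \<omega> * (real (X l \<omega>) + 1) \<partial>M) = (\<integral>\<omega>. real (X l \<omega>) + 1 \<partial>M)"
    by (intro Bochner_Integration.integral_cong) auto
  also have "\<dots> = 1 + expectation (\<lambda>\<omega>. real (X l \<omega>))" by (simp add: prob_space)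
  finally show ?thesis .
qed

lemma prob_truncated_services:
  assumes "0 < C" "0 < \<xi>"
  obtains \<epsilon> A where "0 < \<epsilon>" "1 \<le> A"
    "\<forall>\<^sub>F x in at_top. \<forall>l n. real n + 1 \<le> C * x \<longrightarrow>
      \<P>(\<omega> in M. (real n + 1) * b + \<xi> * x \<le> (\<Sum>i=0..n. min (\<sigma> (Suc l) i \<omega>) (\<epsilon> * x)))
        \<le> A * ((real n + 1) * F (\<epsilon> * x))\<^sup>2"
proof -
  obtain \<epsilon> A where A: "0 < \<epsilon>" "1 \<le> A"
    "\<forall>\<^sub>F x in at_top. \<forall>(I :: nat set) Y. finite I \<longrightarrow> I \<noteq> {} \<longrightarrow> real (card I) \<le> C * x \<longrightarrow>
       indep_vars (\<lambda>_. borel) Y I \<longrightarrow> (\<forall>i\<in>I. distr M borel (Y i) = G) \<longrightarrow>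
       \<P>(\<omega> in M. real (card I) * b + \<xi> * x \<le> (\<Sum>i\<in>I. min (Y i \<omega>) (\<epsilon> * x)))
         \<le> A * (real (card I) * tail G (\<epsilon> * x))\<^sup>2"
    by (rule G.truncated_sum_upper_tail[OF prob_space_axioms assms, where 'i = nat]) blast
  from A(3) have "\<forall>\<^sub>F x in at_top. \<forall>l n. real n + 1 \<le> C * x \<longrightarrow>
      \<P>(\<omega> in M. (real n + 1) * b + \<xi> * x \<le> (\<Sum>i=0..n. min (\<sigma> (Suc l) i \<omega>) (\<epsilon> * x)))
        \<le> A * ((real n + 1) * F (\<epsilon> * x))\<^sup>2"
  proof eventually_elim
    case (elim x)
    show ?case
    proof (intro allI impI)
      fix l n assume n: "real n + 1 \<le> C * x"
      have c: "real (card {0..n}) = real n + 1" by simp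
      show "\<P>(\<omega> in M. (real n + 1) * b + \<xi> * x \<le> (\<Sum>i=0..n. min (\<sigma> (Suc l) i \<omega>) (\<epsilon> * x)))
        \<le> A * ((real n + 1) * F (\<epsilon> * x))\<^sup>2"
      proof (rule elim[rule_format, of "{0..n}" "\<sigma> (Suc l)", unfolded c])
        show "real n + 1 \<le> C * x" by (rule n)
        show "indep_vars (\<lambda>_. borel) (\<sigma> (Suc l)) {0..n}" by (rule indep_vars_service)
        show "distr M borel (\<sigma> (Suc l) i) = G" for i by (rule service_distribution) simp
      qed simp_all
    qed
  qed
  with A(1,2) that show ?thesis by blast
qed

lemma tail_scale_mult_tendsto_0:
  assumes "0 < \<epsilon>" shows "((\<lambda>x. x * F (\<epsilon> * x)) \<longlongrightarrow> 0) at_top"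
proof -
  have "filterlim (\<lambda>x. x * \<epsilon>) at_top at_top"
    using assms by (intro filterlim_at_top_mult_tendsto_pos[OF tendsto_const _ filterlim_ident]) auto
  from filterlim_compose[OF G.mult_tail_tendsto_0 this]
  have "((\<lambda>x. (1/\<epsilon>) * ((x * \<epsilon>) * F (x * \<epsilon>))) \<longlongrightarrow> (1/\<epsilon>) * 0) at_top" by (rule tendsto_mult_left)
  then show ?thesis using assms by (simp add: mult_ac)
qed

text \<open>
  The restriction \<open>n \<le> c * x\<close> with \<open>c * b < \<kappa>\<close> keeps the mean of the work below \<open>\<kappa> * x\<close>.  To
  exceed \<open>\<kappa> * x\<close> there must be one service longer than \<open>\<epsilon> * x\<close> or a large deviation of the truncated
  sum, and both cost at most a constant times \<open>(n + 1) * F x\<close>.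
\<close>

lemma prob_W_gt_le:
  assumes c: "0 < c" "c * b < \<kappa>"
  obtains C where "1 \<le> C"
    "\<And>l n x. 0 \<le> x \<Longrightarrow> real n \<le> c * x \<Longrightarrow> \<P>(\<omega> in M. \<kappa> * x < W l n \<omega>) \<le> C * ((real n + 1) * F x)"
proof -
  define \<xi> where "\<xi> = (\<kappa> - c * b) / 2"
  have \<xi>: "0 < \<xi>" using c by (simp add: \<xi>_def)
  have c1: "0 < c + 1" using c by simp
  obtain \<epsilon> A where \<epsilon>: "0 < \<epsilon>" and A: "1 \<le> A" "\<forall>\<^sub>F x in at_top. \<forall>l n. real n + 1 \<le> (c + 1) * x \<longrightarrow>
      \<P>(\<omega> in M. (real n + 1) * b + \<xi> * x \<le> (\<Sum>i=0..n. min (\<sigma> (Suc l) i \<omega>) (\<epsilon> * x)))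
        \<le> A * ((real n + 1) * F (\<epsilon> * x))\<^sup>2"
    using prob_truncated_services[OF c1 \<xi>] by blast
  obtain C\<epsilon> where C\<epsilon>: "1 \<le> C\<epsilon>" "\<And>x. 0 \<le> x \<Longrightarrow> F (\<epsilon> * x) \<le> C\<epsilon> * F x" using G.tail_scale_le[OF \<epsilon>] by blast
  have "((\<lambda>x. (c + 1) * (x * F (\<epsilon> * x))) \<longlongrightarrow> (c + 1) * 0) at_top"
    by (intro tendsto_mult_left tail_scale_mult_tendsto_0 \<epsilon>)
  then have "\<forall>\<^sub>F x in at_top. (c + 1) * (x * F (\<epsilon> * x)) < 1" by (intro order_tendstoD(2)) auto
  with A(2) have "\<forall>\<^sub>F x in at_top. \<forall>l n. real n \<le> c * x \<longrightarrow>
      \<P>(\<omega> in M. \<kappa> * x < W l n \<omega>) \<le> (1 + A) * C\<epsilon> * ((real n + 1) * F x)"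
    using eventually_ge_at_top[of "max 1 (b / \<xi>)"]
  proof eventually_elim
    case (elim x)
    have x: "1 \<le> x" "b \<le> \<xi> * x" using elim(3) \<xi> by (auto simp: field_simps)
    show ?case
    proof (intro allI impI)
      fix l n assume n: "real n \<le> c * x"
      let ?n = "real n + 1"
      have n': "?n \<le> (c + 1) * x" using n x by (simp add: algebra_simps)
      let ?A = "{\<omega> \<in> space M. \<exists>i\<le>n. \<epsilon> * x < \<sigma> (Suc l) i \<omega>}"
      let ?B = "{\<omega> \<in> space M. ?n * b + \<xi> * x \<le> (\<Sum>i=0..n. min (\<sigma> (Suc l) i \<omega>) (\<epsilon> * x))}"
      have "{\<omega> \<in> space M. \<kappa> * x < W l n \<omega>} \<subseteq> ?A \<union> ?B"
      proof (safe, rule ccontr)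
        fix \<omega> assume \<omega>: "\<omega> \<in> space M" "\<kappa> * x < W l n \<omega>"
          "\<not> ?n * b + \<xi> * x \<le> (\<Sum>i=0..n. min (\<sigma> (Suc l) i \<omega>) (\<epsilon> * x))"
          "\<not> (\<exists>i\<le>n. \<epsilon> * x < \<sigma> (Suc l) i \<omega>)"
        have "W l n \<omega> = (\<Sum>i=0..n. min (\<sigma> (Suc l) i \<omega>) (\<epsilon> * x))"
          unfolding W_def using \<omega>(4) by (intro sum.cong) (auto simp: not_less)
        moreover have "?n * b + \<xi> * x \<le> \<kappa> * x"
        proof -
          have "real n * b \<le> c * x * b" using n b_pos by (intro mult_right_mono) auto
          then have "?n * b + \<xi> * x \<le> c * b * x + \<xi> * x + \<xi> * x" using x by (simp add: algebra_simps)
          also have "\<dots> = \<kappa> * x" by (simp add: \<xi>_def field_simps)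
          finally show ?thesis .
        qed
        ultimately show False using \<omega> by simp
      qed
      then have "\<P>(\<omega> in M. \<kappa> * x < W l n \<omega>) \<le> prob (?A \<union> ?B)" by (intro finite_measure_mono) auto
      also have "\<dots> \<le> prob ?A + prob ?B" by (intro measure_Un_le) auto
      also have "\<dots> \<le> ?n * F (\<epsilon> * x) + A * (?n * F (\<epsilon> * x))\<^sup>2"
        using elim(1) n' by (intro add_mono prob_ex_service_gt) auto
      also have "A * (?n * F (\<epsilon> * x))\<^sup>2 \<le> A * (?n * F (\<epsilon> * x))"
      proof -
        have nn: "0 \<le> ?n * F (\<epsilon> * x)" using G.tail_nonneg by simp
        have "?n * F (\<epsilon> * x) \<le> (c + 1) * x * F (\<epsilon> * x)" using n' G.tail_nonneg by (intro mult_right_mono) auto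
        then have "?n * F (\<epsilon> * x) \<le> 1" using elim(2) by simp
        then have "(?n * F (\<epsilon> * x)) * (?n * F (\<epsilon> * x)) \<le> 1 * (?n * F (\<epsilon> * x))" using nn by (rule mult_right_mono)
        then show ?thesis using A(1) by (simp add: power2_eq_square)
      qed
      also have "?n * F (\<epsilon> * x) + A * (?n * F (\<epsilon> * x)) = (1 + A) * (?n * F (\<epsilon> * x))" by (simp add: algebra_simps)
      also have "\<dots> \<le> (1 + A) * (?n * (C\<epsilon> * F x))"
        using A(1) x by (intro mult_left_mono C\<epsilon>) auto
      finally show "\<P>(\<omega> in M. \<kappa> * x < W l n \<omega>) \<le> (1 + A) * C\<epsilon> * (?n * F x)" by (simp add: mult_ac)
    qed
  qed
  then obtain x0 where x0: "\<And>x l n. x0 \<le> x \<Longrightarrow> real n \<le> c * x \<Longrightarrow>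
      \<P>(\<omega> in M. \<kappa> * x < W l n \<omega>) \<le> (1 + A) * C\<epsilon> * ((real n + 1) * F x)"
    by (auto simp: eventually_at_top_linorder)
  define C where "C = max ((1 + A) * C\<epsilon>) (1 / F x0)"
  have C1: "1 \<le> C" using A(1) C\<epsilon>(1) unfolding C_def by (intro max.coboundedI1 mult_ge1_I) auto
  have "\<P>(\<omega> in M. \<kappa> * x < W l n \<omega>) \<le> C * ((real n + 1) * F x)" if "0 \<le> x" "real n \<le> c * x" for l n x
  proof (cases "x0 \<le> x")
    case True
    have "\<P>(\<omega> in M. \<kappa> * x < W l n \<omega>) \<le> (1 + A) * C\<epsilon> * ((real n + 1) * F x)" using True that(2) by (rule x0)
    also have "\<dots> \<le> C * ((real n + 1) * F x)"
      using G.tail_nonneg by (intro mult_right_mono) (auto simp: C_def)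
    finally show ?thesis .
  next
    case False
    have "\<P>(\<omega> in M. \<kappa> * x < W l n \<omega>) \<le> 1 / F x0 * (1 * F x0)" using G.tail_pos[of x0] by simp
    also have "\<dots> \<le> C * ((real n + 1) * F x)"
      using False C1 G.tail_pos[of x0] by (intro mult_mono G.tail_antimono G.tail_nonneg) (auto simp: C_def G.tail_nonneg)
    finally show ?thesis .
  qed
  with C1 that show ?thesis by blast
qed

lemma prob_W_X_le:
  assumes c: "0 < c" "c * b < \<kappa>"
  obtains C where "1 \<le> C"
    "\<And>l x. 0 \<le> x \<Longrightarrow> \<P>(\<omega> in M. real (X l \<omega>) \<le> c * x \<and> \<kappa> * x < W l (X l \<omega>) \<omega>) \<le> C * (1 + real l) * F x"
proof -
  obtain C where C: "1 \<le> C"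
    "\<And>l n x. 0 \<le> x \<Longrightarrow> real n \<le> c * x \<Longrightarrow> \<P>(\<omega> in M. \<kappa> * x < W l n \<omega>) \<le> C * ((real n + 1) * F x)"
    using prob_W_gt_le[OF c] by blast
  obtain cE where cE: "0 \<le> cE" "\<And>k. expectation (\<lambda>\<omega>. real (X k \<omega>)) \<le> cE * (1 + real k)"
    using expectation_X_le by metis
  have "\<P>(\<omega> in M. real (X l \<omega>) \<le> c * x \<and> \<kappa> * x < W l (X l \<omega>) \<omega>) \<le> C * (1 + cE) * (1 + real l) * F x"
    if x: "0 \<le> x" for l x
  proof -
    have B: "{\<omega> \<in> space M. \<kappa> * x < W l n \<omega>} \<in> sets (alg (stage l))" for n
    proof -
      note [measurable] = measurable_W
      have "{\<omega> \<in> space (alg (stage l)). \<kappa> * x < W l n \<omega>} \<in> sets (alg (stage l))" by measurable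
      then show ?thesis by simp
    qed
    have "\<P>(\<omega> in M. real (X l \<omega>) \<le> c * x \<and> \<kappa> * x < W l (X l \<omega>) \<omega>)
        \<le> (C * F x) * (1 + expectation (\<lambda>\<omega>. real (X l \<omega>)))"
    proof (rule prob_stage_linear_le[OF B])
      show "\<P>(\<omega> in M. \<kappa> * x < W l n \<omega>) \<le> C * F x * (real n + 1)" if "real n \<le> c * x" for n
        using C(2)[OF x that, of l] by (simp add: mult_ac)
    qed (use C G.tail_nonneg in auto)
    also have "\<dots> \<le> (C * F x) * ((1 + cE) * (1 + real l))"
    proof (intro mult_left_mono)
      have "1 + expectation (\<lambda>\<omega>. real (X l \<omega>)) \<le> 1 + cE * (1 + real l)" using cE by simp
      also have "\<dots> \<le> (1 + cE) * (1 + real l)" by (simp add: algebra_simps)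
      finally show "1 + expectation (\<lambda>\<omega>. real (X l \<omega>)) \<le> (1 + cE) * (1 + real l)" .
    qed (use C G.tail_nonneg in auto)
    finally show ?thesis by (simp add: mult_ac)
  qed
  moreover have "1 \<le> C * (1 + cE)" using C cE by (intro mult_ge1_I) auto
  ultimately show ?thesis using that by blast
qed

lemma prob_NB_X_upper:
  assumes "0 < C" "0 \<le> \<xi>"
  shows "\<P>(\<omega> in M. real (X l \<omega>) \<le> C * x \<and> real (X l \<omega>) * p + \<xi> * x < real (NB (Suc l) (X l \<omega>) \<omega>))
     \<le> exp (- (2 * \<xi>\<^sup>2 / C) * x)"
proof -
  have B: "{\<omega> \<in> space M. real n * p + \<xi> * x < real (NB (Suc l) n \<omega>)} \<in> sets (alg (stage l))" for n
  proof -
    note [measurable] = measurable_NB_stage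
    have "{\<omega> \<in> space (alg (stage l)). real n * p + \<xi> * x < real (NB (Suc l) n \<omega>)} \<in> sets (alg (stage l))" by measurable
    then show ?thesis by simp
  qed
  have "\<P>(\<omega> in M. \<omega> \<in> space M \<and> real (X l \<omega>) \<le> C * x \<and> real (X l \<omega>) * p + \<xi> * x < real (NB (Suc l) (X l \<omega>) \<omega>))
      \<le> exp (- (2 * \<xi>\<^sup>2 / C) * x) * prob (space M)"
    by (rule prob_stage_const_le[OF space_past B]) (use prob_NB_deviation(1)[OF assms] in auto)
  then show ?thesis by (simp add: prob_space cong: conj_cong)
qed

text \<open>
  If the queue is at most \<open>x\<close> before a round and the arrivals and the feedback are typical, it can
  exceed \<open>x\<close> afterwards only if the work of the round exceeds \<open>\<kappa> * x\<close>, where \<open>\<kappa> > b\<close> by stability.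
  Each round therefore adds a multiple of \<open>E (1 + X k) * F x\<close> to the bound instead of multiplying
  it, and with the linear growth of the means the constants grow only quadratically.
\<close>

lemma prob_X_gt_le:
  obtains C where "1 \<le> C" "\<And>k x. 0 \<le> x \<Longrightarrow> \<P>(\<omega> in M. x < real (X k \<omega>)) \<le> C * (1 + real k)\<^sup>2 * F x"
proof -
  obtain lam' where lam': "lam < lam'" "p + lam' * b < 1" using ex_stable_larger_rate by blast
  have lam'_pos: "0 < lam'" using lam' lam_pos by simp
  define \<xi> where "\<xi> = (1 - p - lam' * b) / 4"
  define \<kappa> where "\<kappa> = (1 - p - 2 * \<xi>) / lam'"
  have \<xi>: "0 < \<xi>" using lam'(2) by (simp add: \<xi>_def)
  have \<kappa>: "1 * b < \<kappa>" using lam'(2) lam'_pos by (simp add: \<kappa>_def \<xi>_def field_simps)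
  obtain C1 where C1: "1 \<le> C1"
    "\<And>l x. 0 \<le> x \<Longrightarrow> \<P>(\<omega> in M. real (X l \<omega>) \<le> 1 * x \<and> \<kappa> * x < W l (X l \<omega>) \<omega>) \<le> C1 * (1 + real l) * F x"
    using prob_W_X_le[OF zero_less_one \<kappa>] by blast
  obtain C2 \<eta> where C2: "1 \<le> C2" "0 < \<eta>"
    "\<And>l x. 0 \<le> x \<Longrightarrow> \<P>(\<omega> in M. lam' * W l (X l \<omega>) \<omega> + \<xi> * x < real (N (T (Suc l) \<omega>) \<omega>) - real (N (T l \<omega>) \<omega>))
       \<le> C2 * (1 + real l) * exp (- \<eta> * x)"
    using arrivals_in_stage_upper_tail[OF lam'(1) \<xi>] by blast
  obtain C3 where C3: "1 \<le> C3" "\<And>x. 0 \<le> x \<Longrightarrow> exp (- \<eta> * x) \<le> C3 * F x" using G.exp_le_tail[OF C2(2)] by blast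
  have "0 < 2 * \<xi>\<^sup>2 / 1" using \<xi> by simp
  from G.exp_le_tail[OF this] obtain C4 where C4: "1 \<le> C4" "\<And>x. 0 \<le> x \<Longrightarrow> exp (- (2 * \<xi>\<^sup>2 / 1) * x) \<le> C4 * F x" by blast
  define C where "C = C1 + C2 * C3 + C4"
  have C2C3: "1 \<le> C2 * C3" using C2(1) C3(1) by (intro mult_ge1_I)
  have C: "1 \<le> C" using C1(1) C2C3 C4(1) by (simp add: C_def)
  have "\<P>(\<omega> in M. x < real (X k \<omega>)) \<le> C * (1 + real k)\<^sup>2 * F x" if x: "0 \<le> x" for k x
  proof (induction k)
    case 0
    then show ?case using x C G.tail_nonneg by (simp add: not_less)
  next
    case (Suc k)
    let ?E0 = "{\<omega> \<in> space M. x < real (X k \<omega>)}"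
    let ?E1 = "{\<omega> \<in> space M. real (X k \<omega>) \<le> 1 * x \<and> \<kappa> * x < W k (X k \<omega>) \<omega>}"
    let ?E2 = "{\<omega> \<in> space M. lam' * W k (X k \<omega>) \<omega> + \<xi> * x < real (N (T (Suc k) \<omega>) \<omega>) - real (N (T k \<omega>) \<omega>)}"
    let ?E3 = "{\<omega> \<in> space M. real (X k \<omega>) \<le> 1 * x \<and> real (X k \<omega>) * p + \<xi> * x < real (NB (Suc k) (X k \<omega>) \<omega>)}"
    have "\<P>(\<omega> in M. x < real (X (Suc k) \<omega>)) \<le> prob (?E0 \<union> (?E1 \<union> (?E2 \<union> ?E3)))"
    proof (rule finite_measure_mono_AE)
      show "AE \<omega> in M. \<omega> \<in> {\<omega> \<in> space M. x < real (X (Suc k) \<omega>)} \<longrightarrow> \<omega> \<in> ?E0 \<union> (?E1 \<union> (?E2 \<union> ?E3))"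
        using AE_good
      proof eventually_elim
        case (elim \<omega>)
        show ?case
        proof (intro impI, rule ccontr)
          assume \<omega>: "\<omega> \<in> {\<omega> \<in> space M. x < real (X (Suc k) \<omega>)}" "\<omega> \<notin> ?E0 \<union> (?E1 \<union> (?E2 \<union> ?E3))"
          then have Xk: "real (X k \<omega>) \<le> x" by auto
          then have W: "W k (X k \<omega>) \<omega> \<le> \<kappa> * x"
            and NN: "real (N (T (Suc k) \<omega>) \<omega>) - real (N (T k \<omega>) \<omega>) \<le> lam' * W k (X k \<omega>) \<omega> + \<xi> * x"
            and NBk: "real (NB (Suc k) (X k \<omega>) \<omega>) \<le> real (X k \<omega>) * p + \<xi> * x"
            using \<omega> by (auto simp: not_less)
          have "N (T k \<omega>) \<omega> \<le> N (T (Suc k) \<omega>) \<omega>" using elim by (intro N_mono T_mono_Suc)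
          then have "real (X (Suc k) \<omega>) = real (N (T (Suc k) \<omega>) \<omega>) - real (N (T k \<omega>) \<omega>) + real (NB (Suc k) (X k \<omega>) \<omega>)"
            by (simp add: X_Suc of_nat_diff)
          also have "\<dots> \<le> lam' * (\<kappa> * x) + \<xi> * x + (x * p + \<xi> * x)"
            using NN NBk mult_left_mono[OF W, of lam'] mult_right_mono[OF Xk, of p] lam'_pos p_pos by linarith
          also have "\<dots> = (lam' * \<kappa>) * x + 2 * \<xi> * x + p * x" by (simp add: algebra_simps)
          also have "lam' * \<kappa> = 1 - p - 2 * \<xi>" using lam'_pos by (simp add: \<kappa>_def)
          also have "(1 - p - 2 * \<xi>) * x + 2 * \<xi> * x + p * x = x" by (simp add: algebra_simps)
          finally show False using \<omega>(1) by simp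
        qed
      qed
    qed measurable
    also have "\<dots> \<le> prob ?E0 + prob (?E1 \<union> (?E2 \<union> ?E3))" by (intro measure_Un_le) measurable
    also have "prob (?E1 \<union> (?E2 \<union> ?E3)) \<le> prob ?E1 + prob (?E2 \<union> ?E3)" by (intro measure_Un_le) measurable
    also have "prob (?E2 \<union> ?E3) \<le> prob ?E2 + prob ?E3" by (intro measure_Un_le) measurable
    also have "prob ?E1 \<le> C1 * (1 + real k) * F x" by (rule C1(2)[OF x])
    also have "prob ?E2 \<le> C2 * (1 + real k) * exp (- \<eta> * x)" by (rule C2(3)[OF x])
    also have "\<dots> \<le> C2 * (1 + real k) * (C3 * F x)" using C2(1) by (intro mult_left_mono C3(2) x) auto
    also have "prob ?E3 \<le> exp (- (2 * \<xi>\<^sup>2 / 1) * x)" using \<xi> by (intro prob_NB_X_upper) auto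
    also have "\<dots> \<le> C4 * F x" by (rule C4(2)[OF x])
    also have "C4 * F x \<le> C4 * (1 + real k) * F x" using C4(1) G.tail_nonneg by (simp add: algebra_simps)
    finally have "\<P>(\<omega> in M. x < real (X (Suc k) \<omega>)) \<le> prob ?E0 + C * (1 + real k) * F x"
      by (simp add: C_def algebra_simps)
    also have "\<dots> \<le> C * (1 + real k)\<^sup>2 * F x + C * (1 + real k) * F x" using Suc by simp
    also have "\<dots> = C * ((1 + real k)\<^sup>2 + (1 + real k)) * F x" by (simp add: algebra_simps)
    also have "\<dots> \<le> C * (1 + real (Suc k))\<^sup>2 * F x"
      using C G.tail_nonneg by (intro mult_right_mono mult_left_mono) (auto simp: power2_eq_square algebra_simps)
    finally show ?case .
  qed
  with C that show ?thesis by blast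
qed

text \<open>
  If \<open>T k > x\<close>, then one of the \<open>k\<close> rounds is longer than \<open>x / k\<close>; \<open>tail_divide_le\<close> makes the cost
  of dividing by \<open>k\<close> polynomial.
\<close>

lemma prob_T_gt_le:
  obtains C d where "1 \<le> C" "\<And>k x. 0 \<le> x \<Longrightarrow> \<P>(\<omega> in M. x < T k \<omega>) \<le> C * (1 + real k) ^ d * F x"
proof -
  define c where "c = 1 / (2 * b)"
  have c: "0 < c" "c * b < 1" using b_pos by (auto simp: c_def)
  obtain C1 where C1: "1 \<le> C1"
    "\<And>l x. 0 \<le> x \<Longrightarrow> \<P>(\<omega> in M. real (X l \<omega>) \<le> c * x \<and> 1 * x < W l (X l \<omega>) \<omega>) \<le> C1 * (1 + real l) * F x"
    using prob_W_X_le[OF c] by blast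
  obtain C2 where C2: "1 \<le> C2" "\<And>k x. 0 \<le> x \<Longrightarrow> \<P>(\<omega> in M. x < real (X k \<omega>)) \<le> C2 * (1 + real k)\<^sup>2 * F x"
    using prob_X_gt_le by blast
  obtain C3 where C3: "1 \<le> C3" "\<And>x. 0 \<le> x \<Longrightarrow> F (c * x) \<le> C3 * F x" using G.tail_scale_le[OF c(1)] by blast
  obtain C4 d where C4: "1 \<le> C4" "\<And>x k. 0 \<le> x \<Longrightarrow> 1 \<le> k \<Longrightarrow> F (x / real k) \<le> C4 * real k ^ d * F x"
    using G.tail_divide_le by metis
  have C23: "1 \<le> C2 * C3" using C2 C3 by (intro mult_ge1_I)
  define C5 where "C5 = C1 + C2 * C3"
  have C5: "1 \<le> C5" using C1 C23 by (simp add: C5_def)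
  have W_le: "\<P>(\<omega> in M. y < W l (X l \<omega>) \<omega>) \<le> C5 * (1 + real l)\<^sup>2 * F y" if y: "0 \<le> y" for y l
  proof -
    let ?A = "{\<omega> \<in> space M. real (X l \<omega>) \<le> c * y \<and> 1 * y < W l (X l \<omega>) \<omega>}"
    let ?B = "{\<omega> \<in> space M. c * y < real (X l \<omega>)}"
    have "\<P>(\<omega> in M. y < W l (X l \<omega>) \<omega>) \<le> prob (?A \<union> ?B)" by (intro finite_measure_mono) auto
    also have "\<dots> \<le> prob ?A + prob ?B" by (intro measure_Un_le) auto
    also have "\<dots> \<le> C1 * (1 + real l) * F y + C2 * (1 + real l)\<^sup>2 * F (c * y)"
      using y c by (intro add_mono C1(2) C2(2)) auto
    also have "C2 * (1 + real l)\<^sup>2 * F (c * y) \<le> C2 * (1 + real l)\<^sup>2 * (C3 * F y)"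
      using C2(1) y by (intro mult_left_mono C3(2)) auto
    also have "C1 * (1 + real l) * F y \<le> C1 * (1 + real l)\<^sup>2 * F y"
      using C1(1) G.tail_nonneg by (intro mult_right_mono mult_left_mono) (auto simp: power2_eq_square algebra_simps)
    finally show ?thesis by (simp add: C5_def algebra_simps)
  qed
  have "\<P>(\<omega> in M. x < T k \<omega>) \<le> C5 * C4 * (1 + real k) ^ (d + 3) * F x" if x: "0 \<le> x" for k x
  proof (cases "k = 0")
    case True
    then show ?thesis using x C5 C4(1) G.tail_nonneg by (simp add: not_less)
  next
    case False
    then have k: "1 \<le> k" by simp
    have "{\<omega> \<in> space M. x < T k \<omega>} \<subseteq> (\<Union>l<k. {\<omega> \<in> space M. x / real k < W l (X l \<omega>) \<omega>})"
    proof (intro subsetI, rule ccontr)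
      fix \<omega> assume \<omega>: "\<omega> \<in> {\<omega> \<in> space M. x < T k \<omega>}" "\<omega> \<notin> (\<Union>l<k. {\<omega> \<in> space M. x / real k < W l (X l \<omega>) \<omega>})"
      have "T k \<omega> = (\<Sum>l<k. W l (X l \<omega>) \<omega>)" by (induction k) (auto simp: T_Suc)
      also have "\<dots> \<le> (\<Sum>l<k. x / real k)" using \<omega> by (intro sum_mono) (auto simp: not_less)
      also have "\<dots> = x" using k by simp
      finally show False using \<omega>(1) by simp
    qed
    then have "\<P>(\<omega> in M. x < T k \<omega>) \<le> prob (\<Union>l<k. {\<omega> \<in> space M. x / real k < W l (X l \<omega>) \<omega>})"
      by (intro finite_measure_mono) auto
    also have "\<dots> \<le> (\<Sum>l<k. \<P>(\<omega> in M. x / real k < W l (X l \<omega>) \<omega>))"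
      by (intro finite_measure_subadditive_finite) auto
    also have "\<dots> \<le> (\<Sum>l<k. C5 * (1 + real k)\<^sup>2 * (C4 * real k ^ d * F x))"
    proof (intro sum_mono)
      fix l assume "l \<in> {..<k}"
      then have l: "real l \<le> real k" by simp
      have "\<P>(\<omega> in M. x / real k < W l (X l \<omega>) \<omega>) \<le> C5 * (1 + real l)\<^sup>2 * F (x / real k)"
        using x by (intro W_le) auto
      also have "\<dots> \<le> C5 * (1 + real k)\<^sup>2 * (C4 * real k ^ d * F x)"
        using C5 l x k by (intro mult_mono C4(2) power_mono G.tail_nonneg) auto
      finally show "\<P>(\<omega> in M. x / real k < W l (X l \<omega>) \<omega>) \<le> C5 * (1 + real k)\<^sup>2 * (C4 * real k ^ d * F x)" .
    qed
    also have "\<dots> = C5 * C4 * (real k * (1 + real k)\<^sup>2 * real k ^ d) * F x" by (simp add: mult_ac)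
    also have "\<dots> \<le> C5 * C4 * ((1 + real k) * (1 + real k)\<^sup>2 * (1 + real k) ^ d) * F x"
      using C5 C4(1) G.tail_nonneg by (intro mult_right_mono mult_left_mono mult_mono power_mono) auto
    also have "(1 + real k) * (1 + real k)\<^sup>2 * (1 + real k) ^ d = (1 + real k) ^ (d + 3)"
      by (simp add: power_add power2_eq_square power3_eq_cube mult_ac)
    finally show ?thesis .
  qed
  moreover have "1 \<le> C5 * C4" using C5 C4 by (intro mult_ge1_I)
  ultimately show ?thesis using that by blast
qed

end

section \<open>Upper bound for a fixed number of rounds\<close>

context stable_feedback_queue begin

text \<open>
  The mean time that one customer in the queue adds to the next \<open>l\<close> rounds, through its own
  services and those of the customers who arrive meanwhile.
\<close>

definition backlog_time :: "nat \<Rightarrow> real" where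
  "backlog_time l = b * (1 - r ^ l) / (1 - r)"

text \<open>
  A service of length \<open>y\<close> lets \<open>lam * y\<close> customers arrive, so with \<open>l\<close> rounds to come it delays the
  end of the last one by \<open>stretch l * y\<close>.
\<close>

definition stretch :: "nat \<Rightarrow> real" where
  "stretch l = 1 + lam * backlog_time l"

text \<open>
  The mean number of services in round \<open>j + 1\<close>, the one of the tagged customer included.
\<close>

definition expected_customers :: "nat \<Rightarrow> real" where
  "expected_customers j = 1 + expectation (\<lambda>\<omega>. real (X j \<omega>))"

lemma backlog_time_0 [simp]: "backlog_time 0 = 0" by (simp add: backlog_time_def)

lemma backlog_time_Suc: "backlog_time (Suc l) = b + r * backlog_time l"
  using r_less_1 by (simp add: backlog_time_def field_simps)

lemma backlog_time_nonneg: "0 \<le> backlog_time l"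
  by (induction l) (use b_pos r_pos in \<open>auto simp: backlog_time_Suc\<close>)

lemma stretch_ge_1: "1 \<le> stretch l"
  using backlog_time_nonneg lam_pos by (simp add: stretch_def)

lemma expected_customers_ge_1: "1 \<le> expected_customers j"
  unfolding expected_customers_def by (simp add: integral_nonneg_AE)

lemma prob_two_services_gt:
  "\<P>(\<omega> in M. \<exists>i\<le>n. \<exists>i'\<le>n. i \<noteq> i' \<and> y < \<sigma> (Suc l) i \<omega> \<and> y < \<sigma> (Suc l) i' \<omega>) \<le> ((real n + 1) * F y)\<^sup>2"
proof -
  let ?A = "\<lambda>i. {\<omega> \<in> space M. y < \<sigma> (Suc l) i \<omega>}"
  have pair: "prob (?A i \<inter> ?A i') = F y * F y" if "i \<noteq> i'" for i i'
  proof -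
    have "?A i \<in> sets (alg {Service (Suc l) i})" for i
    proof -
      have [measurable]: "\<sigma> (Suc l) i \<in> borel_measurable (alg {Service (Suc l) i})" by (rule measurable_alg_service) simp
      have "{\<omega> \<in> space (alg {Service (Suc l) i}). y < \<sigma> (Suc l) i \<omega>} \<in> sets (alg {Service (Suc l) i})" by measurable
      then show ?thesis by simp
    qed
    then have "prob (?A i \<inter> ?A i') = prob (?A i) * prob (?A i')"
      using that by (intro indep_alg[of "{Service (Suc l) i}" "{Service (Suc l) i'}"]) (auto simp: sources_def)
    then show ?thesis by (simp add: prob_service_gt)
  qed
  let ?P = "{(i, i'). i \<le> n \<and> i' \<le> n \<and> i \<noteq> i'}"
  have sub: "?P \<subseteq> {..n} \<times> {..n}" by auto
  then have fin: "finite ?P" by (rule finite_subset) auto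
  have "{\<omega> \<in> space M. \<exists>i\<le>n. \<exists>i'\<le>n. i \<noteq> i' \<and> y < \<sigma> (Suc l) i \<omega> \<and> y < \<sigma> (Suc l) i' \<omega>}
      = (\<Union>(i, i')\<in>?P. ?A i \<inter> ?A i')" by auto
  then have "\<P>(\<omega> in M. \<exists>i\<le>n. \<exists>i'\<le>n. i \<noteq> i' \<and> y < \<sigma> (Suc l) i \<omega> \<and> y < \<sigma> (Suc l) i' \<omega>)
      = prob (\<Union>x\<in>?P. ?A (fst x) \<inter> ?A (snd x))" by (simp add: case_prod_unfold)
  also have "\<dots> \<le> (\<Sum>x\<in>?P. prob (?A (fst x) \<inter> ?A (snd x)))"
    by (intro finite_measure_subadditive_finite fin) auto
  also have "\<dots> = (\<Sum>x\<in>?P. F y * F y)" using pair by (intro sum.cong) auto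
  also have "\<dots> = real (card ?P) * (F y * F y)" by simp
  also have "\<dots> \<le> (real n + 1) * (real n + 1) * (F y * F y)"
  proof (intro mult_right_mono mult_nonneg_nonneg G.tail_nonneg)
    have "card ?P \<le> card ({..n} \<times> {..n})" using sub by (intro card_mono) auto
    then have "card ?P \<le> Suc n * Suc n" by simp
    then have "real (card ?P) \<le> real (Suc n * Suc n)" by (rule of_nat_mono)
    then show "real (card ?P) \<le> (real n + 1) * (real n + 1)" by (simp add: algebra_simps)
  qed
  finally show ?thesis by (simp add: power2_eq_square mult_ac)
qed

lemma W_le_truncated:
  assumes g: "good \<omega>" and y: "0 \<le> y"
    and one: "\<not> (\<exists>i\<le>n. \<exists>i'\<le>n. i \<noteq> i' \<and> y < \<sigma> (Suc l) i \<omega> \<and> y < \<sigma> (Suc l) i' \<omega>)"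
  shows "W l n \<omega> \<le> (\<Sum>i=0..n. min (\<sigma> (Suc l) i \<omega>) y) \<or>
    (\<exists>i\<le>n. y < \<sigma> (Suc l) i \<omega> \<and> W l n \<omega> \<le> \<sigma> (Suc l) i \<omega> + (\<Sum>i=0..n. min (\<sigma> (Suc l) i \<omega>) y))"
proof (cases "\<exists>i\<le>n. y < \<sigma> (Suc l) i \<omega>")
  case False
  then have "W l n \<omega> = (\<Sum>i=0..n. min (\<sigma> (Suc l) i \<omega>) y)"
    unfolding W_def by (intro sum.cong) (auto simp: not_less)
  then show ?thesis by simp
next
  case True
  then obtain i where i: "i \<le> n" "y < \<sigma> (Suc l) i \<omega>" by auto
  have "W l n \<omega> = \<sigma> (Suc l) i \<omega> + (\<Sum>k\<in>{0..n} - {i}. \<sigma> (Suc l) k \<omega>)"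
    unfolding W_def using i by (subst sum.remove[of _ i]) auto
  also have "(\<Sum>k\<in>{0..n} - {i}. \<sigma> (Suc l) k \<omega>) = (\<Sum>k\<in>{0..n} - {i}. min (\<sigma> (Suc l) k \<omega>) y)"
  proof (intro sum.cong refl)
    fix k assume "k \<in> {0..n} - {i}"
    then have "\<not> y < \<sigma> (Suc l) k \<omega>" using one i by auto
    then show "\<sigma> (Suc l) k \<omega> = min (\<sigma> (Suc l) k \<omega>) y" by simp
  qed
  also have "\<dots> \<le> (\<Sum>k\<in>{0..n}. min (\<sigma> (Suc l) k \<omega>) y)"
    using g y by (intro sum_mono2) (auto simp: good_def)
  finally show ?thesis using i by auto
qed

text \<open>
  Compare \<open>L = T j + (b + r c) * X j\<close> with its successor \<open>L' = T (j + 1) + c * X (j + 1)\<close>.  The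
  factor \<open>b + r c\<close> is such that the two agree up to fluctuations.  If \<open>L \<le> (1 - \<delta>) x\<close>, then
  \<open>X j \<le> x / b\<close>, and \<open>L' > x\<close> requires one of the events: too many arrivals (\<open>E1\<close>), too much feedback
  (\<open>E2\<close>), a deviation of the truncated services (\<open>E3\<close>), two services longer than \<open>\<epsilon> x\<close> (\<open>E4\<close>), one
  such service when \<open>L\<close> is already of order \<open>x\<close> (\<open>E5\<close>), or a single service that is long enough by
  itself (\<open>E6\<close>).  Only \<open>E6\<close> has a probability of the order of \<open>F x\<close>.
\<close>

lemma prob_step_upper:
  assumes c: "0 \<le> c" and \<delta>: "0 < \<delta>" "\<delta> < 1" and \<eta>: "0 < \<eta>"
  shows "\<forall>\<^sub>F x in at_top. \<P>(\<omega> in M. x < T (Suc j) \<omega> + c * real (X (Suc j) \<omega>))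
    \<le> \<P>(\<omega> in M. (1 - \<delta>) * x < T j \<omega> + (b + r * c) * real (X j \<omega>))
      + expected_customers j * F ((1 - \<delta>) * x / (1 + lam * c)) + \<eta> * F x"
proof -
  \<comment> \<open>\<open>\<zeta>\<close> and \<open>\<xi>\<close> are chosen such that all errors together are at most \<open>\<delta> * x\<close>, see \<open>budget\<close>\<close>
  define \<zeta> where "\<zeta> = \<delta> / (8 * (1 + c))"
  define lam' where "lam' = lam + \<zeta>"
  define \<xi> where "\<xi> = \<delta> / (8 * ((1 + c) * (1 + lam')))"
  define \<mu> where "\<mu> = 1 + lam * c"
  have \<zeta>: "0 < \<zeta>" using \<delta> c by (simp add: \<zeta>_def)
  have lam': "lam < lam'" "0 < lam'" using \<zeta> lam_pos by (auto simp: lam'_def)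
  have \<xi>: "0 < \<xi>" using \<delta> c lam' by (simp add: \<xi>_def)
  have \<mu>: "1 \<le> \<mu>" using c lam_pos by (simp add: \<mu>_def)
  have budget: "2 * (c * \<zeta>) + \<xi> * (1 + 2 * (1 + c * lam') + 2 * c) \<le> \<delta>"
  proof -
    have "c * \<zeta> \<le> (1 + c) * \<zeta>" using \<zeta> by (intro mult_right_mono) auto
    also have "\<dots> = \<delta> / 8"
    proof -
      have "1 + c \<noteq> 0" using c by simp
      then show ?thesis unfolding \<zeta>_def by (simp del: distrib_left_numeral)
    qed
    finally have 1: "c * \<zeta> \<le> \<delta> / 8" .
    have "0 \<le> c * lam'" using c lam' by simp
    then have "1 + 2 * (1 + c * lam') + 2 * c \<le> 3 * ((1 + c) * (1 + lam'))"
      using c lam' by (simp add: algebra_simps)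
    then have "\<xi> * (1 + 2 * (1 + c * lam') + 2 * c) \<le> \<xi> * (3 * ((1 + c) * (1 + lam')))"
      using \<xi> by (intro mult_left_mono) auto
    also have "\<dots> = 3 * \<delta> / 8"
    proof -
      have "(1 + c) * (1 + lam') \<noteq> 0" using c lam' by simp
      moreover have "\<delta> / (8 * Q) * (3 * Q) = 3 * \<delta> / 8" if "Q \<noteq> 0" for Q using that by (simp add: field_simps)
      ultimately show ?thesis unfolding \<xi>_def by blast
    qed
    finally show ?thesis using 1 \<delta> by linarith
  qed
  define Cn where "Cn = 1 / b + 1"
  have Cn: "0 < Cn" using b_pos by (simp add: Cn_def add_pos_pos)
  obtain \<epsilon> A where \<epsilon>: "0 < \<epsilon>" and A: "1 \<le> A"
    "\<forall>\<^sub>F x in at_top. \<forall>l n. real n + 1 \<le> Cn * x \<longrightarrow>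
      \<P>(\<omega> in M. (real n + 1) * b + \<xi> * x \<le> (\<Sum>i=0..n. min (\<sigma> (Suc l) i \<omega>) (\<epsilon> * x)))
        \<le> A * ((real n + 1) * F (\<epsilon> * x))\<^sup>2"
    using prob_truncated_services[OF Cn \<xi>] by blast
  obtain C\<epsilon> where C\<epsilon>: "1 \<le> C\<epsilon>" "\<And>x. 0 \<le> x \<Longrightarrow> F (\<epsilon> * x) \<le> C\<epsilon> * F x" using G.tail_scale_le[OF \<epsilon>] by blast
  obtain C1 \<eta>1 where C1: "1 \<le> C1" "0 < \<eta>1"
    "\<And>l x. 0 \<le> x \<Longrightarrow> \<P>(\<omega> in M. lam' * W l (X l \<omega>) \<omega> + \<xi> * x < real (N (T (Suc l) \<omega>) \<omega>) - real (N (T l \<omega>) \<omega>))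
       \<le> C1 * (1 + real l) * exp (- \<eta>1 * x)"
    using arrivals_in_stage_upper_tail[OF lam'(1) \<xi>] by blast
  define \<eta>2 where "\<eta>2 = 2 * \<xi>\<^sup>2 / (1 / b)"
  have \<eta>2: "0 < \<eta>2" using \<xi> b_pos by (simp add: \<eta>2_def)
  define ej where "ej = expected_customers j"
  have ej: "1 \<le> ej" unfolding ej_def by (rule expected_customers_ge_1)
  define c' where "c' = b + r * c"
  have c': "b \<le> c'" using r_pos c by (simp add: c'_def)
  define L where "L x = {\<omega> \<in> space M. \<xi> * x < T j \<omega> + c' * real (X j \<omega>)}" for x
  have L_past: "L x \<in> sets (alg (past j))" for x
  proof -
    note [measurable] = measurable_X_past measurable_T_past
    have "{\<omega> \<in> space (alg (past j)). \<xi> * x < T j \<omega> + c' * real (X j \<omega>)} \<in> sets (alg (past j))" by measurable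
    then show ?thesis by (simp add: L_def)
  qed
  define I where "I x = (\<integral>\<omega>. indicator (L x) \<omega> * (real (X j \<omega>) + 1) \<partial>M)" for x
  \<comment> \<open>this makes \<open>E5\<close> negligible; the dominating variable is \<open>1 + X j\<close>, whose mean is finite\<close>
  have I_lim: "(I \<longlongrightarrow> 0) at_top"
  proof -
    have "((\<lambda>x. \<integral>\<omega>. indicator (L x) \<omega> * (real (X j \<omega>) + 1) \<partial>M) \<longlongrightarrow> (\<integral>\<omega>. 0 \<partial>M)) at_top"
    proof (rule integral_dominated_convergence_at_top[where w = "\<lambda>\<omega>. real (X j \<omega>) + 1"])
      show "\<forall>\<^sub>F x in at_top. AE \<omega> in M. norm (indicator (L x) \<omega> * (real (X j \<omega>) + 1)) \<le> real (X j \<omega>) + 1"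
        by (intro always_eventually allI AE_I2) (auto simp: indicator_def)
      show "AE \<omega> in M. ((\<lambda>x. indicator (L x) \<omega> * (real (X j \<omega>) + 1)) \<longlongrightarrow> 0) at_top"
      proof (rule AE_I2)
        fix \<omega>
        have "\<forall>\<^sub>F x in at_top. indicator (L x) \<omega> * (real (X j \<omega>) + 1) = 0"
          using eventually_ge_at_top[of "(T j \<omega> + c' * real (X j \<omega>)) / \<xi>"]
        proof eventually_elim
          case (elim x)
          then have "T j \<omega> + c' * real (X j \<omega>) \<le> \<xi> * x" using \<xi> by (simp add: field_simps)
          then show ?case by (simp add: L_def)
        qed
        then show "((\<lambda>x. indicator (L x) \<omega> * (real (X j \<omega>) + 1)) \<longlongrightarrow> 0) at_top" by (rule tendsto_eventually)
      qed
      show "integrable M (\<lambda>\<omega>. real (X j \<omega>) + 1)" by simp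
      show "(\<lambda>\<omega>. indicator (L x) \<omega> * (real (X j \<omega>) + 1)) \<in> borel_measurable M" for x
        using alg_past_events[OF L_past[of x]] by measurable
    qed simp
    then show ?thesis by (simp add: I_def[abs_def])
  qed
  have I_nonneg: "0 \<le> I x" for x unfolding I_def by (intro integral_nonneg_AE) auto
  have ev1: "\<forall>\<^sub>F x in at_top. C1 * (1 + real j) * (exp (- \<eta>1 * x) / F x) < \<eta> / 4"
  proof -
    have "((\<lambda>x. C1 * (1 + real j) * (exp (- \<eta>1 * x) / F x)) \<longlongrightarrow> C1 * (1 + real j) * 0) at_top"
      by (intro tendsto_mult_left G.exp_smallo_tail C1)
    then show ?thesis using \<eta> by (intro order_tendstoD(2)) auto
  qed
  have ev2: "\<forall>\<^sub>F x in at_top. exp (- \<eta>2 * x) / F x < \<eta> / 4"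
    using G.exp_smallo_tail[OF \<eta>2] \<eta> by (intro order_tendstoD(2)) auto
  have ev3: "\<forall>\<^sub>F x in at_top. ((A + 1) * Cn * ej * C\<epsilon>) * (x * F (\<epsilon> * x)) < \<eta> / 4"
  proof -
    have "((\<lambda>x. ((A + 1) * Cn * ej * C\<epsilon>) * (x * F (\<epsilon> * x))) \<longlongrightarrow> ((A + 1) * Cn * ej * C\<epsilon>) * 0) at_top"
      by (intro tendsto_mult_left tail_scale_mult_tendsto_0 \<epsilon>)
    then show ?thesis using \<eta> by (intro order_tendstoD(2)) auto
  qed
  have ev4: "\<forall>\<^sub>F x in at_top. C\<epsilon> * I x < \<eta> / 4"
  proof -
    have "((\<lambda>x. C\<epsilon> * I x) \<longlongrightarrow> C\<epsilon> * 0) at_top" by (intro tendsto_mult_left I_lim)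
    then show ?thesis using \<eta> by (intro order_tendstoD(2)) auto
  qed
  show ?thesis
    using A(2) ev1 ev2 ev3 ev4 eventually_ge_at_top[of "max 1 (b / \<xi>)"]
  proof eventually_elim
    case (elim x)
    have x: "1 \<le> x" "b \<le> \<xi> * x" using elim(6) \<xi> by (auto simp: field_simps)
    define E0 where "E0 = {\<omega> \<in> space M. (1 - \<delta>) * x < T j \<omega> + c' * real (X j \<omega>)}"
    define E1 where "E1 = {\<omega> \<in> space M. lam' * W j (X j \<omega>) \<omega> + \<xi> * x < real (N (T (Suc j) \<omega>) \<omega>) - real (N (T j \<omega>) \<omega>)}"
    define E2 where "E2 = {\<omega> \<in> space M. real (X j \<omega>) \<le> 1 / b * x \<and> real (X j \<omega>) * p + \<xi> * x < real (NB (Suc j) (X j \<omega>) \<omega>)}"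
    let ?P3 = "\<lambda>n \<omega>. (real n + 1) * b + \<xi> * x \<le> (\<Sum>i=0..n. min (\<sigma> (Suc j) i \<omega>) (\<epsilon> * x))"
    let ?P4 = "\<lambda>n \<omega>. \<exists>i\<le>n. \<exists>i'\<le>n. i \<noteq> i' \<and> \<epsilon> * x < \<sigma> (Suc j) i \<omega> \<and> \<epsilon> * x < \<sigma> (Suc j) i' \<omega>"
    let ?P5 = "\<lambda>n \<omega>. \<exists>i\<le>n. \<epsilon> * x < \<sigma> (Suc j) i \<omega>"
    let ?P6 = "\<lambda>n \<omega>. \<exists>i\<le>n. (1 - \<delta>) * x / \<mu> < \<sigma> (Suc j) i \<omega>"
    define E3 where "E3 = {\<omega> \<in> space M. real (X j \<omega>) \<le> 1 / b * x \<and> ?P3 (X j \<omega>) \<omega>}"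
    define E4 where "E4 = {\<omega> \<in> space M. real (X j \<omega>) \<le> 1 / b * x \<and> ?P4 (X j \<omega>) \<omega>}"
    define E5 where "E5 = {\<omega> \<in> space M. \<omega> \<in> L x \<and> True \<and> ?P5 (X j \<omega>) \<omega>}"
    define E6 where "E6 = {\<omega> \<in> space M. True \<and> ?P6 (X j \<omega>) \<omega>}"
    have P_sets: "{\<omega> \<in> space M. ?P3 n \<omega>} \<in> sets (alg (stage j))" "{\<omega> \<in> space M. ?P4 n \<omega>} \<in> sets (alg (stage j))"
      "{\<omega> \<in> space M. ?P5 n \<omega>} \<in> sets (alg (stage j))" "{\<omega> \<in> space M. ?P6 n \<omega>} \<in> sets (alg (stage j))" for n
    proof -
      note [measurable] = measurable_service_stage
      have "{\<omega> \<in> space (alg (stage j)). ?P3 n \<omega>} \<in> sets (alg (stage j))" "{\<omega> \<in> space (alg (stage j)). ?P4 n \<omega>} \<in> sets (alg (stage j))"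
      "{\<omega> \<in> space (alg (stage j)). ?P5 n \<omega>} \<in> sets (alg (stage j))" "{\<omega> \<in> space (alg (stage j)). ?P6 n \<omega>} \<in> sets (alg (stage j))"
        by measurable
      then show "{\<omega> \<in> space M. ?P3 n \<omega>} \<in> sets (alg (stage j))" "{\<omega> \<in> space M. ?P4 n \<omega>} \<in> sets (alg (stage j))"
        "{\<omega> \<in> space M. ?P5 n \<omega>} \<in> sets (alg (stage j))" "{\<omega> \<in> space M. ?P6 n \<omega>} \<in> sets (alg (stage j))"
        by (simp_all only: space_alg)
    qed
    have F\<epsilon>: "F (\<epsilon> * x) \<le> C\<epsilon> * F x" using x by (intro C\<epsilon>) auto
    have F\<epsilon>0: "0 \<le> F (\<epsilon> * x)" by (rule G.tail_nonneg)
    have sq_le: "((real n + 1) * F (\<epsilon> * x))\<^sup>2 \<le> (Cn * x * F (\<epsilon> * x) * F (\<epsilon> * x)) * (real n + 1)"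
      and n_le: "real n + 1 \<le> Cn * x" if "real n \<le> 1 / b * x" for n
    proof -
      show n: "real n + 1 \<le> Cn * x" using that x by (simp add: Cn_def algebra_simps)
      have "((real n + 1) * F (\<epsilon> * x))\<^sup>2 = (real n + 1) * (F (\<epsilon> * x) * F (\<epsilon> * x) * (real n + 1))"
        by (simp add: power2_eq_square mult_ac)
      also have "\<dots> \<le> (Cn * x) * (F (\<epsilon> * x) * F (\<epsilon> * x) * (real n + 1))"
        using n F\<epsilon>0 by (intro mult_right_mono) auto
      finally show "((real n + 1) * F (\<epsilon> * x))\<^sup>2 \<le> (Cn * x * F (\<epsilon> * x) * F (\<epsilon> * x)) * (real n + 1)" by (simp add: mult_ac)
    qed
    have CxF: "0 \<le> Cn * x * F (\<epsilon> * x) * F (\<epsilon> * x)" using Cn x F\<epsilon>0 by simp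
    have p3: "prob E3 \<le> (A * (Cn * x * F (\<epsilon> * x) * F (\<epsilon> * x))) * ej"
      unfolding E3_def ej_def expected_customers_def
    proof (rule prob_stage_linear_le[OF P_sets(1)])
      fix n assume n: "real n \<le> 1 / b * x"
      have "\<P>(\<omega> in M. ?P3 n \<omega>) \<le> A * ((real n + 1) * F (\<epsilon> * x))\<^sup>2"
        using elim(1)[rule_format, OF n_le[OF n]] .
      also have "\<dots> \<le> A * ((Cn * x * F (\<epsilon> * x) * F (\<epsilon> * x)) * (real n + 1))"
        using A(1) by (intro mult_left_mono sq_le n) auto
      finally show "\<P>(\<omega> in M. ?P3 n \<omega>) \<le> A * (Cn * x * F (\<epsilon> * x) * F (\<epsilon> * x)) * (real n + 1)"
        by (simp add: mult_ac)
    qed (use A(1) CxF in auto)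
    have p4: "prob E4 \<le> (Cn * x * F (\<epsilon> * x) * F (\<epsilon> * x)) * ej"
      unfolding E4_def ej_def expected_customers_def
    proof (rule prob_stage_linear_le[OF P_sets(2)])
      fix n assume n: "real n \<le> 1 / b * x"
      show "\<P>(\<omega> in M. ?P4 n \<omega>) \<le> Cn * x * F (\<epsilon> * x) * F (\<epsilon> * x) * (real n + 1)"
        using prob_two_services_gt sq_le[OF n] by (rule order_trans)
    qed (use CxF in auto)
    have p5: "prob E5 \<le> F (\<epsilon> * x) * I x"
      unfolding E5_def I_def
    proof (rule prob_stage_le[OF L_past P_sets(3)])
      fix n
      show "\<P>(\<omega> in M. ?P5 n \<omega>) \<le> F (\<epsilon> * x) * (real n + 1)"
        using prob_ex_service_gt[of n "\<epsilon> * x" j] by (simp add: mult.commute)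
    qed (use F\<epsilon>0 in auto)
    have p6: "prob E6 \<le> F ((1 - \<delta>) * x / \<mu>) * ej"
      unfolding E6_def ej_def expected_customers_def
    proof (rule prob_stage_linear_le[OF P_sets(4)])
      fix n
      show "\<P>(\<omega> in M. ?P6 n \<omega>) \<le> F ((1 - \<delta>) * x / \<mu>) * (real n + 1)"
        using prob_ex_service_gt[of n "(1 - \<delta>) * x / \<mu>" j] by (simp add: mult.commute)
    qed (auto intro: G.tail_nonneg)
    have m3: "E3 \<in> events" and m4: "E4 \<in> events" and m5: "E5 \<in> events" and m6: "E6 \<in> events"
      unfolding E3_def E4_def E5_def E6_def
      by (rule stage_event[OF P_sets(1)] stage_event[OF P_sets(2)] past_stage_event[OF L_past P_sets(3)] stage_event[OF P_sets(4)])+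
    have p1: "prob E1 \<le> C1 * (1 + real j) * exp (- \<eta>1 * x)" unfolding E1_def using x by (intro C1) auto
    have p2: "prob E2 \<le> exp (- \<eta>2 * x)" unfolding E2_def \<eta>2_def using b_pos \<xi> by (intro prob_NB_X_upper) auto
    have m0: "E0 \<in> events" and m1: "E1 \<in> events" and m2: "E2 \<in> events" unfolding E0_def E1_def E2_def by measurable
    have "\<P>(\<omega> in M. x < T (Suc j) \<omega> + c * real (X (Suc j) \<omega>))
        \<le> prob (E0 \<union> (E6 \<union> (E1 \<union> (E2 \<union> (E3 \<union> (E4 \<union> E5))))))"
    proof (rule finite_measure_mono_AE)
      show "E0 \<union> (E6 \<union> (E1 \<union> (E2 \<union> (E3 \<union> (E4 \<union> E5))))) \<in> events"
        by (intro sets.Un m0 m1 m2 m3 m4 m5 m6)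
      show "AE \<omega> in M. \<omega> \<in> {\<omega> \<in> space M. x < T (Suc j) \<omega> + c * real (X (Suc j) \<omega>)} \<longrightarrow>
        \<omega> \<in> E0 \<union> (E6 \<union> (E1 \<union> (E2 \<union> (E3 \<union> (E4 \<union> E5)))))"
        using AE_good
      proof eventually_elim
        case (elim \<omega>)
        show ?case
        proof (intro impI, rule ccontr)
          assume big: "\<omega> \<in> {\<omega> \<in> space M. x < T (Suc j) \<omega> + c * real (X (Suc j) \<omega>)}"
            and no: "\<omega> \<notin> E0 \<union> (E6 \<union> (E1 \<union> (E2 \<union> (E3 \<union> (E4 \<union> E5)))))"
          have sp: "\<omega> \<in> space M" using big by simp
          define n where "n = X j \<omega>"
          have L0: "T j \<omega> + c' * real n \<le> (1 - \<delta>) * x" using no sp by (simp add: E0_def n_def not_less)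
          have Tj: "0 \<le> T j \<omega>" using elim by (rule T_nonneg)
          have "b * real n \<le> c' * real n" using c' by (intro mult_right_mono) auto
          also have "\<dots> \<le> 1 * x" using L0 Tj \<delta> x mult_right_mono[of "1 - \<delta>" 1 x] by linarith
          finally have bn: "b * real n \<le> x" by simp
          then have nx: "real n \<le> 1 / b * x" using b_pos by (simp add: field_simps)
          have no1: "real (N (T (Suc j) \<omega>) \<omega>) - real (N (T j \<omega>) \<omega>) \<le> lam' * W j n \<omega> + \<xi> * x"
            using no sp by (simp add: E1_def n_def not_less)
          have no2: "real (NB (Suc j) n \<omega>) \<le> real n * p + \<xi> * x"
            using no sp nx by (auto simp: E2_def n_def not_less)
          have no3: "(\<Sum>i=0..n. min (\<sigma> (Suc j) i \<omega>) (\<epsilon> * x)) < (real n + 1) * b + \<xi> * x"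
            using no sp nx by (auto simp: E3_def n_def not_le)
          have no4: "\<not> ?P4 n \<omega>" using no sp nx unfolding n_def E4_def by blast
          have no5: "T j \<omega> + c' * real n \<le> \<xi> * x" if "?P5 n \<omega>"
            using no sp that unfolding n_def E5_def L_def by (auto simp: not_less)
          have no6: "\<mu> * \<sigma> (Suc j) i \<omega> \<le> (1 - \<delta>) * x" if "i \<le> n" for i
          proof -
            have "\<sigma> (Suc j) i \<omega> \<le> (1 - \<delta>) * x / \<mu>" using no sp that unfolding n_def E6_def by (auto simp: not_less)
            then show ?thesis using \<mu> by (simp add: field_simps)
          qed
          have Nm: "N (T j \<omega>) \<omega> \<le> N (T (Suc j) \<omega>) \<omega>" using elim by (intro N_mono T_mono_Suc)
          have XS: "real (X (Suc j) \<omega>) = real (N (T (Suc j) \<omega>) \<omega>) - real (N (T j \<omega>) \<omega>) + real (NB (Suc j) n \<omega>)"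
            using Nm by (simp add: X_Suc n_def of_nat_diff)
          have XS_le: "real (X (Suc j) \<omega>) \<le> lam' * W j n \<omega> + \<xi> * x + (real n * p + \<xi> * x)"
            using XS no1 no2 by linarith
          have "x < T (Suc j) \<omega> + c * real (X (Suc j) \<omega>)" using big by simp
          also have "\<dots> \<le> T j \<omega> + W j n \<omega> + c * (lam' * W j n \<omega> + \<xi> * x + (real n * p + \<xi> * x))"
            using mult_left_mono[OF XS_le c] by (simp add: T_Suc n_def)
          also have "\<dots> = T j \<omega> + (1 + c * lam') * W j n \<omega> + c * p * real n + 2 * c * \<xi> * x"
            by (simp add: algebra_simps)
          finally have main: "x < T j \<omega> + (1 + c * lam') * W j n \<omega> + c * p * real n + 2 * c * \<xi> * x" .
          define w where "w = (real n + 1) * b + \<xi> * x"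
          have cl: "0 \<le> 1 + c * lam'" using c lam' by simp
          have rest: "T j \<omega> + (1 + c * lam') * w + c * p * real n + 2 * c * \<xi> * x
              \<le> T j \<omega> + c' * real n + (c * \<zeta> + \<xi> * (2 * (1 + c * lam') + 2 * c)) * x"
          proof -
            have "w \<le> real n * b + 2 * (\<xi> * x)" using x by (simp add: w_def algebra_simps)
            then have "(1 + c * lam') * w \<le> (1 + c * lam') * (real n * b + 2 * (\<xi> * x))"
              using cl by (rule mult_left_mono)
            moreover have "(1 + c * lam') * (real n * b + 2 * (\<xi> * x)) + c * p * real n
                = c' * real n + c * \<zeta> * (b * real n) + \<xi> * (2 * (1 + c * lam')) * x"
              by (simp add: c'_def r_eq lam'_def algebra_simps)
            moreover have "c * \<zeta> * (b * real n) \<le> c * \<zeta> * x" using bn c \<zeta> by (intro mult_left_mono) auto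
            ultimately show ?thesis by (simp add: algebra_simps)
          qed
          have \<epsilon>x: "0 \<le> \<epsilon> * x" using \<epsilon> x by simp
          consider "W j n \<omega> \<le> w" | i where "i \<le> n" "\<epsilon> * x < \<sigma> (Suc j) i \<omega>" "W j n \<omega> \<le> \<sigma> (Suc j) i \<omega> + w"
            using W_le_truncated[OF elim \<epsilon>x no4] no3 unfolding w_def by fastforce
          then show False
          proof cases
            case 1
            have "(1 + c * lam') * W j n \<omega> \<le> (1 + c * lam') * w" using 1 cl by (rule mult_left_mono)
            then have "x < (1 - \<delta>) * x + (c * \<zeta> + \<xi> * (2 * (1 + c * lam') + 2 * c)) * x"
              using main rest L0 by linarith
            also have "\<dots> \<le> (1 - \<delta>) * x + \<delta> * x"
            proof -
              have "0 \<le> c * \<zeta>" using c \<zeta> by simp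
              then have "c * \<zeta> + \<xi> * (2 * (1 + c * lam') + 2 * c) \<le> \<delta>"
                using budget \<xi> by (simp add: algebra_simps)
              then show ?thesis using x by (intro add_left_mono mult_right_mono) auto
            qed
            finally show False by (simp add: algebra_simps)
          next
            case 2
            define z where "z = \<sigma> (Suc j) i \<omega>"
            have z: "\<mu> * z \<le> (1 - \<delta>) * x" unfolding z_def by (rule no6[OF 2(1)])
            have z0: "0 \<le> z" using elim by (simp add: z_def good_def)
            have "1 * z \<le> \<mu> * z" using \<mu> z0 by (rule mult_right_mono)
            also have "\<dots> \<le> 1 * x" using z \<delta> x mult_right_mono[of "1 - \<delta>" 1 x] by linarith
            finally have zx: "z \<le> x" by simp
            have "(1 + c * lam') * W j n \<omega> \<le> (1 + c * lam') * (z + w)"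
              using 2(3) cl unfolding z_def by (rule mult_left_mono)
            also have "\<dots> = \<mu> * z + c * \<zeta> * z + (1 + c * lam') * w"
              by (simp add: \<mu>_def lam'_def algebra_simps)
            finally have W: "(1 + c * lam') * W j n \<omega> \<le> \<mu> * z + c * \<zeta> * z + (1 + c * lam') * w" .
            have "c * \<zeta> * z \<le> c * \<zeta> * x" using zx c \<zeta> by (intro mult_left_mono) auto
            moreover have "T j \<omega> + c' * real n \<le> \<xi> * x" using 2 by (intro no5) auto
            ultimately have "x < \<xi> * x + (c * \<zeta> + \<xi> * (2 * (1 + c * lam') + 2 * c)) * x + (1 - \<delta>) * x + c * \<zeta> * x"
              using main rest W z by linarith
            also have "\<dots> = (1 - \<delta>) * x + (2 * (c * \<zeta>) + \<xi> * (1 + 2 * (1 + c * lam') + 2 * c)) * x"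
              by (simp add: algebra_simps)
            also have "\<dots> \<le> (1 - \<delta>) * x + \<delta> * x"
              using budget x by (intro add_left_mono mult_right_mono) auto
            finally show False by (simp add: algebra_simps)
          qed
        qed
      qed
    qed
    also have "\<dots> \<le> prob E0 + (prob E6 + (prob E1 + (prob E2 + (prob E3 + (prob E4 + prob E5)))))"
      by (intro order_trans[OF measure_Un_le] add_left_mono order_refl sets.Un m0 m1 m2 m3 m4 m5 m6)
    also have "\<dots> \<le> prob E0 + ej * F ((1 - \<delta>) * x / \<mu>) + \<eta> * F x"
    proof -
      have Fx: "0 < F x" by (rule G.tail_pos)
      have q1: "prob E1 \<le> \<eta> / 4 * F x" using p1 elim(2) Fx by (simp add: field_simps)
      have q2: "prob E2 \<le> \<eta> / 4 * F x" using p2 elim(3) Fx by (simp add: field_simps)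
      have q34: "prob E3 + prob E4 \<le> \<eta> / 4 * F x"
      proof -
        have "prob E3 + prob E4 \<le> ((A + 1) * Cn * ej * (x * F (\<epsilon> * x))) * F (\<epsilon> * x)"
          using p3 p4 by (simp add: algebra_simps)
        also have "\<dots> \<le> ((A + 1) * Cn * ej * (x * F (\<epsilon> * x))) * (C\<epsilon> * F x)"
          using A(1) Cn ej x F\<epsilon>0 by (intro mult_left_mono F\<epsilon>) auto
        also have "\<dots> = (((A + 1) * Cn * ej * C\<epsilon>) * (x * F (\<epsilon> * x))) * F x" by (simp add: mult_ac)
        also have "\<dots> \<le> \<eta> / 4 * F x" using elim(4) Fx by (intro mult_right_mono) auto
        finally show ?thesis .
      qed
      have q5: "prob E5 \<le> \<eta> / 4 * F x"
      proof -
        have "prob E5 \<le> (C\<epsilon> * F x) * I x" using p5 F\<epsilon> I_nonneg mult_right_mono by (meson order_trans)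
        also have "\<dots> = (C\<epsilon> * I x) * F x" by (simp add: mult_ac)
        also have "\<dots> \<le> \<eta> / 4 * F x" using elim(5) Fx by (intro mult_right_mono) auto
        finally show ?thesis .
      qed
      have "prob E6 \<le> ej * F ((1 - \<delta>) * x / \<mu>)" using p6 by (simp add: mult.commute)
      moreover have "\<eta> * F x = \<eta> / 4 * F x + \<eta> / 4 * F x + \<eta> / 4 * F x + \<eta> / 4 * F x" by simp
      ultimately show ?thesis using q1 q2 q34 q5 by linarith
    qed
    finally show ?case by (simp add: E0_def c'_def ej_def \<mu>_def)
  qed
qed

text \<open>
  Iteration of \<open>prob_step_upper\<close> with \<open>c = backlog_time (k - j - 1)\<close> from \<open>L 0 = 0\<close> to \<open>L k = T k\<close>.  Each
  step contracts \<open>x\<close> by \<open>1 - \<delta>1\<close>; taking \<open>\<delta>1\<close> half as large as \<open>\<delta>\<close> keeps the product of two factors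
  above \<open>1 - \<delta>\<close>, which is all that the induction step needs.
\<close>

lemma prob_T_upper:
  assumes \<delta>: "0 < \<delta>" "\<delta> < 1" and \<eta>: "0 < \<eta>"
  shows "\<forall>\<^sub>F x in at_top. \<P>(\<omega> in M. x < T k \<omega>)
    \<le> (\<Sum>i<k. expected_customers i * F ((1 - \<delta>) * x / stretch (k - Suc i))) + \<eta> * F x"
proof -
  have "\<forall>\<^sub>F x in at_top. \<P>(\<omega> in M. x < T j \<omega> + backlog_time (k - j) * real (X j \<omega>))
    \<le> (\<Sum>i<j. expected_customers i * F ((1 - \<delta>) * x / stretch (k - Suc i))) + \<eta> * F x"
    if "j \<le> k" "0 < \<delta>" "\<delta> < 1" "0 < \<eta>" for j \<delta> \<eta>
    using that
  proof (induction j arbitrary: \<delta> \<eta>)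
    case 0
    show ?case using eventually_ge_at_top[of 0]
      by eventually_elim (use 0 G.tail_nonneg in \<open>simp add: not_less mult_nonneg_nonneg\<close>)
  next
    case (Suc j)
    obtain D where D: "1 \<le> D" "\<And>x. F (x / 2) \<le> D * F x" using G.tail_half_le by blast
    define \<delta>1 where "\<delta>1 = \<delta> / 2"
    have \<delta>1: "0 < \<delta>1" "\<delta>1 < 1" "\<delta>1 < 1/2" "1 - \<delta> \<le> (1 - \<delta>1) * (1 - \<delta>1)"
      using Suc.prems by (auto simp: \<delta>1_def algebra_simps)
    define \<eta>1 where "\<eta>1 = \<eta> / (2 * D)"
    have \<eta>1: "0 < \<eta>1" "\<eta>1 * D = \<eta> / 2" using Suc.prems D by (auto simp: \<eta>1_def)
    have k: "k - j = Suc (k - Suc j)" using Suc.prems by simp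
    have "j \<le> k" using Suc.prems by simp
    note IH = Suc.IH[OF this \<delta>1(1,2) \<eta>1(1)]
    have "filterlim (\<lambda>x. x * (1 - \<delta>1)) at_top at_top"
      using \<delta>1 by (intro filterlim_at_top_mult_tendsto_pos[OF tendsto_const _ filterlim_ident]) auto
    note IH' = eventually_compose_filterlim[OF IH this]
    have "0 < \<eta> / 2" using Suc.prems by simp
    note step = prob_step_upper[OF backlog_time_nonneg[of "k - Suc j"] \<delta>1(1,2) this, of j, folded backlog_time_Suc stretch_def, folded k]
    from step IH' show ?case using eventually_ge_at_top[of 0]
    proof eventually_elim
      case (elim x)
      have "\<P>(\<omega> in M. x < T (Suc j) \<omega> + backlog_time (k - Suc j) * real (X (Suc j) \<omega>))
          \<le> \<P>(\<omega> in M. (1 - \<delta>1) * x < T j \<omega> + backlog_time (k - j) * real (X j \<omega>))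
          + expected_customers j * F ((1 - \<delta>1) * x / stretch (k - Suc j)) + \<eta> / 2 * F x" by (rule elim(1))
      also have "\<P>(\<omega> in M. (1 - \<delta>1) * x < T j \<omega> + backlog_time (k - j) * real (X j \<omega>))
          \<le> (\<Sum>i<j. expected_customers i * F ((1 - \<delta>1) * (x * (1 - \<delta>1)) / stretch (k - Suc i))) + \<eta>1 * F (x * (1 - \<delta>1))"
        using elim(2) by (simp add: mult.commute)
      also have "(\<Sum>i<j. expected_customers i * F ((1 - \<delta>1) * (x * (1 - \<delta>1)) / stretch (k - Suc i)))
          \<le> (\<Sum>i<j. expected_customers i * F ((1 - \<delta>) * x / stretch (k - Suc i)))"
      proof (intro sum_mono mult_left_mono G.tail_antimono divide_right_mono)
        show "(1 - \<delta>) * x \<le> (1 - \<delta>1) * (x * (1 - \<delta>1))"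
          using mult_right_mono[OF \<delta>1(4) elim(3)] by (simp add: mult_ac)
      qed (use stretch_ge_1 expected_customers_ge_1 in \<open>auto intro: order_trans[of 0 1]\<close>)
      also have "\<eta>1 * F (x * (1 - \<delta>1)) \<le> \<eta>1 * (D * F x)"
      proof (intro mult_left_mono)
        have "x / 2 \<le> x * (1 - \<delta>1)" using mult_left_mono[of "1/2" "1 - \<delta>1" x] \<delta>1 elim(3) by simp
        then have "F (x * (1 - \<delta>1)) \<le> F (x / 2)" by (rule G.tail_antimono)
        also have "\<dots> \<le> D * F x" by (rule D)
        finally show "F (x * (1 - \<delta>1)) \<le> D * F x" .
      qed (use \<eta>1 in auto)
      also have "\<eta>1 * (D * F x) = \<eta> / 2 * F x" using \<eta>1(2) by (simp add: mult.assoc[symmetric])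
      also have "expected_customers j * F ((1 - \<delta>1) * x / stretch (k - Suc j)) \<le> expected_customers j * F ((1 - \<delta>) * x / stretch (k - Suc j))"
      proof (intro mult_left_mono G.tail_antimono divide_right_mono mult_right_mono)
        show "1 - \<delta> \<le> 1 - \<delta>1" using Suc.prems by (simp add: \<delta>1_def)
      qed (use stretch_ge_1[of "k - Suc j"] expected_customers_ge_1[of j] elim(3) in auto)
      finally show ?case by (simp add: algebra_simps)
    qed
  qed
  from this[OF order_refl \<delta> \<eta>] show ?thesis by simp
qed

end

section \<open>Lower bound for a fixed number of rounds\<close>

context prob_space begin

lemma bonferroni_lower:
  assumes fin: "finite I" and A: "\<And>i. i \<in> I \<Longrightarrow> A i \<in> events" and \<kappa>: "0 \<le> \<kappa>"
    and pair: "\<And>i j. i \<in> I \<Longrightarrow> j \<in> I \<Longrightarrow> i \<noteq> j \<Longrightarrow> prob (A i \<inter> A j) \<le> \<kappa>"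
  shows "(\<Sum>i\<in>I. prob (A i)) - (real (card I))\<^sup>2 * \<kappa> \<le> prob (\<Union>i\<in>I. A i)"
  using fin A pair
proof (induction I rule: finite_induct)
  case (insert i I)
  let ?U = "\<Union>i\<in>I. A i"
  have U: "?U \<in> events" using insert by auto
  have "A i \<inter> ?U = (\<Union>j\<in>I. A i \<inter> A j)" by blast
  then have "prob (A i \<inter> ?U) = prob (\<Union>j\<in>I. A i \<inter> A j)" by (rule arg_cong)
  also have "\<dots> \<le> (\<Sum>j\<in>I. prob (A i \<inter> A j))"
    using insert by (intro finite_measure_subadditive_finite) auto
  also have "\<dots> \<le> (\<Sum>j\<in>I. \<kappa>)" using insert by (intro sum_mono insert.prems) auto
  also have "\<dots> = real (card I) * \<kappa>" by simp
  finally have int: "prob (A i \<inter> ?U) \<le> real (card I) * \<kappa>" .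
  have "prob (A i \<union> ?U) = prob (A i) + prob ?U - prob (A i \<inter> ?U)"
    using insert.prems U by (intro measure_Un3) (auto simp: fmeasurable_eq_sets)
  moreover have "(\<Sum>i\<in>I. prob (A i)) - (real (card I))\<^sup>2 * \<kappa> \<le> prob ?U" using insert by auto
  moreover have "(real (card I))\<^sup>2 * \<kappa> + real (card I) * \<kappa> \<le> (real (card (insert i I)))\<^sup>2 * \<kappa>"
  proof -
    have "(real (card I))\<^sup>2 + real (card I) \<le> (real (card (insert i I)))\<^sup>2"
      using insert.hyps by (simp add: power2_eq_square algebra_simps)
    from mult_right_mono[OF this \<kappa>] show ?thesis by (simp add: algebra_simps)
  qed
  ultimately show ?case using insert.hyps int by simp
qed simp

end

context stable_feedback_queue begin

text \<open>
  At most \<open>2 x / b\<close> of the services are needed to reach the capped mean \<open>min (b n) (2 x)\<close>, so a deficit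
  of \<open>\<xi> x\<close> is exponentially unlikely uniformly in \<open>n\<close>.  Without the cap, \<open>\<xi> x\<close> would be smaller than
  the fluctuations of the sum for large \<open>n\<close>.
\<close>

lemma prob_W_lower:
  assumes \<xi>: "0 < \<xi>" "\<xi> < 1"
  obtains C \<theta> where "0 < C" "0 < \<theta>"
    "\<And>l n x. 0 \<le> x \<Longrightarrow> \<P>(\<omega> in M. W l n \<omega> < min (b * real n) (2 * x) - \<xi> * x) \<le> C * exp (- \<theta> * x)"
proof -
  define b' where "b' = b * (1 - \<xi> / 4)"
  have b': "b' < (\<integral>y. y \<partial>G)" using b_pos \<xi> by (simp add: b'_def G_mean)
  obtain \<theta> where \<theta>: "0 < \<theta>"
    "\<And>(I :: nat set) Y u. finite I \<Longrightarrow> indep_vars (\<lambda>_. borel) Y I \<Longrightarrow> (\<And>i. i \<in> I \<Longrightarrow> distr M borel (Y i) = G)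
      \<Longrightarrow> \<P>(\<omega> in M. (\<Sum>i\<in>I. Y i \<omega>) \<le> real (card I) * b' - u) \<le> exp (- \<theta> * u)"
    by (rule iid_sum_lower_tail[OF G.prob_space_axioms _ G_nonneg G_integrable b', where 'i = nat]) (simp, blast)
  show ?thesis
  proof (rule that[of "exp (\<theta> * b)" "\<theta> * \<xi> / 2"])
    fix l n and x :: real assume x: "0 \<le> x"
    define n' where "n' = min n (nat \<lfloor>2 * x / b\<rfloor>)"
    have nx: "real n' \<le> 2 * x / b" "min (real n) (2 * x / b) \<le> real n' + 1"
    proof -
      have "0 \<le> 2 * x / b" using x b_pos by simp
      then show "real n' \<le> 2 * x / b" "min (real n) (2 * x / b) \<le> real n' + 1"
        unfolding n'_def by linarith+
    qed
    have bn: "b * real n' \<le> 2 * x" using nx(1) b_pos by (simp add: field_simps)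
    have "b * min (real n) (2 * x / b) \<le> b * (real n' + 1)" using nx(2) b_pos by (intro mult_left_mono) auto
    then have mn: "min (b * real n) (2 * x) \<le> b * real n' + b"
      using b_pos by (simp add: min_mult_distrib_left algebra_simps)
    have "\<xi> / 4 * (b * real n') \<le> \<xi> / 4 * (2 * x)" using bn \<xi> by (intro mult_left_mono) auto
    then have b'n: "b * real n' \<le> real n' * b' + \<xi> * x / 2" by (simp add: b'_def algebra_simps)
    have "\<P>(\<omega> in M. W l n \<omega> < min (b * real n) (2 * x) - \<xi> * x)
        \<le> \<P>(\<omega> in M. (\<Sum>i\<in>{..<n'}. \<sigma> (Suc l) i \<omega>) \<le> real (card {..<n'}) * b' - (\<xi> * x / 2 - b))"
    proof (rule finite_measure_mono_AE)
      show "AE \<omega> in M. \<omega> \<in> {\<omega> \<in> space M. W l n \<omega> < min (b * real n) (2 * x) - \<xi> * x} \<longrightarrow>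
        \<omega> \<in> {\<omega> \<in> space M. (\<Sum>i\<in>{..<n'}. \<sigma> (Suc l) i \<omega>) \<le> real (card {..<n'}) * b' - (\<xi> * x / 2 - b)}"
        using AE_service_nonneg
      proof eventually_elim
        case (elim \<omega>)
        have "(\<Sum>i\<in>{..<n'}. \<sigma> (Suc l) i \<omega>) \<le> W l n \<omega>"
          unfolding W_def using elim by (intro sum_mono2) (auto simp: n'_def)
        show ?case
        proof
          assume "\<omega> \<in> {\<omega> \<in> space M. W l n \<omega> < min (b * real n) (2 * x) - \<xi> * x}"
          then have \<omega>: "\<omega> \<in> space M" "W l n \<omega> < min (b * real n) (2 * x) - \<xi> * x" by blast+
          have "(\<Sum>i\<in>{..<n'}. \<sigma> (Suc l) i \<omega>) \<le> real n' * b' - (\<xi> * x / 2 - b)"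
            using \<open>_ \<le> W l n \<omega>\<close> \<omega>(2) mn b'n by linarith
          with \<omega>(1) show "\<omega> \<in> {\<omega> \<in> space M. (\<Sum>i\<in>{..<n'}. \<sigma> (Suc l) i \<omega>) \<le> real (card {..<n'}) * b' - (\<xi> * x / 2 - b)}"
            by simp
        qed
      qed
    qed measurable
    also have "\<dots> \<le> exp (- \<theta> * (\<xi> * x / 2 - b))"
      by (intro \<theta>(2) indep_vars_service service_distribution) auto
    also have "\<dots> = exp (\<theta> * b) * exp (- (\<theta> * \<xi> / 2) * x)" by (simp add: exp_add[symmetric] algebra_simps)
    finally show "\<P>(\<omega> in M. W l n \<omega> < min (b * real n) (2 * x) - \<xi> * x) \<le> exp (\<theta> * b) * exp (- (\<theta> * \<xi> / 2) * x)" .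
  qed (use \<theta> \<xi> in auto)
qed

definition backlog_bound :: real where "backlog_bound = b / (1 - r)"

lemma backlog_time_le_bound: "backlog_time l \<le> backlog_bound"
proof -
  have "b * (1 - r ^ l) \<le> b * 1" using b_pos r_pos by (intro mult_left_mono) auto
  then show ?thesis unfolding backlog_time_def backlog_bound_def using r_less_1 by (intro divide_right_mono) auto
qed

lemma backlog_bound_pos: "0 < backlog_bound"
  using b_pos r_less_1 by (simp add: backlog_bound_def)

lemma stretch_le: "stretch l \<le> 1 + lam * backlog_bound"
  unfolding stretch_def using backlog_time_le_bound lam_pos by simp

lemma jump_event_past: "Suc j \<le> l \<Longrightarrow> {\<omega> \<in> space M. y < \<sigma> (Suc j) i \<omega>} \<in> sets (alg (past l))"
proof -
  assume "Suc j \<le> l"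
  then have [measurable]: "\<sigma> (Suc j) i \<in> borel_measurable (alg (past l))"
    by (intro measurable_alg_service) (simp add: past_def)
  have "{\<omega> \<in> space (alg (past l)). y < \<sigma> (Suc j) i \<omega>} \<in> sets (alg (past l))" by measurable
  then show ?thesis by simp
qed

lemma jump_event_service: "{\<omega> \<in> space M. y < \<sigma> (Suc j) i \<omega>} \<in> sets (alg {Service (Suc j) i})"
proof -
  have [measurable]: "\<sigma> (Suc j) i \<in> borel_measurable (alg {Service (Suc j) i})"
    by (intro measurable_alg_service) simp
  have "{\<omega> \<in> space (alg {Service (Suc j) i}). y < \<sigma> (Suc j) i \<omega>} \<in> sets (alg {Service (Suc j) i})" by measurable
  then show ?thesis by simp
qed

text \<open>
  The functional \<open>L l = T l + backlog_time (k - l) * X l\<close> is at least \<open>stretch (k - j - 1)\<close> times the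
  long service at the end of its round, up to an error, and each later round decreases it by at
  most a multiple of \<open>\<xi> x\<close>.  The queue length never exceeds \<open>2 x / b\<close>, for then the next round alone
  would last longer than \<open>x\<close>, against \<open>T k \<le> x\<close>.
\<close>

lemma T_large_after_jump:
  assumes g: "good \<omega>" and x: "0 < x" and \<xi>: "0 < \<xi>" "\<xi> < 1" and j: "j < k" and i: "i \<le> X j \<omega>"
    and T: "T k \<omega> \<le> x"
    and NN: "\<And>t. 0 \<le> t \<Longrightarrow> t \<le> x \<Longrightarrow> \<bar>real (N t \<omega>) - lam * t\<bar> \<le> \<xi> * x"
    and W: "\<And>l. j < l \<Longrightarrow> l < k \<Longrightarrow> min (b * real (X l \<omega>)) (2 * x) - \<xi> * x \<le> W l (X l \<omega>) \<omega>"
    and B: "\<And>l. j < l \<Longrightarrow> l < k \<Longrightarrow> real (X l \<omega>) \<le> 2 / b * x \<Longrightarrow> real (X l \<omega>) * p - \<xi> * x \<le> real (NB (Suc l) (X l \<omega>) \<omega>)"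
  shows "stretch (k - Suc j) * \<sigma> (Suc j) i \<omega> - real k * (1 + (lam + 3) * backlog_bound) * \<xi> * x \<le> T k \<omega>"
proof -
  define Q where "Q = (1 + (lam + 3) * backlog_bound) * \<xi> * x"
  have Q: "0 \<le> Q" using backlog_bound_pos lam_pos \<xi> x by (simp add: Q_def)
  define z where "z = \<sigma> (Suc j) i \<omega>"
  have z0: "0 \<le> z" using g by (simp add: z_def good_def)
  have Tx: "0 \<le> T l \<omega>" "T l \<omega> \<le> x" if "l \<le> k" for l
    using T_nonneg[OF g] T_mono[OF g that] T by auto
  have arr: "lam * W l (X l \<omega>) \<omega> - 2 * (\<xi> * x) \<le> real (N (T (Suc l) \<omega>) \<omega> - N (T l \<omega>) \<omega>)" if "l < k" for l
  proof -
    have "real (N (T l \<omega>) \<omega>) \<le> lam * T l \<omega> + \<xi> * x" using NN[of "T l \<omega>"] Tx[of l] that by auto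
    moreover have "lam * T (Suc l) \<omega> - \<xi> * x \<le> real (N (T (Suc l) \<omega>) \<omega>)" using NN[of "T (Suc l) \<omega>"] Tx[of "Suc l"] that by auto
    moreover have "lam * T (Suc l) \<omega> = lam * T l \<omega> + lam * W l (X l \<omega>) \<omega>" by (simp add: T_Suc algebra_simps)
    ultimately have "lam * W l (X l \<omega>) \<omega> - 2 * (\<xi> * x) \<le> real (N (T (Suc l) \<omega>) \<omega>) - real (N (T l \<omega>) \<omega>)" by linarith
    also have "\<dots> \<le> real (N (T (Suc l) \<omega>) \<omega> - N (T l \<omega>) \<omega>)" by linarith
    finally show ?thesis .
  qed
  have "stretch (k - Suc j) * z - real (Suc n) * Q \<le> T (Suc j + n) \<omega> + backlog_time (k - (Suc j + n)) * real (X (Suc j + n) \<omega>)"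
    if "Suc j + n \<le> k" for n
    using that
  proof (induction n)
    case 0
    let ?c = "backlog_time (k - Suc j)"
    have Wz: "z \<le> W j (X j \<omega>) \<omega>"
      unfolding W_def z_def using i g by (intro member_le_sum) (auto simp: good_def)
    have "lam * W j (X j \<omega>) \<omega> - 2 * (\<xi> * x) \<le> real (X (Suc j) \<omega>)" using arr[of j] j by (simp add: X_Suc)
    then have "?c * (lam * W j (X j \<omega>) \<omega> - 2 * (\<xi> * x)) \<le> ?c * real (X (Suc j) \<omega>)"
      using backlog_time_nonneg by (rule mult_left_mono)
    moreover have "(1 + lam * ?c) * z \<le> (1 + lam * ?c) * W j (X j \<omega>) \<omega>"
      using Wz backlog_time_nonneg lam_pos by (intro mult_left_mono) (auto intro: add_nonneg_nonneg)
    moreover have "?c * (2 * (\<xi> * x)) \<le> Q"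
    proof -
      have "?c * (2 * (\<xi> * x)) \<le> backlog_bound * (2 * (\<xi> * x))" using backlog_time_le_bound \<xi> x by (intro mult_right_mono) auto
      also have "\<dots> = (2 * backlog_bound) * (\<xi> * x)" by simp
      also have "\<dots> \<le> (1 + (lam + 3) * backlog_bound) * (\<xi> * x)"
      proof (rule mult_right_mono)
        have "0 \<le> lam * backlog_bound" using lam_pos backlog_bound_pos by simp
        then show "2 * backlog_bound \<le> 1 + (lam + 3) * backlog_bound" using backlog_bound_pos by (simp add: algebra_simps)
      qed (use \<xi> x in auto)
      finally show ?thesis by (simp add: Q_def mult_ac)
    qed
    moreover have "0 \<le> T j \<omega>" using g by (rule T_nonneg)
    ultimately show ?case by (simp add: T_Suc stretch_def algebra_simps)
  next
    case (Suc n)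
    define l where "l = Suc j + n"
    define c where "c = backlog_time (k - Suc l)"
    have l: "j < l" "l < k" using Suc.prems by (auto simp: l_def)
    have kl: "k - l = Suc (k - Suc l)" using l by simp
    have bl: "backlog_time (k - l) = b + r * c" unfolding kl backlog_time_Suc c_def ..
    have c0: "0 \<le> c" "c \<le> backlog_bound" unfolding c_def by (rule backlog_time_nonneg backlog_time_le_bound)+
    define n' where "n' = real (X l \<omega>)"
    define w where "w = W l (X l \<omega>) \<omega>"
    have wm: "min (b * n') (2 * x) - \<xi> * x \<le> w" unfolding w_def n'_def by (rule W[OF l])
    have "T l \<omega> + w = T (Suc l) \<omega>" by (simp add: T_Suc w_def)
    then have "w \<le> x" using Tx[of "Suc l"] Tx[of l] l by simp
    moreover have "\<xi> * x < x" using \<xi> x by simp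
    ultimately have "b * n' \<le> 2 * x" using wm by (auto simp: min_def split: if_splits)
    then have n'x: "n' \<le> 2 / b * x" and w: "b * n' - \<xi> * x \<le> w" using wm b_pos by (auto simp: field_simps min_def)
    have "n' * p - \<xi> * x \<le> real (NB (Suc l) (X l \<omega>) \<omega>)"
      using B[OF l] n'x unfolding n'_def by blast
    then have XS: "lam * w + n' * p - 3 * (\<xi> * x) \<le> real (X (Suc l) \<omega>)"
      using arr[OF l(2)] by (simp add: X_Suc w_def)
    have "T l \<omega> + (b + r * c) * n' - Q \<le> T (Suc l) \<omega> + c * real (X (Suc l) \<omega>)"
    proof -
      have "c * (lam * w + n' * p - 3 * (\<xi> * x)) \<le> c * real (X (Suc l) \<omega>)" using XS c0(1) by (rule mult_left_mono)
      moreover have "(1 + c * lam) * (b * n' - \<xi> * x) \<le> (1 + c * lam) * w"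
        using w c0 lam_pos by (intro mult_left_mono) (auto intro: add_nonneg_nonneg)
      moreover have "(1 + (lam + 3) * c) * (\<xi> * x) \<le> Q"
      proof -
        have "(1 + (lam + 3) * c) * (\<xi> * x) \<le> (1 + (lam + 3) * backlog_bound) * (\<xi> * x)"
          using c0 lam_pos \<xi> x by (intro mult_right_mono add_left_mono mult_left_mono) auto
        then show ?thesis by (simp add: Q_def mult_ac)
      qed
      ultimately show ?thesis by (simp add: T_Suc w_def[symmetric] r_eq algebra_simps)
    qed
    moreover have "stretch (k - Suc j) * z - real (Suc n) * Q \<le> T l \<omega> + (b + r * c) * n'"
      using Suc.IH l(2) unfolding l_def[symmetric] bl n'_def by simp
    ultimately have "stretch (k - Suc j) * z - real (Suc n) * Q - Q \<le> T (Suc l) \<omega> + c * real (X (Suc l) \<omega>)"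
      by linarith
    moreover have "Suc j + Suc n = Suc l" by (simp add: l_def)
    moreover have "real (Suc (Suc n)) * Q = real (Suc n) * Q + Q" by (simp add: algebra_simps)
    ultimately show ?case unfolding c_def by simp
  qed
  from this[of "k - Suc j"] have "stretch (k - Suc j) * z - real (Suc (k - Suc j)) * Q \<le> T k \<omega>" using j by simp
  moreover have "real (Suc (k - Suc j)) * Q \<le> real k * Q" using j Q by (intro mult_right_mono) auto
  ultimately show ?thesis by (simp add: z_def Q_def mult_ac)
qed

text \<open>
  A long service can fail to delay \<open>T k\<close> beyond \<open>x\<close> only if the arrival process deviates, which is
  independent of that service, or if a later round deviates, which is independent of the past that
  contains it.  So the failure probability is a factor tending to \<open>0\<close> times \<open>F (\<kappa> * x)\<close>.
\<close>

lemma jump_without_effect_negligible: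
  assumes j: "j < k" and \<delta>: "0 < \<delta>" and \<eta>: "0 < \<eta>"
  shows "\<forall>\<^sub>F x in at_top. \<P>(\<omega> in M. i \<le> X j \<omega> \<and> (1 + \<delta>) * x / stretch (k - Suc j) < \<sigma> (Suc j) i \<omega> \<and> T k \<omega> \<le> x) \<le> \<eta> * F x"
proof -
  define \<mu> where "\<mu> = stretch (k - Suc j)"
  have \<mu>: "1 \<le> \<mu>" unfolding \<mu>_def by (rule stretch_ge_1)
  define \<kappa> where "\<kappa> = (1 + \<delta>) / \<mu>"
  have \<kappa>: "0 < \<kappa>" using \<delta> \<mu> by (simp add: \<kappa>_def)
  define Q where "Q = real k * (1 + (lam + 3) * backlog_bound)"
  have Q: "0 < Q" using j lam_pos backlog_bound_pos by (auto simp: Q_def intro!: mult_pos_pos add_pos_pos)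
  define \<xi> where "\<xi> = min (1/2) (\<delta> / Q)"
  have \<xi>: "0 < \<xi>" "\<xi> < 1" "Q * \<xi> \<le> \<delta>"
  proof -
    show "0 < \<xi>" "\<xi> < 1" using \<delta> Q by (auto simp: \<xi>_def)
    have "Q * \<xi> \<le> Q * (\<delta> / Q)" using Q by (intro mult_left_mono) (auto simp: \<xi>_def)
    then show "Q * \<xi> \<le> \<delta>" using Q by simp
  qed
  obtain V where V: "\<And>x. V x \<in> sets (alg arrivals)" "((\<lambda>x. prob (V x)) \<longlongrightarrow> 0) at_top"
    "\<And>x \<omega> t. 0 < x \<Longrightarrow> \<omega> \<in> space M - V x \<Longrightarrow> good \<omega> \<Longrightarrow> 0 \<le> t \<Longrightarrow> t \<le> x \<Longrightarrow> \<bar>real (N t \<omega>) - lam * t\<bar> \<le> \<xi> * x"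
    using renewal_uniform_weak_lln[OF \<xi>(1)] by blast
  obtain C1 \<theta> where C1: "0 < C1" "0 < \<theta>"
    "\<And>l n x. 0 \<le> x \<Longrightarrow> \<P>(\<omega> in M. W l n \<omega> < min (b * real n) (2 * x) - \<xi> * x) \<le> C1 * exp (- \<theta> * x)"
    using prob_W_lower[OF \<xi>(1,2)] by blast
  define \<theta>2 where "\<theta>2 = 2 * \<xi>\<^sup>2 / (2 / b)"
  have \<theta>2: "0 < \<theta>2" using \<xi> b_pos by (simp add: \<theta>2_def)
  obtain C\<kappa> where C\<kappa>: "1 \<le> C\<kappa>" "\<And>x. 0 \<le> x \<Longrightarrow> F (\<kappa> * x) \<le> C\<kappa> * F x" using G.tail_scale_le[OF \<kappa>] by blast
  define J where "J x = {\<omega> \<in> space M. \<kappa> * x < \<sigma> (Suc j) i \<omega>}" for x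
  have J_ev: "J x \<in> events" for x unfolding J_def by measurable
  have J_prob: "prob (J x) = F (\<kappa> * x)" for x unfolding J_def by (rule prob_service_gt)
  define e where "e x = prob (V x) + real k * (C1 * exp (- \<theta> * x) + exp (- \<theta>2 * x))" for x
  have exp_lim: "((\<lambda>x. exp (- t * x)) \<longlongrightarrow> 0) at_top" if "0 < t" for t :: real
    using that by real_asymp
  have "(e \<longlongrightarrow> 0 + real k * (C1 * 0 + 0)) at_top"
    unfolding e_def by (intro tendsto_intros V(2) exp_lim C1 \<theta>2)
  then have "((\<lambda>x. e x * C\<kappa>) \<longlongrightarrow> 0 * C\<kappa>) at_top" by (intro tendsto_intros) simp
  then have "\<forall>\<^sub>F x in at_top. e x * C\<kappa> < \<eta>" using \<eta> by (intro order_tendstoD(2)) auto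
  then show ?thesis using eventually_gt_at_top[of 0]
  proof eventually_elim
    case (elim x)
    define E0 where "E0 = V x \<inter> J x"
    define E1 where "E1 l = {\<omega> \<in> space M. \<omega> \<in> J x \<and> True \<and> W l (X l \<omega>) \<omega> < min (b * real (X l \<omega>)) (2 * x) - \<xi> * x}" for l
    define E2 where "E2 l = {\<omega> \<in> space M. \<omega> \<in> J x \<and> real (X l \<omega>) \<le> 2 / b * x \<and> real (NB (Suc l) (X l \<omega>) \<omega>) < real (X l \<omega>) * p - \<xi> * x}" for l
    have E0_ev: "E0 \<in> events" unfolding E0_def using alg_arrivals_events[OF V(1)] J_ev by auto
    have E1_ev: "E1 l \<in> events" for l
      unfolding E1_def using J_ev[of x] by measurable
    have E2_ev: "E2 l \<in> events" for l
      unfolding E2_def using J_ev[of x] by measurable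
    have p0: "prob E0 = prob (V x) * F (\<kappa> * x)"
    proof -
      have "prob E0 = prob (V x) * prob (J x)" unfolding E0_def J_def
        by (rule indep_alg[OF _ arrivals_sources _ V(1) jump_event_service]) (auto simp: arrivals_def sources_def)
      then show ?thesis by (simp add: J_prob)
    qed
    have J_past: "J x \<in> sets (alg (past l))" if "j < l" for l
      unfolding J_def using that by (intro jump_event_past) auto
    have p1: "prob (E1 l) \<le> C1 * exp (- \<theta> * x) * F (\<kappa> * x)" if "j < l" for l
      unfolding E1_def J_prob[symmetric]
    proof (rule prob_stage_const_le[OF J_past[OF that]])
      fix n
      note [measurable] = measurable_W
      have "{\<omega> \<in> space (alg (stage l)). W l n \<omega> < min (b * real n) (2 * x) - \<xi> * x} \<in> sets (alg (stage l))" by measurable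
      then show "{\<omega> \<in> space M. W l n \<omega> < min (b * real n) (2 * x) - \<xi> * x} \<in> sets (alg (stage l))" by (simp only: space_alg)
      show "\<P>(\<omega> in M. W l n \<omega> < min (b * real n) (2 * x) - \<xi> * x) \<le> C1 * exp (- \<theta> * x)"
        using elim(2) by (intro C1(3)) auto
    qed (use C1 in auto)
    have p2: "prob (E2 l) \<le> exp (- \<theta>2 * x) * F (\<kappa> * x)" if "j < l" for l
      unfolding E2_def J_prob[symmetric]
    proof (rule prob_stage_const_le[OF J_past[OF that]])
      fix n
      note [measurable] = measurable_NB_stage
      have "{\<omega> \<in> space (alg (stage l)). real (NB (Suc l) n \<omega>) < real n * p - \<xi> * x} \<in> sets (alg (stage l))" by measurable
      then show "{\<omega> \<in> space M. real (NB (Suc l) n \<omega>) < real n * p - \<xi> * x} \<in> sets (alg (stage l))" by (simp only: space_alg)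
      assume "real n \<le> 2 / b * x"
      then show "\<P>(\<omega> in M. real (NB (Suc l) n \<omega>) < real n * p - \<xi> * x) \<le> exp (- \<theta>2 * x)"
        unfolding \<theta>2_def using b_pos \<xi> by (intro prob_NB_deviation) auto
    qed simp
    let ?L = "{Suc j..<k}"
    have "\<P>(\<omega> in M. i \<le> X j \<omega> \<and> (1 + \<delta>) * x / stretch (k - Suc j) < \<sigma> (Suc j) i \<omega> \<and> T k \<omega> \<le> x)
        \<le> prob (E0 \<union> (\<Union>l\<in>?L. E1 l \<union> E2 l))"
    proof (rule finite_measure_mono_AE)
      show "E0 \<union> (\<Union>l\<in>?L. E1 l \<union> E2 l) \<in> events" using E0_ev E1_ev E2_ev by auto
      show "AE \<omega> in M. \<omega> \<in> {\<omega> \<in> space M. i \<le> X j \<omega> \<and> (1 + \<delta>) * x / stretch (k - Suc j) < \<sigma> (Suc j) i \<omega> \<and> T k \<omega> \<le> x} \<longrightarrow>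
         \<omega> \<in> E0 \<union> (\<Union>l\<in>?L. E1 l \<union> E2 l)"
        using AE_good
      proof eventually_elim
        case (elim \<omega>)
        note good = elim
        show ?case
        proof (intro impI, rule ccontr)
          assume in1: "\<omega> \<in> {\<omega> \<in> space M. i \<le> X j \<omega> \<and> (1 + \<delta>) * x / stretch (k - Suc j) < \<sigma> (Suc j) i \<omega> \<and> T k \<omega> \<le> x}"
            and no: "\<omega> \<notin> E0 \<union> (\<Union>l\<in>?L. E1 l \<union> E2 l)"
          have sp: "\<omega> \<in> space M" and i: "i \<le> X j \<omega>" and T: "T k \<omega> \<le> x"
            and jump: "(1 + \<delta>) * x / \<mu> < \<sigma> (Suc j) i \<omega>" using in1 by (auto simp: \<mu>_def)
          have J: "\<omega> \<in> J x" using sp jump by (simp add: J_def \<kappa>_def)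
          have "\<omega> \<notin> V x" using no J by (auto simp: E0_def)
          then have NN: "\<bar>real (N t \<omega>) - lam * t\<bar> \<le> \<xi> * x" if "0 \<le> t" "t \<le> x" for t
            using V(3)[OF \<open>0 < x\<close> _ good that] sp by auto
          have E1n: "\<omega> \<notin> E1 l" and E2n: "\<omega> \<notin> E2 l" if "j < l" "l < k" for l
            using no that by auto
          have Wl: "min (b * real (X l \<omega>)) (2 * x) - \<xi> * x \<le> W l (X l \<omega>) \<omega>" if "j < l" "l < k" for l
            using E1n[OF that] sp J unfolding E1_def by simp
          have Bl: "real (X l \<omega>) * p - \<xi> * x \<le> real (NB (Suc l) (X l \<omega>) \<omega>)" if "j < l" "l < k" "real (X l \<omega>) \<le> 2 / b * x" for l
            using E2n[OF that(1,2)] that(3) sp J unfolding E2_def by simp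
          have "\<mu> * \<sigma> (Suc j) i \<omega> - real k * (1 + (lam + 3) * backlog_bound) * \<xi> * x \<le> T k \<omega>"
            unfolding \<mu>_def by (rule T_large_after_jump[OF good \<open>0 < x\<close> \<xi>(1,2) j i T NN Wl Bl])
          moreover have "real k * (1 + (lam + 3) * backlog_bound) * \<xi> * x \<le> \<delta> * x"
            using mult_right_mono[OF \<xi>(3), of x] \<open>0 < x\<close> by (simp add: Q_def)
          moreover have "(1 + \<delta>) * x < \<mu> * \<sigma> (Suc j) i \<omega>" using jump \<mu> by (simp add: field_simps)
          ultimately have "(1 + \<delta>) * x - \<delta> * x < x" using T by linarith
          then show False by (simp add: algebra_simps)
        qed
      qed
    qed
    also have "\<dots> \<le> prob E0 + prob (\<Union>l\<in>?L. E1 l \<union> E2 l)"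
      using E0_ev E1_ev E2_ev by (intro measure_Un_le) auto
    also have "prob (\<Union>l\<in>?L. E1 l \<union> E2 l) \<le> (\<Sum>l\<in>?L. prob (E1 l \<union> E2 l))"
      using E1_ev E2_ev by (intro finite_measure_subadditive_finite) auto
    also have "\<dots> \<le> (\<Sum>l\<in>?L. (C1 * exp (- \<theta> * x) + exp (- \<theta>2 * x)) * F (\<kappa> * x))"
    proof (intro sum_mono)
      fix l assume l: "l \<in> ?L"
      have "prob (E1 l \<union> E2 l) \<le> prob (E1 l) + prob (E2 l)" using E1_ev E2_ev by (intro measure_Un_le) auto
      also have "\<dots> \<le> C1 * exp (- \<theta> * x) * F (\<kappa> * x) + exp (- \<theta>2 * x) * F (\<kappa> * x)"
        using l by (intro add_mono p1 p2) auto
      finally show "prob (E1 l \<union> E2 l) \<le> (C1 * exp (- \<theta> * x) + exp (- \<theta>2 * x)) * F (\<kappa> * x)" by (simp add: algebra_simps)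
    qed
    also have "\<dots> = real (card ?L) * ((C1 * exp (- \<theta> * x) + exp (- \<theta>2 * x)) * F (\<kappa> * x))" by simp
    also have "\<dots> \<le> real k * ((C1 * exp (- \<theta> * x) + exp (- \<theta>2 * x)) * F (\<kappa> * x))"
      using C1 G.tail_nonneg by (intro mult_right_mono mult_nonneg_nonneg add_nonneg_nonneg) auto
    also have "prob E0 + \<dots> = e x * F (\<kappa> * x)" by (simp add: p0 e_def algebra_simps)
    also have "\<dots> \<le> e x * (C\<kappa> * F x)"
      using C1 elim(2) by (intro mult_left_mono C\<kappa>(2)) (auto simp: e_def intro!: add_nonneg_nonneg mult_nonneg_nonneg)
    also have "\<dots> = (e x * C\<kappa>) * F x" by simp
    also have "\<dots> \<le> \<eta> * F x" using elim(1) G.tail_nonneg by (intro mult_right_mono) auto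
    finally show ?case by simp
  qed
qed

lemma expected_customers_approx:
  assumes "0 < \<eta>"
  shows "\<forall>\<^sub>F n in sequentially. expected_customers j - \<eta> \<le> (\<Sum>i\<le>n. \<P>(\<omega> in M. i \<le> X j \<omega>))"
proof -
  have "(\<lambda>n. expectation (\<lambda>\<omega>. 1 + real (min (X j \<omega>) n))) \<longlonglongrightarrow> expectation (\<lambda>\<omega>. 1 + real (X j \<omega>))"
  proof (rule integral_dominated_convergence[where w = "\<lambda>\<omega>. 1 + real (X j \<omega>)"])
    show "AE \<omega> in M. (\<lambda>n. 1 + real (min (X j \<omega>) n)) \<longlonglongrightarrow> 1 + real (X j \<omega>)"
    proof (rule AE_I2)
      fix \<omega>
      have "\<forall>\<^sub>F n in sequentially. 1 + real (min (X j \<omega>) n) = 1 + real (X j \<omega>)"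
        using eventually_ge_at_top[of "X j \<omega>"] by eventually_elim auto
      then show "(\<lambda>n. 1 + real (min (X j \<omega>) n)) \<longlonglongrightarrow> 1 + real (X j \<omega>)" by (rule tendsto_eventually)
    qed
  qed auto
  moreover have "expectation (\<lambda>\<omega>. 1 + real (X j \<omega>)) = expected_customers j"
    by (simp add: expected_customers_def prob_space)
  moreover have "expectation (\<lambda>\<omega>. 1 + real (min (X j \<omega>) n)) = (\<Sum>i\<le>n. \<P>(\<omega> in M. i \<le> X j \<omega>))" for n
  proof -
    have "expectation (\<lambda>\<omega>. 1 + real (min (X j \<omega>) n)) = expectation (\<lambda>\<omega>. \<Sum>i\<le>n. indicator {\<omega> \<in> space M. i \<le> X j \<omega>} \<omega>)"
    proof (intro Bochner_Integration.integral_cong refl)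
      fix \<omega> assume "\<omega> \<in> space M"
      then have "(\<Sum>i\<le>n. indicator {\<omega> \<in> space M. i \<le> X j \<omega>} \<omega>) = (\<Sum>i\<le>n. if i \<in> {..X j \<omega>} then 1 else (0::real))"
        by (intro sum.cong) (auto simp: indicator_def)
      also have "\<dots> = real (card ({..n} \<inter> {..X j \<omega>}))" by (subst sum.inter_restrict[symmetric]) auto
      also have "{..n} \<inter> {..X j \<omega>} = {..min (X j \<omega>) n}" by auto
      finally show "1 + real (min (X j \<omega>) n) = (\<Sum>i\<le>n. indicator {\<omega> \<in> space M. i \<le> X j \<omega>} \<omega>)" by simp
    qed
    also have "\<dots> = (\<Sum>i\<le>n. \<P>(\<omega> in M. i \<le> X j \<omega>))"
      by (subst Bochner_Integration.integral_sum) (auto intro!: integrable_real_indicator simp: less_top[symmetric])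
    finally show ?thesis .
  qed
  ultimately have "(\<lambda>n. \<Sum>i\<le>n. \<P>(\<omega> in M. i \<le> X j \<omega>)) \<longlonglongrightarrow> expected_customers j" by simp
  from order_tendstoD(1)[OF this, of "expected_customers j - \<eta>"] assms show ?thesis
    by (auto elim!: eventually_mono)
qed

lemma tail_tendsto_0: "(F \<longlongrightarrow> 0) at_top"
proof (rule tendsto_sandwich[OF _ _ tendsto_const G.mult_tail_tendsto_0])
  show "\<forall>\<^sub>F x in at_top. F x \<le> x * F x"
    using eventually_ge_at_top[of 1]
  proof eventually_elim
    case (elim x)
    show ?case using mult_right_mono[OF elim G.tail_nonneg[of x]] by simp
  qed
qed (auto intro!: always_eventually G.tail_nonneg)

text \<open>
  Finitely many services (the first \<open>n + 1\<close> of each round) carry the means \<open>expected_customers\<close> up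
  to a small error.  By Bonferroni's inequality the probabilities that one of them is long add up, as
  two of them are long with probability \<open>O((F x)\<^sup>2)\<close> only.
\<close>

lemma prob_T_lower:
  assumes \<delta>: "0 < \<delta>" and \<eta>: "0 < \<eta>"
  shows "\<forall>\<^sub>F x in at_top. (\<Sum>j<k. expected_customers j * F ((1 + \<delta>) * x / stretch (k - Suc j))) - \<eta> * F x \<le> \<P>(\<omega> in M. x < T k \<omega>)"
proof -
  define y where "y j x = (1 + \<delta>) * x / stretch (k - Suc j)" for j x
  define \<kappa> where "\<kappa> = 1 / (1 + lam * backlog_bound)"
  have sM: "0 < 1 + lam * backlog_bound" using lam_pos backlog_bound_pos by (simp add: add_pos_pos)
  have \<kappa>: "0 < \<kappa>" using sM by (simp add: \<kappa>_def)
  obtain C where C: "1 \<le> C" "\<And>x. 0 \<le> x \<Longrightarrow> F (\<kappa> * x) \<le> C * F x" using G.tail_scale_le[OF \<kappa>] by blast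
  have Fy: "F (y j x) \<le> C * F x" "F (y j x) \<le> F (\<kappa> * x)" if x: "0 \<le> x" for j x
  proof -
    have "\<kappa> * x \<le> x / stretch (k - Suc j)"
      unfolding \<kappa>_def using x stretch_le[of "k - Suc j"] stretch_ge_1[of "k - Suc j"] by (auto intro!: divide_left_mono mult_pos_pos)
    also have "\<dots> \<le> y j x"
      unfolding y_def using x \<delta> stretch_ge_1[of "k - Suc j"] by (intro divide_right_mono) (auto simp: algebra_simps)
    finally show "F (y j x) \<le> F (\<kappa> * x)" by (rule G.tail_antimono)
    then show "F (y j x) \<le> C * F x" using C(2)[OF x] by simp
  qed
  define \<eta>1 where "\<eta>1 = \<eta> / (3 * C * (real k + 1))"
  have \<eta>1: "0 < \<eta>1" "real k * \<eta>1 * C \<le> \<eta> / 3"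
  proof -
    show "0 < \<eta>1" using \<eta> C by (simp add: \<eta>1_def)
    have "\<eta>1 * C = \<eta> / (3 * (real k + 1))" using C(1) by (simp add: \<eta>1_def)
    then have "real k * \<eta>1 * C = real k * (\<eta> / (3 * (real k + 1)))" by (simp only: mult.assoc)
    also have "\<dots> = (real k / (real k + 1)) * (\<eta> / 3)" by simp
    also have "\<dots> \<le> 1 * (\<eta> / 3)" using \<eta> by (intro mult_right_mono) auto
    finally show "real k * \<eta>1 * C \<le> \<eta> / 3" by simp
  qed
  have "\<forall>\<^sub>F n in sequentially. \<forall>j\<in>{..<k}. expected_customers j - \<eta>1 \<le> (\<Sum>i\<le>n. \<P>(\<omega> in M. i \<le> X j \<omega>))"
    by (intro eventually_ball_finite) (auto intro: expected_customers_approx[OF \<eta>1(1)])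
  then obtain n where n: "\<And>j. j < k \<Longrightarrow> expected_customers j - \<eta>1 \<le> (\<Sum>i\<le>n. \<P>(\<omega> in M. i \<le> X j \<omega>))"
    using eventually_happens'[OF sequentially_bot] by blast
  define I where "I = {..<k} \<times> {..n}"
  have finI: "finite I" by (simp add: I_def)
  define A where "A x s = {\<omega> \<in> space M. snd s \<le> X (fst s) \<omega> \<and> y (fst s) x < \<sigma> (Suc (fst s)) (snd s) \<omega>}" for x s
  have A_ev: "A x s \<in> events" for x s unfolding A_def by measurable
  have A_prob: "prob (A x (j, i)) = \<P>(\<omega> in M. i \<le> X j \<omega>) * F (y j x)" for x j i
  proof -
    have 1: "{\<omega> \<in> space M. i \<le> X j \<omega>} \<in> sets (alg (past j))"
    proof -
      note [measurable] = measurable_X_past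
      have "{\<omega> \<in> space (alg (past j)). i \<le> X j \<omega>} \<in> sets (alg (past j))" by measurable
      then show ?thesis by simp
    qed
    have "prob ({\<omega> \<in> space M. i \<le> X j \<omega>} \<inter> {\<omega> \<in> space M. y j x < \<sigma> (Suc j) i \<omega>})
        = \<P>(\<omega> in M. i \<le> X j \<omega>) * \<P>(\<omega> in M. y j x < \<sigma> (Suc j) i \<omega>)"
      by (rule indep_alg[OF _ past_sources _ 1 jump_event_service]) (auto simp: sources_def past_def arrivals_def)
    moreover have "A x (j, i) = {\<omega> \<in> space M. i \<le> X j \<omega>} \<inter> {\<omega> \<in> space M. y j x < \<sigma> (Suc j) i \<omega>}" by (auto simp: A_def)
    ultimately show ?thesis by (simp add: prob_service_gt)
  qed
  define R where "R x s = {\<omega> \<in> space M. snd s \<le> X (fst s) \<omega> \<and> (1 + \<delta>) * x / stretch (k - Suc (fst s)) < \<sigma> (Suc (fst s)) (snd s) \<omega> \<and> T k \<omega> \<le> x}" for x s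
  have R_ev: "R x s \<in> events" for x s unfolding R_def by measurable
  define \<eta>2 where "\<eta>2 = \<eta> / (3 * (real (card I) + 1))"
  have \<eta>2: "0 < \<eta>2" "real (card I) * \<eta>2 \<le> \<eta> / 3"
  proof -
    show "0 < \<eta>2" using \<eta> by (simp add: \<eta>2_def)
    have "real (card I) * \<eta>2 = (real (card I) / (real (card I) + 1)) * (\<eta> / 3)" by (simp add: \<eta>2_def field_simps)
    also have "\<dots> \<le> 1 * (\<eta> / 3)" using \<eta> by (intro mult_right_mono) auto
    finally show "real (card I) * \<eta>2 \<le> \<eta> / 3" by simp
  qed
  have evR: "\<forall>\<^sub>F x in at_top. \<forall>s\<in>I. prob (R x s) \<le> \<eta>2 * F x"
    unfolding R_def using \<delta> \<eta>2(1)
    by (intro eventually_ball_finite finI ballI jump_without_effect_negligible) (auto simp: I_def)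
  have evP: "\<forall>\<^sub>F x in at_top. (real (card I))\<^sup>2 * (C * C) * F x < \<eta> / 3"
  proof -
    have "((\<lambda>x. (real (card I))\<^sup>2 * (C * C) * F x) \<longlongrightarrow> (real (card I))\<^sup>2 * (C * C) * 0) at_top"
      by (intro tendsto_mult_left tail_tendsto_0)
    then show ?thesis using \<eta> by (intro order_tendstoD(2)) auto
  qed
  show ?thesis using evR evP eventually_ge_at_top[of 0]
  proof eventually_elim
    case (elim x)
    have Fx: "0 \<le> F x" by (rule G.tail_nonneg)
    have pair: "prob (A x s \<inter> A x s') \<le> (C * C * F x) * F x" if "s \<noteq> s'" for s s'
    proof -
      let ?B = "\<lambda>s. {\<omega> \<in> space M. y (fst s) x < \<sigma> (Suc (fst s)) (snd s) \<omega>}"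
      have "prob (A x s \<inter> A x s') \<le> prob (?B s \<inter> ?B s')" by (intro finite_measure_mono) (auto simp: A_def)
      also have "\<dots> = prob (?B s) * prob (?B s')"
        using that by (intro indep_alg[OF _ _ _ jump_event_service jump_event_service]) (auto simp: sources_def prod_eq_iff)
      also have "\<dots> \<le> (C * F x) * (C * F x)"
        unfolding prob_service_gt using C(1) elim(3) by (intro mult_mono Fy G.tail_nonneg) (auto intro: mult_nonneg_nonneg G.tail_nonneg)
      finally show ?thesis by (simp add: mult_ac)
    qed
    have "(\<Sum>s\<in>I. prob (A x s)) - (real (card I))\<^sup>2 * ((C * C * F x) * F x) \<le> prob (\<Union>s\<in>I. A x s)"
      using C(1) Fx by (intro bonferroni_lower finI A_ev pair) auto
    also have "prob (\<Union>s\<in>I. A x s) \<le> prob ({\<omega> \<in> space M. x < T k \<omega>} \<union> (\<Union>s\<in>I. R x s))"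
      using R_ev finI by (intro finite_measure_mono) (auto simp: A_def R_def y_def)
    also have "\<dots> \<le> \<P>(\<omega> in M. x < T k \<omega>) + prob (\<Union>s\<in>I. R x s)"
      using R_ev finI by (intro measure_Un_le) auto
    also have "prob (\<Union>s\<in>I. R x s) \<le> (\<Sum>s\<in>I. prob (R x s))"
      using R_ev by (intro finite_measure_subadditive_finite finI) auto
    also have "\<dots> \<le> (\<Sum>s\<in>I. \<eta>2 * F x)" using elim(1) by (intro sum_mono) auto
    also have "\<dots> = (real (card I) * \<eta>2) * F x" by simp
    also have "\<dots> \<le> \<eta> / 3 * F x" using \<eta>2(2) Fx by (rule mult_right_mono)
    finally have 1: "(\<Sum>s\<in>I. prob (A x s)) - (real (card I))\<^sup>2 * ((C * C * F x) * F x) \<le> \<P>(\<omega> in M. x < T k \<omega>) + \<eta> / 3 * F x"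
      by simp
    have 2: "(real (card I))\<^sup>2 * ((C * C * F x) * F x) \<le> \<eta> / 3 * F x"
      using mult_right_mono[OF less_imp_le[OF elim(2)] Fx] by (simp add: mult_ac)
    have "(\<Sum>s\<in>I. prob (A x s)) = (\<Sum>j<k. \<Sum>i\<le>n. \<P>(\<omega> in M. i \<le> X j \<omega>) * F (y j x))"
      unfolding I_def by (subst sum.cartesian_product') (simp add: A_prob split_beta)
    also have "\<dots> = (\<Sum>j<k. (\<Sum>i\<le>n. \<P>(\<omega> in M. i \<le> X j \<omega>)) * F (y j x))" by (simp add: sum_distrib_right)
    also have "\<dots> \<ge> (\<Sum>j<k. (expected_customers j - \<eta>1) * F (y j x))"
      by (intro sum_mono mult_right_mono n G.tail_nonneg) auto
    also have "(\<Sum>j<k. (expected_customers j - \<eta>1) * F (y j x))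
        = (\<Sum>j<k. expected_customers j * F (y j x)) - \<eta>1 * (\<Sum>j<k. F (y j x))"
      by (simp add: algebra_simps sum_subtractf sum_distrib_left)
    finally have 3: "(\<Sum>j<k. expected_customers j * F (y j x)) - \<eta>1 * (\<Sum>j<k. F (y j x)) \<le> (\<Sum>s\<in>I. prob (A x s))" .
    have "\<eta>1 * (\<Sum>j<k. F (y j x)) \<le> \<eta>1 * (\<Sum>j<k. C * F x)"
      using \<eta>1(1) elim(3) by (intro mult_left_mono sum_mono Fy) auto
    also have "\<dots> = (real k * \<eta>1 * C) * F x" by simp
    also have "\<dots> \<le> \<eta> / 3 * F x" using \<eta>1(2) Fx by (rule mult_right_mono)
    finally have 4: "\<eta>1 * (\<Sum>j<k. F (y j x)) \<le> \<eta> / 3 * F x" .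
    have "\<eta> * F x = \<eta> / 3 * F x + \<eta> / 3 * F x + \<eta> / 3 * F x" by simp
    then show ?case using 1 2 3 4 unfolding y_def by linarith
  qed
qed

end

section \<open>Geometric number of rounds\<close>

lemma summable_poly_geometric:
  assumes "0 < p" "p < (1::real)"
  shows "summable (\<lambda>k. p ^ k * (2 + real k) ^ m)"
proof -
  define \<theta> where "\<theta> = - ln p / 2"
  have \<theta>: "0 < \<theta>" using assms by (simp add: \<theta>_def)
  have p: "p = exp (- \<theta>) * exp (- \<theta>)"
    using assms by (simp add: exp_add[symmetric] \<theta>_def)
  have "summable (\<lambda>k. fact m * exp (2 * \<theta>) / \<theta> ^ m * exp (- \<theta>) ^ k)"
    using \<theta> by (intro summable_mult summable_geometric) auto
  then show ?thesis
  proof (rule summable_comparison_test'[where N = 0])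
    fix k
    have "(\<theta> * (2 + real k)) ^ m \<le> fact m * exp (\<theta> * (2 + real k))"
      using \<theta> by (intro power_le_fact_mult_exp) auto
    then have "(2 + real k) ^ m \<le> fact m * exp (\<theta> * (2 + real k)) / \<theta> ^ m"
      using \<theta> unfolding power_mult_distrib by (simp only: pos_le_divide_eq zero_less_power mult.commute)
    then have "p ^ k * (2 + real k) ^ m \<le> p ^ k * (fact m * exp (\<theta> * (2 + real k)) / \<theta> ^ m)"
      using assms by (intro mult_left_mono) auto
    also have "p ^ k * exp (\<theta> * (2 + real k)) = exp (2 * \<theta>) * exp (- \<theta>) ^ k"
      unfolding p by (simp add: exp_of_nat_mult[symmetric] exp_add[symmetric] algebra_simps)
    then have "p ^ k * (fact m * exp (\<theta> * (2 + real k)) / \<theta> ^ m) = fact m * exp (2 * \<theta>) / \<theta> ^ m * exp (- \<theta>) ^ k"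
      by (simp add: field_simps)
    finally show "norm (p ^ k * (2 + real k) ^ m) \<le> fact m * exp (2 * \<theta>) / \<theta> ^ m * exp (- \<theta>) ^ k"
      using assms by simp
  qed
qed

context stable_feedback_queue begin

definition jump_sum :: "nat \<Rightarrow> real \<Rightarrow> real" where
  "jump_sum k x = (\<Sum>j<k. expected_customers j * F (x / stretch (k - Suc j)))"

lemma tail_div_stretch_le:
  obtains C where "1 \<le> C" "\<And>x l. 0 \<le> x \<Longrightarrow> F (x / stretch l) \<le> C * F x"
proof -
  have sM: "0 < 1 + lam * backlog_bound" using lam_pos backlog_bound_pos by (simp add: add_pos_pos)
  then have "0 < 1 / (1 + lam * backlog_bound)" by simp
  then obtain C where C: "1 \<le> C" "\<And>x. 0 \<le> x \<Longrightarrow> F (1 / (1 + lam * backlog_bound) * x) \<le> C * F x"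
    using G.tail_scale_le by blast
  have "F (x / stretch l) \<le> C * F x" if x: "0 \<le> x" for x l
  proof -
    have "1 / (1 + lam * backlog_bound) * x \<le> x / stretch l"
      using x stretch_le[of l] stretch_ge_1[of l] by (auto intro!: divide_left_mono mult_pos_pos)
    then have "F (x / stretch l) \<le> F (1 / (1 + lam * backlog_bound) * x)" by (rule G.tail_antimono)
    also have "\<dots> \<le> C * F x" by (rule C(2)[OF x])
    finally show ?thesis .
  qed
  with C(1) that show ?thesis by blast
qed

lemma expected_customers_le:
  obtains C where "1 \<le> C" "\<And>j. expected_customers j \<le> C * (1 + real j)"
proof -
  obtain c where c: "0 \<le> c" "\<And>k. expectation (\<lambda>\<omega>. real (X k \<omega>)) \<le> c * (1 + real k)"
    using expectation_X_le by metis
  have "expected_customers j \<le> (1 + c) * (1 + real j)" for j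
    using c(2)[of j] by (simp add: expected_customers_def algebra_simps)
  moreover have "1 \<le> 1 + c" using c(1) by simp
  ultimately show ?thesis using that by blast
qed

lemma jump_sum_nonneg: "0 \<le> jump_sum k x"
  unfolding jump_sum_def using expected_customers_ge_1
  by (intro sum_nonneg mult_nonneg_nonneg G.tail_nonneg) (auto intro: order_trans[of 0 1])

lemma jump_sum_le:
  obtains C where "1 \<le> C" "\<And>k x. 0 \<le> x \<Longrightarrow> jump_sum k x \<le> C * (1 + real k)\<^sup>2 * F x"
proof -
  obtain C1 where C1: "1 \<le> C1" "\<And>x l. 0 \<le> x \<Longrightarrow> F (x / stretch l) \<le> C1 * F x" using tail_div_stretch_le by blast
  obtain C2 where C2: "1 \<le> C2" "\<And>j. expected_customers j \<le> C2 * (1 + real j)" using expected_customers_le by blast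
  have "jump_sum k x \<le> C2 * C1 * (1 + real k)\<^sup>2 * F x" if x: "0 \<le> x" for k x
  proof -
    have "jump_sum k x \<le> (\<Sum>j<k. (C2 * (1 + real k)) * (C1 * F x))"
      unfolding jump_sum_def
    proof (intro sum_mono mult_mono C1(2) x G.tail_nonneg)
      fix j assume "j \<in> {..<k}"
      then have "C2 * (1 + real j) \<le> C2 * (1 + real k)" using C2(1) by (intro mult_left_mono) auto
      with C2(2)[of j] show "expected_customers j \<le> C2 * (1 + real k)" by linarith
    qed (use C2(1) in auto)
    also have "\<dots> = (C2 * C1 * (1 + real k) * F x) * real k" by simp
    also have "\<dots> \<le> (C2 * C1 * (1 + real k) * F x) * (1 + real k)"
      using C1(1) C2(1) G.tail_nonneg by (intro mult_left_mono) auto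
    finally show ?thesis by (simp add: power2_eq_square mult_ac)
  qed
  moreover have "1 \<le> C2 * C1" using C1 C2 by (intro mult_ge1_I)
  ultimately show ?thesis using that by blast
qed

text \<open>
  The bounds with arguments \<open>(1 - \<delta>) x\<close> and \<open>(1 + \<delta>) x\<close> merge because of intermediate regular
  variation; here it is used with constants arbitrarily close to \<open>1\<close>.
\<close>

lemma prob_T_asymp:
  "((\<lambda>x. (\<P>(\<omega> in M. x < T k \<omega>) - jump_sum k x) / F x) \<longlongrightarrow> 0) at_top"
proof (rule tendstoI)
  fix e :: real assume e: "0 < e"
  obtain C where C: "1 \<le> C" "\<And>k x. 0 \<le> x \<Longrightarrow> jump_sum k x \<le> C * (1 + real k)\<^sup>2 * F x"
    using jump_sum_le by blast
  define Ck where "Ck = C * (1 + real k)\<^sup>2"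
  have Ck: "0 < Ck" using C(1) by (simp add: Ck_def)
  define \<eta> where "\<eta> = e / (4 * Ck)"
  have \<eta>: "0 < \<eta>" "\<eta> * Ck = e / 4" using e Ck by (auto simp: \<eta>_def)
  have e4: "0 < e / 4" using e by simp
  have lim: "filterlim (\<lambda>x. x / stretch l) at_top at_top" for l
  proof -
    have "filterlim (\<lambda>x. x * (1 / stretch l)) at_top at_top"
      using stretch_ge_1[of l] by (intro filterlim_at_top_mult_tendsto_pos[OF tendsto_const _ filterlim_ident]) auto
    then show ?thesis by simp
  qed
  obtain \<delta> where \<delta>: "0 < \<delta>" "\<delta> < 1/2" "\<forall>\<^sub>F x in at_top. F ((1 - \<delta>) * x) \<le> (1 + \<eta>) * F x"
    using G.tail_shrink_le[OF \<eta>(1)] by blast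
  obtain \<alpha> where \<alpha>: "1 < \<alpha>" "\<forall>\<^sub>F x in at_top. (1 - \<eta>) * F x \<le> F (\<alpha> * x)"
    using G.tail_stretch_ge[OF \<eta>(1)] by blast
  have up: "\<forall>\<^sub>F x in at_top. \<forall>j\<in>{..<k}. F ((1 - \<delta>) * (x / stretch (k - Suc j))) \<le> (1 + \<eta>) * F (x / stretch (k - Suc j))"
    by (intro eventually_ball_finite ballI eventually_compose_filterlim[OF \<delta>(3) lim]) auto
  have lo: "\<forall>\<^sub>F x in at_top. \<forall>j\<in>{..<k}. (1 - \<eta>) * F (x / stretch (k - Suc j)) \<le> F (\<alpha> * (x / stretch (k - Suc j)))"
    by (intro eventually_ball_finite ballI eventually_compose_filterlim[OF \<alpha>(2) lim]) auto
  have "\<delta> < 1" using \<delta> by simp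
  note U = prob_T_upper[OF \<delta>(1) this e4, of k]
  have "0 < \<alpha> - 1" using \<alpha> by simp
  note L = prob_T_lower[OF this e4, of k]
  show "\<forall>\<^sub>F x in at_top. dist ((\<P>(\<omega> in M. x < T k \<omega>) - jump_sum k x) / F x) 0 < e"
    using up lo U L eventually_ge_at_top[of 0]
  proof eventually_elim
    case (elim x)
    have Fx: "0 < F x" by (rule G.tail_pos)
    have ep: "0 \<le> expected_customers j" for j using expected_customers_ge_1[of j] by simp
    have small: "\<eta> * jump_sum k x \<le> e / 4 * F x"
    proof -
      have "\<eta> * jump_sum k x \<le> \<eta> * (Ck * F x)" using C(2)[OF elim(5)] \<eta>(1) by (intro mult_left_mono) (auto simp: Ck_def)
      also have "\<dots> = e / 4 * F x" using \<eta>(2) by (simp add: mult.assoc[symmetric])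
      finally show ?thesis .
    qed
    have "(\<Sum>j<k. expected_customers j * F ((1 - \<delta>) * x / stretch (k - Suc j))) \<le> (\<Sum>j<k. expected_customers j * ((1 + \<eta>) * F (x / stretch (k - Suc j))))"
      using elim(1) ep by (intro sum_mono mult_left_mono) auto
    also have "\<dots> = (1 + \<eta>) * jump_sum k x" by (simp add: jump_sum_def sum_distrib_left mult_ac)
    finally have u: "\<P>(\<omega> in M. x < T k \<omega>) - jump_sum k x \<le> e / 2 * F x"
      using elim(3) small by (simp add: algebra_simps)
    have "(1 - \<eta>) * jump_sum k x = (\<Sum>j<k. expected_customers j * ((1 - \<eta>) * F (x / stretch (k - Suc j))))"
      by (simp add: jump_sum_def sum_distrib_left mult_ac)
    also have "\<dots> \<le> (\<Sum>j<k. expected_customers j * F ((1 + (\<alpha> - 1)) * x / stretch (k - Suc j)))"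
      using elim(2) ep by (intro sum_mono mult_left_mono) auto
    finally have l: "- (e / 2 * F x) \<le> \<P>(\<omega> in M. x < T k \<omega>) - jump_sum k x"
      using elim(4) small by (simp add: algebra_simps)
    have "\<bar>\<P>(\<omega> in M. x < T k \<omega>) - jump_sum k x\<bar> \<le> e / 2 * F x" using u l by linarith
    also have "\<dots> < e * F x" using e Fx by simp
    finally show ?case using Fx by (simp add: dist_real_def abs_divide pos_divide_less_eq)
  qed
qed

lemma AE_K_pos: "AE \<omega> in M. 1 \<le> K \<omega>"
proof -
  have "(\<Sum>k. \<P>(\<omega> in M. K \<omega> = Suc k)) = (\<Sum>k. (1 - p) * p ^ k)" by (simp add: K_distribution)
  also have "\<dots> = 1" using p_pos p_less_1 by (subst suminf_mult) (auto simp: suminf_geometric intro!: summable_geometric)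
  finally have "(\<Sum>k. \<P>(\<omega> in M. K \<omega> = Suc k)) = 1" .
  moreover have "(\<lambda>k. \<P>(\<omega> in M. K \<omega> = Suc k)) sums prob (\<Union>k. {\<omega> \<in> space M. K \<omega> = Suc k})"
    by (intro finite_measure_UNION) (auto simp: disjoint_family_on_def)
  ultimately have "prob (\<Union>k. {\<omega> \<in> space M. K \<omega> = Suc k}) = 1" by (simp add: sums_unique[symmetric])
  then have "AE \<omega> in M. \<omega> \<in> (\<Union>k. {\<omega> \<in> space M. K \<omega> = Suc k})"
    by (subst (asm) prob_eq_1) auto
  then show ?thesis by eventually_elim auto
qed

lemma K_event_alg: "{\<omega> \<in> space M. K \<omega> = k} \<in> sets (alg {Services_of_tagged})"
proof -
  have [measurable]: "K \<in> measurable (alg {Services_of_tagged}) (count_space UNIV)"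
    by (rule measurable_alg_tagged) simp
  have "{\<omega> \<in> space (alg {Services_of_tagged}). K \<omega> = k} \<in> sets (alg {Services_of_tagged})" by measurable
  then show ?thesis by simp
qed

text \<open>
  Total probability over the values of \<open>K\<close>; the event that \<open>K\<close> vanishes, for which no law is
  prescribed, is null since the geometric weights add up to \<open>1\<close>.
\<close>

lemma prob_mix_K:
  assumes ev: "\<And>k. {\<omega> \<in> space M. P (Suc k) \<omega>} \<in> events"
    and ind: "\<And>k. prob ({\<omega> \<in> space M. K \<omega> = Suc k} \<inter> {\<omega> \<in> space M. P (Suc k) \<omega>})
      = \<P>(\<omega> in M. K \<omega> = Suc k) * \<P>(\<omega> in M. P (Suc k) \<omega>)"
    and PK: "{\<omega> \<in> space M. P (K \<omega>) \<omega>} \<in> events"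
  shows "(\<lambda>k. (1 - p) * p ^ k * \<P>(\<omega> in M. P (Suc k) \<omega>)) sums \<P>(\<omega> in M. P (K \<omega>) \<omega>)"
proof -
  let ?A = "\<lambda>k. {\<omega> \<in> space M. K \<omega> = Suc k} \<inter> {\<omega> \<in> space M. P (Suc k) \<omega>}"
  have A: "?A k \<in> events" for k using ev[of k] by (intro sets.Int) auto
  have "(\<lambda>k. prob (?A k)) sums prob (\<Union>k. ?A k)"
    using A by (intro finite_measure_UNION) (auto simp: disjoint_family_on_def)
  moreover have "prob (\<Union>k. ?A k) = \<P>(\<omega> in M. P (K \<omega>) \<omega>)"
  proof (rule finite_measure_eq_AE)
    show "AE \<omega> in M. \<omega> \<in> (\<Union>k. ?A k) \<longleftrightarrow> \<omega> \<in> {\<omega> \<in> space M. P (K \<omega>) \<omega>}"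
      using AE_K_pos
    proof eventually_elim
      case (elim \<omega>)
      then obtain k where "K \<omega> = Suc k" by (cases "K \<omega>") auto
      then show ?case by auto
    qed
  qed (use A PK in auto)
  moreover have "prob (?A k) = (1 - p) * p ^ k * \<P>(\<omega> in M. P (Suc k) \<omega>)" for k
    by (simp add: ind K_distribution)
  ultimately show ?thesis by simp
qed

lemma prob_sojourn_sums:
  "(\<lambda>k. (1 - p) * p ^ k * \<P>(\<omega> in M. x < T (Suc k) \<omega>)) sums \<P>(\<omega> in M. x < T (K \<omega>) \<omega>)"
proof (rule prob_mix_K[where P = "\<lambda>k \<omega>. x < T k \<omega>"])
  show "{\<omega> \<in> space M. x < T (Suc k) \<omega>} \<in> events" for k by measurable
  have "(\<lambda>\<omega>. T (K \<omega>) \<omega>) \<in> borel_measurable M"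
    by (rule measurable_compose_countable[where g = K]) measurable
  then show "{\<omega> \<in> space M. x < T (K \<omega>) \<omega>} \<in> events" by measurable
  fix k
  note [measurable] = measurable_T_past
  have "{\<omega> \<in> space (alg (past (Suc k))). x < T (Suc k) \<omega>} \<in> sets (alg (past (Suc k)))" by measurable
  then have "{\<omega> \<in> space M. x < T (Suc k) \<omega>} \<in> sets (alg (past (Suc k)))" by (simp only: space_alg)
  then show "prob ({\<omega> \<in> space M. K \<omega> = Suc k} \<inter> {\<omega> \<in> space M. x < T (Suc k) \<omega>})
      = \<P>(\<omega> in M. K \<omega> = Suc k) * \<P>(\<omega> in M. x < T (Suc k) \<omega>)"
    by (intro indep_alg[OF _ _ past_sources K_event_alg]) (auto simp: sources_def past_def arrivals_def)
qed

lemma expectation_customers_sums: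
  "(\<lambda>k. (1 - p) * p ^ k * expected_customers k) sums (\<integral>\<omega>. 1 + real (X (K \<omega> - 1) \<omega>) \<partial>M)"
proof -
  obtain C where C: "1 \<le> C" "\<And>j. expected_customers j \<le> C * (1 + real j)" using expected_customers_le by blast
  have ec0: "0 \<le> expected_customers k" for k using expected_customers_ge_1[of k] by simp
  have sm: "summable (\<lambda>k. (1 - p) * p ^ k * expected_customers k)"
  proof (rule summable_comparison_test'[where N = 0])
    show "summable (\<lambda>k. C * (p ^ k * (2 + real k) ^ 1))"
      using p_pos p_less_1 by (intro summable_mult summable_poly_geometric)
    fix k
    have "(1 - p) * p ^ k * expected_customers k \<le> 1 * p ^ k * (C * (2 + real k))"
    proof (intro mult_mono)
      show "expected_customers k \<le> C * (2 + real k)"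
        using C(2)[of k] mult_left_mono[of "1 + real k" "2 + real k" C] C(1) by linarith
    qed (use p_pos p_less_1 ec0 in auto)
    then show "norm ((1 - p) * p ^ k * expected_customers k) \<le> C * (p ^ k * (2 + real k) ^ 1)"
      using p_pos p_less_1 ec0[of k] by (simp add: mult_ac)
  qed
  have [measurable]: "(\<lambda>\<omega>. X (K \<omega> - 1) \<omega>) \<in> measurable M (count_space UNIV)"
    by (rule measurable_compose_countable[where g = K]) measurable
  have "(\<integral>\<^sup>+\<omega>. ennreal (1 + real (X (K \<omega> - 1) \<omega>)) \<partial>M)
      = (\<integral>\<^sup>+\<omega>. (\<Sum>k. indicator {\<omega> \<in> space M. K \<omega> = Suc k} \<omega> * ennreal (1 + real (X k \<omega>))) \<partial>M)"
  proof (rule nn_integral_cong_AE)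
    show "AE \<omega> in M. ennreal (1 + real (X (K \<omega> - 1) \<omega>)) = (\<Sum>k. indicator {\<omega> \<in> space M. K \<omega> = Suc k} \<omega> * ennreal (1 + real (X k \<omega>)))"
      using AE_K_pos AE_space
    proof eventually_elim
      case (elim \<omega>)
      then obtain k where k: "K \<omega> = Suc k" by (cases "K \<omega>") auto
      have "(\<Sum>k. indicator {\<omega> \<in> space M. K \<omega> = Suc k} \<omega> * ennreal (1 + real (X k \<omega>)))
          = (\<Sum>k\<in>{k}. indicator {\<omega> \<in> space M. K \<omega> = Suc k} \<omega> * ennreal (1 + real (X k \<omega>)))"
        using k by (intro suminf_finite) auto
      then show ?case using k elim by simp
    qed
  qed
  also have "\<dots> = (\<Sum>k. \<integral>\<^sup>+\<omega>. indicator {\<omega> \<in> space M. K \<omega> = Suc k} \<omega> * ennreal (1 + real (X k \<omega>)) \<partial>M)"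
    by (intro nn_integral_suminf) measurable
  also have "\<dots> = (\<Sum>k. ennreal ((1 - p) * p ^ k * expected_customers k))"
  proof (rule suminf_cong)
    fix k
    note [measurable] = measurable_X_past
    have "(\<lambda>\<omega>. ennreal (1 + real (X k \<omega>))) \<in> borel_measurable (alg (past k))" by measurable
    then have "(\<integral>\<^sup>+\<omega>. indicator {\<omega> \<in> space M. K \<omega> = Suc k} \<omega> * ennreal (1 + real (X k \<omega>)) \<partial>M)
        = emeasure M {\<omega> \<in> space M. K \<omega> = Suc k} * (\<integral>\<^sup>+\<omega>. ennreal (1 + real (X k \<omega>)) \<partial>M)"
      by (intro nn_integral_indicator_alg[OF _ _ past_sources K_event_alg]) (auto simp: sources_def past_def arrivals_def)
    also have "(\<integral>\<^sup>+\<omega>. ennreal (1 + real (X k \<omega>)) \<partial>M) = ennreal (\<integral>\<omega>. 1 + real (X k \<omega>) \<partial>M)"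
      by (intro nn_integral_eq_integral) auto
    also have "(\<integral>\<omega>. 1 + real (X k \<omega>) \<partial>M) = expected_customers k"
      by (simp add: expected_customers_def prob_space)
    also have "emeasure M {\<omega> \<in> space M. K \<omega> = Suc k} = ennreal ((1 - p) * p ^ k)"
      by (simp add: emeasure_eq_measure K_distribution)
    finally show "(\<integral>\<^sup>+\<omega>. indicator {\<omega> \<in> space M. K \<omega> = Suc k} \<omega> * ennreal (1 + real (X k \<omega>)) \<partial>M)
        = ennreal ((1 - p) * p ^ k * expected_customers k)"
      using p_pos p_less_1 ec0 by (simp add: ennreal_mult'')
  qed
  also have "\<dots> = ennreal (\<Sum>k. (1 - p) * p ^ k * expected_customers k)"
    using p_pos p_less_1 ec0 sm by (intro suminf_ennreal2) auto
  finally have "(\<integral>\<omega>. 1 + real (X (K \<omega> - 1) \<omega>) \<partial>M) = (\<Sum>k. (1 - p) * p ^ k * expected_customers k)"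
  proof (subst integral_eq_nn_integral)
    have "0 \<le> (\<Sum>k. (1 - p) * p ^ k * expected_customers k)"
      using p_pos p_less_1 ec0 by (intro suminf_nonneg sm) auto
    then show "enn2real (\<integral>\<^sup>+\<omega>. ennreal (1 + real (X (K \<omega> - 1) \<omega>)) \<partial>M) = (\<Sum>k. (1 - p) * p ^ k * expected_customers k)"
      if "(\<integral>\<^sup>+\<omega>. ennreal (1 + real (X (K \<omega> - 1) \<omega>)) \<partial>M) = ennreal (\<Sum>k. (1 - p) * p ^ k * expected_customers k)"
      unfolding that by simp
  qed auto
  then show ?thesis using sm by (simp add: summable_sums)
qed

lemma prob_scaled_service_sums:
  assumes s0: "\<sigma>\<^sub>0 \<in> borel_measurable M" "distr M borel \<sigma>\<^sub>0 = G"
    and ind: "indep_var borel \<sigma>\<^sub>0 borel (\<lambda>\<omega>. real (K \<omega>))"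
  shows "(\<lambda>k. (1 - p) * p ^ k * F (x / stretch k)) sums \<P>(\<omega> in M. x < stretch (K \<omega> - 1) * \<sigma>\<^sub>0 \<omega>)"
proof -
  note [measurable] = s0(1)
  have F: "\<P>(\<omega> in M. y < \<sigma>\<^sub>0 \<omega>) = F y" for y
  proof -
    have "F y = measure (distr M borel \<sigma>\<^sub>0) {y<..}" by (simp add: s0(2) G.tail_eq)
    also have "\<dots> = \<P>(\<omega> in M. y < \<sigma>\<^sub>0 \<omega>)"
      by (subst measure_distr) (auto intro!: arg_cong[where f = prob])
    finally show ?thesis by simp
  qed
  have eq: "{\<omega> \<in> space M. x < stretch k * \<sigma>\<^sub>0 \<omega>} = {\<omega> \<in> space M. x / stretch k < \<sigma>\<^sub>0 \<omega>}" for k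
    using stretch_ge_1[of k] by (auto simp: field_simps)
  have "(\<lambda>k. (1 - p) * p ^ k * \<P>(\<omega> in M. x < stretch (Suc k - 1) * \<sigma>\<^sub>0 \<omega>)) sums \<P>(\<omega> in M. x < stretch (K \<omega> - 1) * \<sigma>\<^sub>0 \<omega>)"
  proof (rule prob_mix_K[where P = "\<lambda>k \<omega>. x < stretch (k - 1) * \<sigma>\<^sub>0 \<omega>"])
    show "{\<omega> \<in> space M. x < stretch (Suc k - 1) * \<sigma>\<^sub>0 \<omega>} \<in> events" for k by measurable
    have "(\<lambda>\<omega>. stretch (K \<omega> - 1) * \<sigma>\<^sub>0 \<omega>) \<in> borel_measurable M"
      by (rule measurable_compose_countable[where g = K]) measurable
    then show "{\<omega> \<in> space M. x < stretch (K \<omega> - 1) * \<sigma>\<^sub>0 \<omega>} \<in> events" by measurable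
    fix k
    from ind have "indep_set (sigma_sets (space M) {\<sigma>\<^sub>0 -` A \<inter> space M |A. A \<in> sets borel})
        (sigma_sets (space M) {(\<lambda>\<omega>. real (K \<omega>)) -` A \<inter> space M |A. A \<in> sets borel})"
      by (simp add: indep_var_eq)
    moreover have "{\<omega> \<in> space M. x < stretch (Suc k - 1) * \<sigma>\<^sub>0 \<omega>} \<in> sigma_sets (space M) {\<sigma>\<^sub>0 -` A \<inter> space M |A. A \<in> sets borel}"
    proof (rule sigma_sets.Basic, safe)
      show "\<exists>A. {\<omega> \<in> space M. x < stretch (Suc k - 1) * \<sigma>\<^sub>0 \<omega>} = \<sigma>\<^sub>0 -` A \<inter> space M \<and> A \<in> sets borel"
        by (intro exI[of _ "{y. x < stretch (Suc k - 1) * y}"]) auto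
    qed
    moreover have "{\<omega> \<in> space M. K \<omega> = Suc k} \<in> sigma_sets (space M) {(\<lambda>\<omega>. real (K \<omega>)) -` A \<inter> space M |A. A \<in> sets borel}"
    proof (rule sigma_sets.Basic, safe)
      show "\<exists>A. {\<omega> \<in> space M. K \<omega> = Suc k} = (\<lambda>\<omega>. real (K \<omega>)) -` A \<inter> space M \<and> A \<in> sets borel"
        by (intro exI[of _ "{real (Suc k)}"]) auto
    qed
    ultimately have "prob ({\<omega> \<in> space M. x < stretch (Suc k - 1) * \<sigma>\<^sub>0 \<omega>} \<inter> {\<omega> \<in> space M. K \<omega> = Suc k})
        = \<P>(\<omega> in M. x < stretch (Suc k - 1) * \<sigma>\<^sub>0 \<omega>) * \<P>(\<omega> in M. K \<omega> = Suc k)"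
      by (rule indep_setD)
    then show "prob ({\<omega> \<in> space M. K \<omega> = Suc k} \<inter> {\<omega> \<in> space M. x < stretch (Suc k - 1) * \<sigma>\<^sub>0 \<omega>})
        = \<P>(\<omega> in M. K \<omega> = Suc k) * \<P>(\<omega> in M. x < stretch (Suc k - 1) * \<sigma>\<^sub>0 \<omega>)"
      by (simp only: Int_commute mult.commute)
  qed
  then show ?thesis by (simp add: eq F)
qed

text \<open>
  Splitting \<open>p ^ k\<close> into \<open>p ^ i * p ^ (k - i)\<close> exhibits the sum over \<open>k\<close> as a Cauchy product; each of its
  factors needs its own normalisation \<open>1 - p\<close>, only one of which is available.
\<close>

lemma jump_sum_mixture:
  assumes s: "(\<lambda>k. (1 - p) * p ^ k * expected_customers k) sums E"
    and t: "(\<lambda>k. (1 - p) * p ^ k * F (x / stretch k)) sums P"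
  shows "(\<lambda>k. (1 - p) * p ^ k * jump_sum (Suc k) x) sums (1 / (1 - p) * E * P)"
proof -
  have q: "0 < 1 - p" using p_less_1 by simp
  define u where "u i = (1 - p) * p ^ i * expected_customers i" for i
  define v where "v l = (1 - p) * p ^ l * F (x / stretch l)" for l
  have u0: "0 \<le> u i" for i using p_pos q expected_customers_ge_1[of i] by (simp add: u_def)
  have v0: "0 \<le> v i" for i using p_pos q G.tail_nonneg by (simp add: v_def)
  have su: "summable (\<lambda>i. norm (u i))" and sv: "summable (\<lambda>i. norm (v i))"
    using s t u0 v0 by (auto simp: sums_iff u_def[symmetric] v_def[symmetric])
  have "(\<lambda>k. \<Sum>i\<le>k. u i * v (k - i)) sums ((\<Sum>k. u k) * (\<Sum>k. v k))"
    by (rule Cauchy_product_sums[OF su sv])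
  also have "(\<Sum>k. u k) * (\<Sum>k. v k) = E * P"
    using s t by (simp add: sums_iff u_def v_def)
  finally have "(\<lambda>k. 1 / (1 - p) * (\<Sum>i\<le>k. u i * v (k - i))) sums (1 / (1 - p) * (E * P))"
    by (rule sums_mult)
  moreover have "1 / (1 - p) * (\<Sum>i\<le>k. u i * v (k - i)) = (1 - p) * p ^ k * jump_sum (Suc k) x" for k
  proof -
    have "(\<Sum>i\<le>k. u i * v (k - i)) = (\<Sum>i\<le>k. (1 - p) * ((1 - p) * p ^ k * (expected_customers i * F (x / stretch (k - i)))))"
    proof (rule sum.cong[OF refl])
      fix i assume "i \<in> {..k}"
      then have pk: "p ^ i * p ^ (k - i) = p ^ k" by (simp add: power_add[symmetric])
      have "u i * v (k - i) = (1 - p) * ((1 - p) * (p ^ i * p ^ (k - i)) * (expected_customers i * F (x / stretch (k - i))))"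
        by (simp add: u_def v_def mult_ac)
      then show "u i * v (k - i) = (1 - p) * ((1 - p) * p ^ k * (expected_customers i * F (x / stretch (k - i))))"
        unfolding pk .
    qed
    also have "\<dots> = (1 - p) * ((1 - p) * p ^ k * jump_sum (Suc k) x)"
      by (simp only: jump_sum_def lessThan_Suc_atMost sum_distrib_left diff_Suc_Suc)
    finally show ?thesis using q by simp
  qed
  ultimately show ?thesis by (simp only: mult.assoc)
qed

text \<open>
  Tannery's theorem; the polynomial bounds for a fixed number of rounds against the geometric
  weights provide the summable majorant.
\<close>

lemma sojourn_minus_mixture_negligible:
  "((\<lambda>x. (\<Sum>k. (1 - p) * p ^ k * ((\<P>(\<omega> in M. x < T (Suc k) \<omega>) - jump_sum (Suc k) x) / F x))) \<longlongrightarrow> 0) at_top"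
proof -
  obtain C1 d where C1: "1 \<le> C1" "\<And>k x. 0 \<le> x \<Longrightarrow> \<P>(\<omega> in M. x < T k \<omega>) \<le> C1 * (1 + real k) ^ d * F x"
    using prob_T_gt_le by metis
  obtain C2 where C2: "1 \<le> C2" "\<And>k x. 0 \<le> x \<Longrightarrow> jump_sum k x \<le> C2 * (1 + real k)\<^sup>2 * F x"
    using jump_sum_le by blast
  let ?M = "\<lambda>k. (C1 + C2) * (p ^ k * (2 + real k) ^ (d + 2))"
  have bound: "norm ((1 - p) * p ^ k * ((\<P>(\<omega> in M. x < T (Suc k) \<omega>) - jump_sum (Suc k) x) / F x)) \<le> ?M k"
    if x: "0 \<le> x" for k x
  proof -
    have Fx: "0 < F x" by (rule G.tail_pos)
    have k: "1 \<le> 2 + real k" by simp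
    have "\<P>(\<omega> in M. x < T (Suc k) \<omega>) \<le> C1 * (2 + real k) ^ d * F x"
      using C1(2)[OF x, of "Suc k"] by simp
    also have "\<dots> \<le> C1 * (2 + real k) ^ (d + 2) * F x"
      using C1(1) Fx k by (intro mult_right_mono mult_left_mono power_increasing) auto
    finally have 1: "\<P>(\<omega> in M. x < T (Suc k) \<omega>) \<le> C1 * (2 + real k) ^ (d + 2) * F x" .
    have "jump_sum (Suc k) x \<le> C2 * (2 + real k)\<^sup>2 * F x"
      using C2(2)[OF x, of "Suc k"] by simp
    also have "\<dots> \<le> C2 * (2 + real k) ^ (d + 2) * F x"
      using C2(1) Fx k by (intro mult_right_mono mult_left_mono power_increasing) auto
    finally have 2: "jump_sum (Suc k) x \<le> C2 * (2 + real k) ^ (d + 2) * F x" .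
    have "\<bar>\<P>(\<omega> in M. x < T (Suc k) \<omega>) - jump_sum (Suc k) x\<bar> \<le> \<P>(\<omega> in M. x < T (Suc k) \<omega>) + jump_sum (Suc k) x"
      using jump_sum_nonneg[of "Suc k" x] measure_nonneg[of M "{\<omega> \<in> space M. x < T (Suc k) \<omega>}"] by linarith
    also have "\<dots> \<le> (C1 + C2) * (2 + real k) ^ (d + 2) * F x" using 1 2 by (simp only: distrib_right)
    finally have 3: "\<bar>\<P>(\<omega> in M. x < T (Suc k) \<omega>) - jump_sum (Suc k) x\<bar> / F x \<le> (C1 + C2) * (2 + real k) ^ (d + 2)"
      using Fx by (simp only: pos_divide_le_eq)
    have "norm ((1 - p) * p ^ k * ((\<P>(\<omega> in M. x < T (Suc k) \<omega>) - jump_sum (Suc k) x) / F x))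
        = (1 - p) * p ^ k * (\<bar>\<P>(\<omega> in M. x < T (Suc k) \<omega>) - jump_sum (Suc k) x\<bar> / F x)"
      using p_pos p_less_1 Fx by (simp add: abs_mult abs_divide)
    also have "\<dots> \<le> 1 * p ^ k * ((C1 + C2) * (2 + real k) ^ (d + 2))"
      using p_pos p_less_1 3 Fx by (intro mult_mono) auto
    finally show ?thesis by (simp only: mult_ac mult_1)
  qed
  have "((\<lambda>x. \<Sum>k. (1 - p) * p ^ k * ((\<P>(\<omega> in M. x < T (Suc k) \<omega>) - jump_sum (Suc k) x) / F x)) \<longlongrightarrow> (\<Sum>k. 0)) at_top"
  proof (rule tannerys_theorem[where M = ?M, THEN conjunct2, THEN conjunct2])
    show "((\<lambda>x. (1 - p) * p ^ k * ((\<P>(\<omega> in M. x < T (Suc k) \<omega>) - jump_sum (Suc k) x) / F x)) \<longlongrightarrow> 0) at_top" for k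
      using tendsto_mult_left[OF prob_T_asymp[of "Suc k"], of "(1 - p) * p ^ k"] by simp
    have "\<forall>\<^sub>F x in (at_top :: real filter). 0 \<le> x" by (rule eventually_ge_at_top)
    then have "\<forall>\<^sub>F (k :: nat, x) in at_top \<times>\<^sub>F at_top. (0::real) \<le> x"
      by (rule eventually_prod2[OF sequentially_bot, THEN iffD2])
    then show "\<forall>\<^sub>F (k, x) in at_top \<times>\<^sub>F at_top.
        norm ((1 - p) * p ^ k * ((\<P>(\<omega> in M. x < T (Suc k) \<omega>) - jump_sum (Suc k) x) / F x)) \<le> ?M k"
      by (rule eventually_mono) (use bound in auto)
    show "summable ?M" using p_pos p_less_1 by (intro summable_mult summable_poly_geometric)
  qed simp
  then show ?thesis by simp
qed

text \<open>
  The difference of the two sides is \<open>o (F x)\<close>, and the right-hand side is at least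
  \<open>(1 - p) * F x\<close> because of its term with a single round.
\<close>

lemma sojourn_tail_asymp:
  assumes s0: "\<sigma>\<^sub>0 \<in> borel_measurable M" "distr M borel \<sigma>\<^sub>0 = G"
    and ind: "indep_var borel \<sigma>\<^sub>0 borel (\<lambda>\<omega>. real (K \<omega>))"
  shows "(\<lambda>x. \<P>(\<omega> in M. x < T (K \<omega>) \<omega>)) \<sim>[at_top]
    (\<lambda>x. 1 / (1 - p) * (\<integral>\<omega>. 1 + real (X (K \<omega> - 1) \<omega>) \<partial>M) * \<P>(\<omega> in M. x < stretch (K \<omega> - 1) * \<sigma>\<^sub>0 \<omega>))"
proof -
  define A where "A x = 1 / (1 - p) * (\<integral>\<omega>. 1 + real (X (K \<omega> - 1) \<omega>) \<partial>M) * \<P>(\<omega> in M. x < stretch (K \<omega> - 1) * \<sigma>\<^sub>0 \<omega>)" for x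
  define P where "P x = \<P>(\<omega> in M. x < T (K \<omega>) \<omega>)" for x
  define D where "D x = (\<Sum>k. (1 - p) * p ^ k * ((\<P>(\<omega> in M. x < T (Suc k) \<omega>) - jump_sum (Suc k) x) / F x))" for x
  have q: "0 < 1 - p" using p_less_1 by simp
  have A_sums: "(\<lambda>k. (1 - p) * p ^ k * jump_sum (Suc k) x) sums A x" for x
    unfolding A_def
    by (rule jump_sum_mixture[OF expectation_customers_sums prob_scaled_service_sums[OF s0 ind]])
  have P_sums: "(\<lambda>k. (1 - p) * p ^ k * \<P>(\<omega> in M. x < T (Suc k) \<omega>)) sums P x" for x
    unfolding P_def by (rule prob_sojourn_sums)
  have A_ge: "(1 - p) * F x \<le> A x" for x
  proof -
    have "(\<Sum>k\<in>{0}. (1 - p) * p ^ k * jump_sum (Suc k) x) \<le> (\<Sum>k. (1 - p) * p ^ k * jump_sum (Suc k) x)"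
      using A_sums[of x] q p_pos jump_sum_nonneg by (intro sum_le_suminf) (auto simp: sums_iff)
    also have "\<dots> = A x" using A_sums[of x] by (simp add: sums_iff)
    finally have "(1 - p) * jump_sum (Suc 0) x \<le> A x" by simp
    moreover have "jump_sum (Suc 0) x = F x"
      by (simp add: jump_sum_def stretch_def expected_customers_def)
    ultimately show ?thesis by simp
  qed
  have A_pos: "0 < A x" for x using A_ge[of x] mult_pos_pos[OF q G.tail_pos[of x]] by linarith
  have PA: "P x - A x = D x * F x" for x
  proof -
    have "(\<lambda>k. ((1 - p) * p ^ k * \<P>(\<omega> in M. x < T (Suc k) \<omega>) - (1 - p) * p ^ k * jump_sum (Suc k) x) / F x) sums ((P x - A x) / F x)"
      by (intro sums_divide sums_diff P_sums A_sums)
    then have "(\<lambda>k. (1 - p) * p ^ k * ((\<P>(\<omega> in M. x < T (Suc k) \<omega>) - jump_sum (Suc k) x) / F x)) sums ((P x - A x) / F x)"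
      by (simp add: right_diff_distrib)
    then have "D x = (P x - A x) / F x" by (simp add: D_def sums_iff)
    then show ?thesis using G.tail_pos[of x] by simp
  qed
  have "((\<lambda>x. P x / A x - 1) \<longlongrightarrow> 0) at_top"
  proof (rule Lim_null_comparison)
    have "((\<lambda>x. \<bar>D x\<bar> / (1 - p)) \<longlongrightarrow> \<bar>0\<bar> / (1 - p)) at_top"
      using sojourn_minus_mixture_negligible q unfolding D_def[symmetric] by (intro tendsto_intros) auto
    then show "((\<lambda>x. \<bar>D x\<bar> / (1 - p)) \<longlongrightarrow> 0) at_top" by simp
    show "\<forall>\<^sub>F x in at_top. norm (P x / A x - 1) \<le> \<bar>D x\<bar> / (1 - p)"
    proof (intro always_eventually allI)
      fix x
      have "P x / A x - 1 = D x * F x / A x" using PA[of x] A_pos[of x] by (simp add: field_simps)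
      then have "norm (P x / A x - 1) = \<bar>D x\<bar> * F x / A x" using A_pos[of x] G.tail_pos[of x] by (simp add: abs_mult abs_divide)
      also have "\<dots> \<le> \<bar>D x\<bar> * F x / ((1 - p) * F x)"
        using A_ge[of x] A_pos[of x] q G.tail_pos[of x] by (intro divide_left_mono mult_nonneg_nonneg mult_pos_pos) auto
      also have "\<dots> = \<bar>D x\<bar> / (1 - p)" using G.tail_pos[of x] by simp
      finally show "norm (P x / A x - 1) \<le> \<bar>D x\<bar> / (1 - p)" .
    qed
  qed
  then have "((\<lambda>x. P x / A x - 1 + 1) \<longlongrightarrow> 0 + 1) at_top" by (intro tendsto_intros)
  then have "((\<lambda>x. P x / A x) \<longlongrightarrow> 1) at_top" by simp
  then have "P \<sim>[at_top] A" by (rule asymp_equivI')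
  then show ?thesis by (simp add: P_def[abs_def] A_def[abs_def])
qed

end

theorem theorem2p1:
  fixes M :: "'a measure"
    and G :: "real measure"
    and a b p q lam r :: real
    and m :: "nat \<Rightarrow> real"
    and \<tau> :: "nat \<Rightarrow> 'a \<Rightarrow> real"
    and \<sigma> :: "nat \<Rightarrow> nat \<Rightarrow> 'a \<Rightarrow> real"
    and NB :: "nat \<Rightarrow> nat \<Rightarrow> 'a \<Rightarrow> nat"
    and K :: "'a \<Rightarrow> nat"
    and \<sigma>\<^sub>0 :: "'a \<Rightarrow> real"
    and X :: "nat \<Rightarrow> 'a \<Rightarrow> nat"
    and U :: "'a \<Rightarrow> real"
  assumes queue: "feedback_queue M G a b p \<tau> \<sigma> NB K"
    and q_def: "q = 1 - p"
    and lam_def: "lam = 1 / a"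
    and r_def: "r = p + lam * b"
    and stable: "lam * b / q < 1"
    and irv: "intermediate_regularly_varying G"
    and X_def: "X = (\<lambda>k \<omega>. queue_behind (\<lambda>n. \<tau> n \<omega>) (\<lambda>k i. \<sigma> k i \<omega>) (\<lambda>k n. NB k n \<omega>) k)"
    and U_def: "U = (\<lambda>\<omega>. sojourn_time (\<lambda>n. \<tau> n \<omega>) (\<lambda>k i. \<sigma> k i \<omega>) (\<lambda>k n. NB k n \<omega>) (K \<omega>))"
    and m_def: "m = (\<lambda>k. (1 - r ^ k) / (1 - r) * (lam * b))"
    and sigma0_measurable: "\<sigma>\<^sub>0 \<in> borel_measurable M"
    and sigma0_distribution: "distr M borel \<sigma>\<^sub>0 = G"
    and sigma0_indep_K: "prob_space.indep_var M borel \<sigma>\<^sub>0 borel (\<lambda>\<omega>. real (K \<omega>))"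
  shows "(\<lambda>x. measure M {\<omega> \<in> space M. U \<omega> > x}) \<sim>[at_top]
         (\<lambda>x. 1 / q * (\<integral>\<omega>. 1 + real (X (K \<omega> - 1) \<omega>) \<partial>M)
              * measure M {\<omega> \<in> space M. (1 + m (K \<omega> - 1)) * \<sigma>\<^sub>0 \<omega> > x})"
proof -
  interpret fq: feedback_queue M G a b p \<tau> \<sigma> NB K by (rule queue)
  have r: "r < 1" using stable fq.p_less_1 by (simp add: q_def r_def pos_divide_less_eq)
  interpret sq: stable_feedback_queue M G a b p \<tau> \<sigma> NB K lam r
    by (intro stable_feedback_queue.intro stable_feedback_queue_axioms.intro queue lam_def r_def r irv)
  have X: "X k \<omega> = sq.X k \<omega>" for k \<omega> by (simp add: X_def sq.X_def)
  have U: "U \<omega> = sq.T (K \<omega>) \<omega>" for \<omega> by (simp add: U_def sq.sojourn_time_eq)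
  have stretch: "1 + m k = sq.stretch k" for k by (simp add: m_def sq.stretch_def sq.backlog_time_def)
  show ?thesis
    using sq.sojourn_tail_asymp[OF sigma0_measurable sigma0_distribution sigma0_indep_K]
    unfolding X U stretch q_def .
qed

end
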